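(* Let $\mathfrak{g}$ be the Kac-Moody algebra over $\mathbb{C}$ associated to the (indecomposable) generalized Cartan matrix $\begin{pmatrix}2&-r\\-s&2\end{pmatrix}$, where $r,s$ are positive integers. Then $\mathcal{H}(\mathfrak{g})\neq\varnothing$ if and only if $rs\le 2$. Moreover: (1) If $r=s=1$, then $\mathcal{H}(\mathfrak{g})=\{M(\mathbf{a},b,S)\mid \mathbf{a}\in(\mathbb{C}^* )^2,\ b\in\mathbb{C},\ S\subseteq\{1,2,3\}\}$. (2) If $r=1,s=2$, then $\mathcal{H}(\mathfrak{g})=\{M(\mathbf{a},S)\mid \mathbf{a}\in(\mathbb{C}^* )^2,\ S\subseteq\{1,2\}\}$. Here $M(\mathbf{a},b,S)$ and $M(\mathbf{a},S)$ are the explicit modules defined in the context.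
   Context: For a generalized Cartan matrix $A=(a_{ij})_{1\le i,j\le l}$ (integer matrix, $a_{ii}=2$, $a_{ij}\le0$ for $i\neq j$, $a_{ij}=0\Leftrightarrow a_{ji}=0$), the Kac-Moody algebra $\mathfrak{g}(A)$ over $\mathbb{C}$ is defined as follows: $\mathfrak{h}$ is a vector space of dimension $2l-\mathrm{rank}A$ with linearly independent simple roots $\alpha_i\in\mathfrak{h}^*$ and linearly independent simple coroots $\alpha_i^\vee\in\mathfrak{h}$, $\alpha_j(\alpha_i^\vee)=a_{ij}$; $\mathfrak{g}(A)$ is the Lie algebra generated by $\mathfrak{h},e_i,f_i$ with $[\mathfrak{h},\mathfrak{h}]=0$, $[h,e_i]=\alpha_i(h)e_i$, $[h,f_i]=-\alpha_i(h)f_i$, $[e_i,f_j]=\delta_{ij}\alpha_i^\vee$, modulo the unique maximal ideal intersecting $\mathfrak{h}$ trivially. $\mathcal{H}(\mathfrak{g})$ is the full subcategory of $\mathfrak{g}$-modules whose restriction to $U(\mathfrak{h})$ is free of rank $1$. Via a free generator, each object is identified with $U(\mathfrak{h})$ with $\mathfrak{h}$ acting by multiplication; an equality such as $\mathcal{H}(\mathfrak{g})=\{\dots\}$ means that each listed module is a $\mathfrak g$-module in $\mathcal{H}(\mathfrak{g})$ and every object of $\mathcal{H}(\mathfrak{g})$ is isomorphic to a listed one. In cases (1) and (2), $A$ is invertible; put $(H_1,H_2)^T=A^{-1}(\alpha_1^\vee,\alpha_2^\vee)^T$, a basis of $\mathfrak{h}$ with $[H_i,e_j]=\delta_{ij}e_j$,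 $[H_i,f_j]=-\delta_{ij}f_j$. Thus $U(\mathfrak{h})=\mathbb{C}[H_1,H_2]$. Let $\sigma_i$ be the algebra automorphism of $\mathbb{C}[H_1,H_2]$ with $\sigma_i(H_j)=H_j-\delta_{ij}$. All modules below have underlying space $\mathbb{C}[H_1,H_2]$, $H_i\cdot g=H_ig$, $e_i\cdot g=E_i\sigma_i(g)$, $f_i\cdot g=F_i\sigma_i^{-1}(g)$, with $E_i,F_i$ as follows; $\mathbf{a}=(a_1,a_2)$. $M(\mathbf{a},b,S)$ (case $r=s=1$, $S\subseteq\{1,2,3\}$, $H_0=H_3:=0$), for $i=1,2$: - if $i,i+1\in S$: $E_i=a_i(H_{i+1}-H_i-b)$, $F_i=a_i^{-1}(H_i-H_{i-1}-b)$; - if $i\in S,i+1\notin S$: $E_i=a_i$, $F_i=a_i^{-1}(H_i-H_{i-1}-b)(H_{i+1}-H_i-b-1)$; - if $i\notin S,i+1\in S$: $E_i=a_i(H_i-H_{i-1}-b-1)(H_{i+1}-H_i-b)$, $F_i=a_i^{-1}$; - if $i,i+1\notin S$: $E_i=a_i(H_i-H_{i-1}-b-1)$, $F_i=a_i^{-1}(H_{i+1}-H_i-b-1)$. $M(\mathbf{a},S)$ (case $r=1,s=2$, $S\subseteq\{1,2\}$): - if $1\in S$: $E_1=a_1$, $F_1=-a_1^{-1}(H_1-\frac12H_2+\frac34)(H_1-\frac12H_2+\frac14)$; - if $1\notin S$: $E_1=-a_1(H_1-\frac12H_2-\frac34)(H_1-\frac12H_2-\frac14)$, $F_1=a_1^{-1}$;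 - if $1,2\in S$: $E_2=a_2(-2H_1+H_2-\frac12)$, $F_2=-a_2^{-1}(H_2+\frac12)$; - if $1\in S,2\notin S$: $E_2=a_2(H_2-\frac12)(2H_1-H_2+\frac12)$, $F_2=a_2^{-1}$; - if $1,2\notin S$: $E_2=a_2(H_2-\frac12)$, $F_2=a_2^{-1}(2H_1-H_2-\frac12)$; - if $1\notin S,2\in S$: $E_2=a_2$, $F_2=a_2^{-1}(H_2+\frac12)(2H_1-H_2-\frac12)$. *)

theory Defs
  imports
    "HOL-Analysis.Analysis"
    "HOL-Computational_Algebra.Polynomial"
begin

section \<open>Complex Lie algebras on explicit carriers\<close>

record 'a lie_alg =
  car :: "'a set"
  lzero :: 'a
  ladd :: "'a \<Rightarrow> 'a \<Rightarrow> 'a"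
  lscale :: "complex \<Rightarrow> 'a \<Rightarrow> 'a"
  lbr :: "'a \<Rightarrow> 'a \<Rightarrow> 'a"

definition lie_ideal :: "'a lie_alg \<Rightarrow> 'a set \<Rightarrow> bool" where
  "lie_ideal L I \<longleftrightarrow>
     I \<subseteq> car L \<and> lzero L \<in> I \<and>
     (\<forall>x\<in>I. \<forall>y\<in>I. ladd L x y \<in> I) \<and>
     (\<forall>c. \<forall>x\<in>I. lscale L c x \<in> I) \<and>
     (\<forall>x\<in>car L. \<forall>y\<in>I. lbr L x y \<in> I)"

definition lie_coset :: "'a lie_alg \<Rightarrow> 'a set \<Rightarrow> 'a \<Rightarrow> 'a set" where
  "lie_coset L I x = {ladd L x i |i. i \<in> I}"

text \<open>The operations are the usual ones on cosets, written without choosing representatives.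
  Adding \<open>I\<close> in the last two is needed to get the whole coset.\<close>

definition lie_quotient :: "'a lie_alg \<Rightarrow> 'a set \<Rightarrow> 'a set lie_alg" where
  "lie_quotient L I =
     \<lparr> car = lie_coset L I ` car L,
       lzero = I,
       ladd = (\<lambda>X Y. {ladd L x y |x y. x \<in> X \<and> y \<in> Y}),
       lscale = (\<lambda>c X. {ladd L (lscale L c x) i |x i. x \<in> X \<and> i \<in> I}),
       lbr = (\<lambda>X Y. {ladd L (lbr L x y) i |x y i. x \<in> X \<and> y \<in> Y \<and> i \<in> I}) \<rparr>"

text \<open>A module is a complex vector space, given by a type \<open>'m\<close> with scalar multiplication \<open>sm\<close>,
  together with an action \<open>\<rho>\<close>, of which only the values on the carrier matter.\<close>

definition lie_module ::
  "'a lie_alg \<Rightarrow> (complex \<Rightarrow> 'm \<Rightarrow> 'm) \<Rightarrow> ('a \<Rightarrow> 'm \<Rightarrow> 'm::ab_group_add) \<Rightarrow> bool" where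
  "lie_module L sm \<rho> \<longleftrightarrow>
     vector_space sm \<and>
     (\<forall>x\<in>car L. Vector_Spaces.linear sm sm (\<rho> x)) \<and>
     (\<forall>x\<in>car L. \<forall>y\<in>car L. \<forall>m. \<rho> (ladd L x y) m = \<rho> x m + \<rho> y m) \<and>
     (\<forall>c. \<forall>x\<in>car L. \<forall>m. \<rho> (lscale L c x) m = sm c (\<rho> x m)) \<and>
     (\<forall>x\<in>car L. \<forall>y\<in>car L. \<forall>m. \<rho> (lbr L x y) m = \<rho> x (\<rho> y m) - \<rho> y (\<rho> x m))"

definition lie_module_iso ::
  "'a lie_alg \<Rightarrow> (complex \<Rightarrow> 'm \<Rightarrow> 'm) \<Rightarrow> ('a \<Rightarrow> 'm \<Rightarrow> 'm::ab_group_add) \<Rightarrow>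
   (complex \<Rightarrow> 'n \<Rightarrow> 'n) \<Rightarrow> ('a \<Rightarrow> 'n \<Rightarrow> 'n::ab_group_add) \<Rightarrow> bool" where
  "lie_module_iso L sm \<rho> sn \<rho>' \<longleftrightarrow>
     (\<exists>\<phi>. Vector_Spaces.linear sm sn \<phi> \<and> bij \<phi> \<and>
          (\<forall>x\<in>car L. \<forall>m. \<phi> (\<rho> x m) = \<rho>' x (\<phi> m)))"


section \<open>Lie algebras presented by generators and relations\<close>

datatype 'x lie_term =
    LGen 'x
  | LZero
  | LAdd "'x lie_term" "'x lie_term"
  | LScale complex "'x lie_term"
  | LBr "'x lie_term" "'x lie_term"

text \<open>The least congruence that contains the relations \<open>R\<close> and makes the terms a Lie algebra.\<close>

inductive lie_eq :: "('x lie_term \<times> 'x lie_term) set \<Rightarrow> 'x lie_term \<Rightarrow> 'x lie_term \<Rightarrow> bool"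
  for R where
  rel: "(s, t) \<in> R \<Longrightarrow> lie_eq R s t"
| refl: "lie_eq R t t"
| sym: "lie_eq R s t \<Longrightarrow> lie_eq R t s"
| trans: "lie_eq R s t \<Longrightarrow> lie_eq R t u \<Longrightarrow> lie_eq R s u"
| cong_add: "lie_eq R s s' \<Longrightarrow> lie_eq R t t' \<Longrightarrow> lie_eq R (LAdd s t) (LAdd s' t')"
| cong_scale: "lie_eq R t t' \<Longrightarrow> lie_eq R (LScale c t) (LScale c t')"
| cong_br: "lie_eq R s s' \<Longrightarrow> lie_eq R t t' \<Longrightarrow> lie_eq R (LBr s t) (LBr s' t')"
| add_assoc: "lie_eq R (LAdd (LAdd s t) u) (LAdd s (LAdd t u))"
| add_comm: "lie_eq R (LAdd s t) (LAdd t s)"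
| add_zero: "lie_eq R (LAdd LZero t) t"
| add_neg: "lie_eq R (LAdd t (LScale (-1) t)) LZero"
| scale_add: "lie_eq R (LScale c (LAdd s t)) (LAdd (LScale c s) (LScale c t))"
| add_scale: "lie_eq R (LScale (c + d) t) (LAdd (LScale c t) (LScale d t))"
| scale_scale: "lie_eq R (LScale c (LScale d t)) (LScale (c * d) t)"
| scale_one: "lie_eq R (LScale 1 t) t"
| br_add_left: "lie_eq R (LBr (LAdd s t) u) (LAdd (LBr s u) (LBr t u))"
| br_add_right: "lie_eq R (LBr u (LAdd s t)) (LAdd (LBr u s) (LBr u t))"
| br_scale_left: "lie_eq R (LBr (LScale c s) t) (LScale c (LBr s t))"
| br_scale_right: "lie_eq R (LBr s (LScale c t)) (LScale c (LBr s t))"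
| br_self: "lie_eq R (LBr t t) LZero"
| jacobi: "lie_eq R (LAdd (LBr s (LBr t u)) (LAdd (LBr t (LBr u s)) (LBr u (LBr s t)))) LZero"

definition lie_class :: "('x lie_term \<times> 'x lie_term) set \<Rightarrow> 'x lie_term \<Rightarrow> 'x lie_term set" where
  "lie_class R t = {u. lie_eq R t u}"

definition lie_presented :: "('x lie_term \<times> 'x lie_term) set \<Rightarrow> 'x lie_term set lie_alg" where
  "lie_presented R =
     \<lparr> car = range (lie_class R),
       lzero = lie_class R LZero,
       ladd = (\<lambda>X Y. {u. \<exists>s\<in>X. \<exists>t\<in>Y. lie_eq R (LAdd s t) u}),
       lscale = (\<lambda>c X. {u. \<exists>t\<in>X. lie_eq R (LScale c t) u}),
       lbr = (\<lambda>X Y. {u. \<exists>s\<in>X. \<exists>t\<in>Y. lie_eq R (LBr s t) u}) \<rparr>"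


section \<open>Enveloping algebras and freeness of rank one\<close>

datatype 'x env_term =
    UGen 'x
  | UZero
  | UOne
  | UAdd "'x env_term" "'x env_term"
  | UScale complex "'x env_term"
  | UMult "'x env_term" "'x env_term"

text \<open>Equality in the universal enveloping algebra of the Lie algebra on the type \<open>'x\<close> with
  scalar multiplication \<open>sc\<close> and bracket \<open>br\<close>: the associative unital algebra generated by \<open>'x\<close>
  with the linear relations of \<open>'x\<close> and \<open>x y - y x = br x y\<close>.\<close>

inductive env_eq ::
  "(complex \<Rightarrow> 'x \<Rightarrow> 'x) \<Rightarrow> ('x \<Rightarrow> 'x \<Rightarrow> 'x::ab_group_add) \<Rightarrow> 'x env_term \<Rightarrow> 'x env_term \<Rightarrow> bool"
  for sc br where
  gen_add: "env_eq sc br (UGen (x + y)) (UAdd (UGen x) (UGen y))"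
| gen_scale: "env_eq sc br (UGen (sc c x)) (UScale c (UGen x))"
| gen_br: "env_eq sc br (UAdd (UMult (UGen x) (UGen y)) (UScale (-1) (UMult (UGen y) (UGen x))))
             (UGen (br x y))"
| refl: "env_eq sc br t t"
| sym: "env_eq sc br s t \<Longrightarrow> env_eq sc br t s"
| trans: "env_eq sc br s t \<Longrightarrow> env_eq sc br t u \<Longrightarrow> env_eq sc br s u"
| cong_add: "env_eq sc br s s' \<Longrightarrow> env_eq sc br t t' \<Longrightarrow> env_eq sc br (UAdd s t) (UAdd s' t')"
| cong_scale: "env_eq sc br t t' \<Longrightarrow> env_eq sc br (UScale c t) (UScale c t')"
| cong_mult: "env_eq sc br s s' \<Longrightarrow> env_eq sc br t t' \<Longrightarrow> env_eq sc br (UMult s t) (UMult s' t')"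
| add_assoc: "env_eq sc br (UAdd (UAdd s t) u) (UAdd s (UAdd t u))"
| add_comm: "env_eq sc br (UAdd s t) (UAdd t s)"
| add_zero: "env_eq sc br (UAdd UZero t) t"
| add_neg: "env_eq sc br (UAdd t (UScale (-1) t)) UZero"
| scale_add: "env_eq sc br (UScale c (UAdd s t)) (UAdd (UScale c s) (UScale c t))"
| add_scale: "env_eq sc br (UScale (c + d) t) (UAdd (UScale c t) (UScale d t))"
| scale_scale: "env_eq sc br (UScale c (UScale d t)) (UScale (c * d) t)"
| scale_one: "env_eq sc br (UScale 1 t) t"
| mult_assoc: "env_eq sc br (UMult (UMult s t) u) (UMult s (UMult t u))"
| mult_one_left: "env_eq sc br (UMult UOne t) t"
| mult_one_right: "env_eq sc br (UMult t UOne) t"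
| mult_add_left: "env_eq sc br (UMult (UAdd s t) u) (UAdd (UMult s u) (UMult t u))"
| mult_add_right: "env_eq sc br (UMult u (UAdd s t)) (UAdd (UMult u s) (UMult u t))"
| mult_scale_left: "env_eq sc br (UMult (UScale c s) t) (UScale c (UMult s t))"
| mult_scale_right: "env_eq sc br (UMult s (UScale c t)) (UScale c (UMult s t))"

primrec env_act ::
  "(complex \<Rightarrow> 'm \<Rightarrow> 'm) \<Rightarrow> ('x \<Rightarrow> 'm \<Rightarrow> 'm::ab_group_add) \<Rightarrow> 'x env_term \<Rightarrow> 'm \<Rightarrow> 'm" where
  "env_act sm \<rho> (UGen x) m = \<rho> x m"
| "env_act sm \<rho> UZero m = 0"
| "env_act sm \<rho> UOne m = m"
| "env_act sm \<rho> (UAdd s t) m = env_act sm \<rho> s m + env_act sm \<rho> t m"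
| "env_act sm \<rho> (UScale c t) m = sm c (env_act sm \<rho> t m)"
| "env_act sm \<rho> (UMult s t) m = env_act sm \<rho> s (env_act sm \<rho> t m)"

text \<open>A free generator \<open>v\<close>: the map \<open>u \<mapsto> u \<cdot> v\<close> from the enveloping algebra to the module is
  surjective and has zero kernel.\<close>

definition free_rank_one ::
  "(complex \<Rightarrow> 'x \<Rightarrow> 'x) \<Rightarrow> ('x \<Rightarrow> 'x \<Rightarrow> 'x::ab_group_add) \<Rightarrow>
   (complex \<Rightarrow> 'm \<Rightarrow> 'm) \<Rightarrow> ('x \<Rightarrow> 'm \<Rightarrow> 'm::ab_group_add) \<Rightarrow> bool" where
  "free_rank_one sc br sm \<rho> \<longleftrightarrow>
     (\<exists>v. (\<forall>m. \<exists>u. env_act sm \<rho> u v = m) \<and>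
          (\<forall>u. env_act sm \<rho> u v = 0 \<longrightarrow> env_eq sc br u UZero))"


section \<open>Kac-Moody algebras\<close>

definition complex_mat :: "int^'n^'m \<Rightarrow> complex^'n^'m" where
  "complex_mat A = (\<chi> i j. of_int (A $ i $ j))"

text \<open>\<open>\<alpha> i\<close> is the simple root and \<open>\<alpha>v i\<close> the simple coroot.  An infinite-dimensional
  space has \<open>dim\<close> equal to 0 and is excluded, the prescribed dimension being positive.\<close>

definition realization ::
  "int^'n^'n \<Rightarrow> (complex \<Rightarrow> 'h \<Rightarrow> 'h::ab_group_add) \<Rightarrow> ('n::finite \<Rightarrow> 'h \<Rightarrow> complex) \<Rightarrow> ('n \<Rightarrow> 'h) \<Rightarrow> bool"
  where
  "realization A sh \<alpha> \<alpha>v \<longleftrightarrow>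
     vector_space sh \<and>
     vector_space.dim sh (UNIV :: 'h set) = 2 * CARD('n) - rank (complex_mat A) \<and>
     (\<forall>i. Vector_Spaces.linear sh (*) (\<alpha> i)) \<and>
     (\<forall>c. (\<forall>x. (\<Sum>i\<in>UNIV. c i * \<alpha> i x) = 0) \<longrightarrow> (\<forall>i. c i = 0)) \<and>
     (\<forall>c. (\<Sum>i\<in>UNIV. sh (c i) (\<alpha>v i)) = 0 \<longrightarrow> (\<forall>i. c i = 0)) \<and>
     (\<forall>i j. \<alpha> j (\<alpha>v i) = of_int (A $ i $ j))"

datatype ('h, 'n) km_gen = KH 'h | KE 'n | KF 'n

inductive_set km_rels ::
  "(complex \<Rightarrow> 'h \<Rightarrow> 'h::ab_group_add) \<Rightarrow> ('n \<Rightarrow> 'h \<Rightarrow> complex) \<Rightarrow> ('n \<Rightarrow> 'h) \<Rightarrow>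
   (('h, 'n) km_gen lie_term \<times> ('h, 'n) km_gen lie_term) set"
  for sh \<alpha> \<alpha>v where
  h_add: "(LGen (KH (x + y)), LAdd (LGen (KH x)) (LGen (KH y))) \<in> km_rels sh \<alpha> \<alpha>v"
| h_scale: "(LGen (KH (sh c x)), LScale c (LGen (KH x))) \<in> km_rels sh \<alpha> \<alpha>v"
| h_h: "(LBr (LGen (KH x)) (LGen (KH y)), LZero) \<in> km_rels sh \<alpha> \<alpha>v"
| h_e: "(LBr (LGen (KH x)) (LGen (KE i)), LScale (\<alpha> i x) (LGen (KE i))) \<in> km_rels sh \<alpha> \<alpha>v"
| h_f: "(LBr (LGen (KH x)) (LGen (KF i)), LScale (- \<alpha> i x) (LGen (KF i))) \<in> km_rels sh \<alpha> \<alpha>v"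
| e_f: "(LBr (LGen (KE i)) (LGen (KF j)), if i = j then LGen (KH (\<alpha>v i)) else LZero)
          \<in> km_rels sh \<alpha> \<alpha>v"

definition km_tilde ::
  "(complex \<Rightarrow> 'h \<Rightarrow> 'h::ab_group_add) \<Rightarrow> ('n \<Rightarrow> 'h \<Rightarrow> complex) \<Rightarrow> ('n \<Rightarrow> 'h) \<Rightarrow>
   ('h, 'n) km_gen lie_term set lie_alg" where
  "km_tilde sh \<alpha> \<alpha>v = lie_presented (km_rels sh \<alpha> \<alpha>v)"

definition km_tilde_gen ::
  "(complex \<Rightarrow> 'h \<Rightarrow> 'h::ab_group_add) \<Rightarrow> ('n \<Rightarrow> 'h \<Rightarrow> complex) \<Rightarrow> ('n \<Rightarrow> 'h) \<Rightarrow>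
   ('h, 'n) km_gen \<Rightarrow> ('h, 'n) km_gen lie_term set" where
  "km_tilde_gen sh \<alpha> \<alpha>v z = lie_class (km_rels sh \<alpha> \<alpha>v) (LGen z)"

definition km_h_trivial_ideal ::
  "(complex \<Rightarrow> 'h \<Rightarrow> 'h::ab_group_add) \<Rightarrow> ('n \<Rightarrow> 'h \<Rightarrow> complex) \<Rightarrow> ('n \<Rightarrow> 'h) \<Rightarrow>
   ('h, 'n) km_gen lie_term set set \<Rightarrow> bool" where
  "km_h_trivial_ideal sh \<alpha> \<alpha>v I \<longleftrightarrow>
     lie_ideal (km_tilde sh \<alpha> \<alpha>v) I \<and>
     I \<inter> range (\<lambda>x. km_tilde_gen sh \<alpha> \<alpha>v (KH x)) = {lzero (km_tilde sh \<alpha> \<alpha>v)}"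

text \<open>By a theorem of Kac there is exactly one maximal such ideal.\<close>

definition km_radical ::
  "(complex \<Rightarrow> 'h \<Rightarrow> 'h::ab_group_add) \<Rightarrow> ('n \<Rightarrow> 'h \<Rightarrow> complex) \<Rightarrow> ('n \<Rightarrow> 'h) \<Rightarrow>
   ('h, 'n) km_gen lie_term set set" where
  "km_radical sh \<alpha> \<alpha>v =
     (THE I. km_h_trivial_ideal sh \<alpha> \<alpha>v I \<and>
        (\<forall>J. km_h_trivial_ideal sh \<alpha> \<alpha>v J \<longrightarrow> I \<subseteq> J \<longrightarrow> J = I))"

definition kac_moody ::
  "(complex \<Rightarrow> 'h \<Rightarrow> 'h::ab_group_add) \<Rightarrow> ('n \<Rightarrow> 'h \<Rightarrow> complex) \<Rightarrow> ('n \<Rightarrow> 'h) \<Rightarrow>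
   ('h, 'n) km_gen lie_term set set lie_alg" where
  "kac_moody sh \<alpha> \<alpha>v = lie_quotient (km_tilde sh \<alpha> \<alpha>v) (km_radical sh \<alpha> \<alpha>v)"

definition km_elem ::
  "(complex \<Rightarrow> 'h \<Rightarrow> 'h::ab_group_add) \<Rightarrow> ('n \<Rightarrow> 'h \<Rightarrow> complex) \<Rightarrow> ('n \<Rightarrow> 'h) \<Rightarrow>
   ('h, 'n) km_gen \<Rightarrow> ('h, 'n) km_gen lie_term set set" where
  "km_elem sh \<alpha> \<alpha>v z =
     lie_coset (km_tilde sh \<alpha> \<alpha>v) (km_radical sh \<alpha> \<alpha>v) (km_tilde_gen sh \<alpha> \<alpha>v z)"

text \<open>The objects of the category \<open>\<H>(\<gg>)\<close>; the Cartan subalgebra is abelian.\<close>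

definition in_H ::
  "(complex \<Rightarrow> 'h \<Rightarrow> 'h::ab_group_add) \<Rightarrow> ('n \<Rightarrow> 'h \<Rightarrow> complex) \<Rightarrow> ('n \<Rightarrow> 'h) \<Rightarrow>
   (complex \<Rightarrow> 'm \<Rightarrow> 'm) \<Rightarrow>
   (('h, 'n) km_gen lie_term set set \<Rightarrow> 'm \<Rightarrow> 'm::ab_group_add) \<Rightarrow> bool" where
  "in_H sh \<alpha> \<alpha>v sm \<rho> \<longleftrightarrow>
     lie_module (kac_moody sh \<alpha> \<alpha>v) sm \<rho> \<and>
     free_rank_one sh (\<lambda>_ _. 0) sm (\<lambda>x. \<rho> (km_elem sh \<alpha> \<alpha>v (KH x)))"


section \<open>Modules on the polynomial ring in two variables\<close>

text \<open>\<open>\<complex>[H\<^sub>1, H\<^sub>2]\<close> is \<open>complex poly poly\<close>, the inner variable being \<open>H\<^sub>1\<close> and the outer one \<open>H\<^sub>2\<close>.\<close>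

type_synonym poly2 = "complex poly poly"

definition const2 :: "complex \<Rightarrow> poly2" where
  "const2 c = [:[:c:]:]"

definition scale2 :: "complex \<Rightarrow> poly2 \<Rightarrow> poly2" where
  "scale2 c p = const2 c * p"

definition Hvar :: "nat \<Rightarrow> poly2" where
  "Hvar i = (if i = 1 then [:[:0, 1:]:] else if i = 2 then [:0, 1:] else 0)"

text \<open>The algebra endomorphism \<open>H\<^sub>i \<mapsto> H\<^sub>i + c\<close> fixing the other variable, for \<open>i \<in> {1, 2}\<close>; thus
  \<open>\<sigma>\<^sub>i = shift2 i (-1)\<close> and its inverse is \<open>shift2 i 1\<close>.\<close>

definition shift2 :: "nat \<Rightarrow> complex \<Rightarrow> poly2 \<Rightarrow> poly2" where
  "shift2 i c p =
     (if i = 1 then map_poly (\<lambda>q. pcompose q [:c, 1:]) p else pcompose p [:[:c:], 1:])"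

definition cartan2 :: "nat \<Rightarrow> nat \<Rightarrow> int^2^2" where
  "cartan2 r s = vector [vector [2, - int r], vector [- int s, 2]]"

text \<open>The vectors \<open>A\<inverse> (\<alpha>v)\<close> of the Cartan subalgebra, for invertible \<open>A\<close>.\<close>

definition dual_coroot ::
  "int^'n^'n \<Rightarrow> (complex \<Rightarrow> 'h \<Rightarrow> 'h::ab_group_add) \<Rightarrow> ('n::finite \<Rightarrow> 'h) \<Rightarrow> 'n \<Rightarrow> 'h" where
  "dual_coroot A sh \<alpha>v i = (\<Sum>j\<in>UNIV. sh (matrix_inv (complex_mat A) $ i $ j) (\<alpha>v j))"

text \<open>The action \<open>\<rho>\<close> on \<open>\<complex>[H\<^sub>1, H\<^sub>2]\<close> is given on generators by the polynomials \<open>E\<close>, \<open>F\<close>.  The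
  index type \<open>2\<close> has the elements 1 and 2 (the latter being equal to 0), whence \<open>of_nat\<close>.  As the
  algebra is generated by the elements mentioned, they determine a module structure uniquely.\<close>

definition acts_by ::
  "int^2^2 \<Rightarrow> (complex \<Rightarrow> 'h \<Rightarrow> 'h::ab_group_add) \<Rightarrow> (2 \<Rightarrow> 'h \<Rightarrow> complex) \<Rightarrow> (2 \<Rightarrow> 'h) \<Rightarrow>
   (nat \<Rightarrow> poly2) \<Rightarrow> (nat \<Rightarrow> poly2) \<Rightarrow>
   (('h, 2) km_gen lie_term set set \<Rightarrow> poly2 \<Rightarrow> poly2) \<Rightarrow> bool" where
  "acts_by A sh \<alpha> \<alpha>v E F \<rho> \<longleftrightarrow>
     (\<forall>i\<in>{1, 2::nat}. \<forall>g.
        \<rho> (km_elem sh \<alpha> \<alpha>v (KH (dual_coroot A sh \<alpha>v (of_nat i)))) g = Hvar i * g \<and>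
        \<rho> (km_elem sh \<alpha> \<alpha>v (KE (of_nat i))) g = E i * shift2 i (-1) g \<and>
        \<rho> (km_elem sh \<alpha> \<alpha>v (KF (of_nat i))) g = F i * shift2 i 1 g)"

definition E_A2 :: "complex^2 \<Rightarrow> complex \<Rightarrow> nat set \<Rightarrow> nat \<Rightarrow> poly2" where
  "E_A2 a b S i = const2 (a $ of_nat i) *
     (if i \<in> S \<and> i + 1 \<in> S then Hvar (i + 1) - Hvar i - const2 b
      else if i \<in> S then 1
      else if i + 1 \<in> S then
        (Hvar i - Hvar (i - 1) - const2 b - 1) * (Hvar (i + 1) - Hvar i - const2 b)
      else Hvar i - Hvar (i - 1) - const2 b - 1)"

definition F_A2 :: "complex^2 \<Rightarrow> complex \<Rightarrow> nat set \<Rightarrow> nat \<Rightarrow> poly2" where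
  "F_A2 a b S i = const2 (inverse (a $ of_nat i)) *
     (if i \<in> S \<and> i + 1 \<in> S then Hvar i - Hvar (i - 1) - const2 b
      else if i \<in> S then
        (Hvar i - Hvar (i - 1) - const2 b) * (Hvar (i + 1) - Hvar i - const2 b - 1)
      else if i + 1 \<in> S then 1
      else Hvar (i + 1) - Hvar i - const2 b - 1)"

definition is_M_A2 ::
  "(complex \<Rightarrow> 'h \<Rightarrow> 'h::ab_group_add) \<Rightarrow> (2 \<Rightarrow> 'h \<Rightarrow> complex) \<Rightarrow> (2 \<Rightarrow> 'h) \<Rightarrow>
   complex^2 \<Rightarrow> complex \<Rightarrow> nat set \<Rightarrow>
   (('h, 2) km_gen lie_term set set \<Rightarrow> poly2 \<Rightarrow> poly2) \<Rightarrow> bool" where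
  "is_M_A2 sh \<alpha> \<alpha>v a b S \<rho> \<longleftrightarrow> acts_by (cartan2 1 1) sh \<alpha> \<alpha>v (E_A2 a b S) (F_A2 a b S) \<rho>"

definition E_B2 :: "complex^2 \<Rightarrow> nat set \<Rightarrow> nat \<Rightarrow> poly2" where
  "E_B2 a S i =
     (if i = 1 then
        (if 1 \<in> S then const2 (a $ 1)
         else - const2 (a $ 1) * (Hvar 1 - const2 (1/2) * Hvar 2 - const2 (3/4))
                * (Hvar 1 - const2 (1/2) * Hvar 2 - const2 (1/4)))
      else
        const2 (a $ 2) *
        (if 1 \<in> S \<and> 2 \<in> S then - 2 * Hvar 1 + Hvar 2 - const2 (1/2)
         else if 1 \<in> S then (Hvar 2 - const2 (1/2)) * (2 * Hvar 1 - Hvar 2 + const2 (1/2))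
         else if 2 \<in> S then 1
         else Hvar 2 - const2 (1/2)))"

definition F_B2 :: "complex^2 \<Rightarrow> nat set \<Rightarrow> nat \<Rightarrow> poly2" where
  "F_B2 a S i =
     (if i = 1 then
        (if 1 \<in> S then
           - const2 (inverse (a $ 1)) * (Hvar 1 - const2 (1/2) * Hvar 2 + const2 (3/4))
             * (Hvar 1 - const2 (1/2) * Hvar 2 + const2 (1/4))
         else const2 (inverse (a $ 1)))
      else
        const2 (inverse (a $ 2)) *
        (if 1 \<in> S \<and> 2 \<in> S then - (Hvar 2 + const2 (1/2))
         else if 1 \<in> S then 1
         else if 2 \<in> S then (Hvar 2 + const2 (1/2)) * (2 * Hvar 1 - Hvar 2 - const2 (1/2))
         else 2 * Hvar 1 - Hvar 2 - const2 (1/2)))"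

definition is_M_B2 ::
  "(complex \<Rightarrow> 'h \<Rightarrow> 'h::ab_group_add) \<Rightarrow> (2 \<Rightarrow> 'h \<Rightarrow> complex) \<Rightarrow> (2 \<Rightarrow> 'h) \<Rightarrow>
   complex^2 \<Rightarrow> nat set \<Rightarrow>
   (('h, 2) km_gen lie_term set set \<Rightarrow> poly2 \<Rightarrow> poly2) \<Rightarrow> bool" where
  "is_M_B2 sh \<alpha> \<alpha>v a S \<rho> \<longleftrightarrow> acts_by (cartan2 1 2) sh \<alpha> \<alpha>v (E_B2 a S) (F_B2 a S) \<rho>"

end

theory Submission
  imports Defs
begin

text \<open>
  On a module in \<open>\<H>(\<gg>)\<close> the generators act by \<open>e\<^sub>i = E\<^sub>i \<sigma>\<^sub>i\<close> and \<open>f\<^sub>i = F\<^sub>i \<sigma>\<^sub>i\<inverse>\<close> with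
  polynomials \<open>E\<^sub>i\<close>, \<open>F\<^sub>i\<close>. Put \<open>G\<^sub>i = E\<^sub>i \<sigma>\<^sub>i(F\<^sub>i)\<close>. The relation \<open>[e\<^sub>i, f\<^sub>i] = \<alpha>\<^sub>i\<^sup>\<or>\<close> determines
  \<open>G\<^sub>i\<close> up to a polynomial \<open>c\<^sub>i\<close> that is invariant under \<open>\<sigma>\<^sub>i\<close>, and \<open>[e\<^sub>1, f\<^sub>2] = [e\<^sub>2, f\<^sub>1] = 0\<close>
  gives the exchange equation \<open>G\<^sub>1 G\<^sub>2 = \<sigma>\<^sub>1(G\<^sub>2) \<sigma>\<^sub>2(G\<^sub>1)\<close>. Comparing coefficients bounds the
  degrees of \<open>c\<^sub>1\<close>, \<open>c\<^sub>2\<close> by 2, forces \<open>r s \<le> 2\<close> and determines \<open>G\<^sub>1\<close>, \<open>G\<^sub>2\<close>; they are products of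
  linear factors, and the ways of distributing the factors over \<open>E\<^sub>i\<close> and \<open>F\<^sub>i\<close> are the listed
  modules.

  Conversely, the maximal ideal of the presented Lie algebra must be shown to annihilate these
  modules. They satisfy the Serre relations and the Cartan subalgebra acts faithfully; modulo the
  annihilator the algebra is spanned by the Cartan subalgebra and at most eight root vectors, from
  each of which a nonzero element of the Cartan subalgebra is reached by brackets, so that no
  nonzero ideal meets the Cartan subalgebra trivially.\<close>

section \<open>The free Lie algebra and presentations\<close>

\<comment> \<open>The coefficient comparison alone does not exclude r = s = 2: it leaves the
  specializations in which \<open>\<alpha>v 1 + \<alpha>v 2\<close>, central in that case, becomes
  0. For a singular Cartan matrix the Cartan subalgebra is larger than two-dimensional, and its
  enveloping algebra is mapped to polynomials by sending h to
  \<open>\<alpha> 1 h * H1 + \<alpha> 2 h * H2 + \<nu> h\<close> with a linear functional \<nu>.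
  Passing a root vector across h shifts only H1 or H2, so the relations survive for every \<nu>, and
  a \<nu> that is nonzero on the coroot sum settles the remaining case. The radical is a definite
  description, so the existence and uniqueness of the maximal ideal have to be proved before
  anything can be said about modules. All Lie algebras that occur are quotients of one free Lie
  algebra and are handled through ideals of it: an equation becomes a membership
  \<open>x - y \<in> I\<close>, and classes of terms appear only where the given definitions are
  translated.\<close>
quotient_type 'x free_lie = "'x lie_term" / "lie_eq {}"
  by (rule equivpI)
    (auto intro!: reflpI sympI transpI intro: lie_eq.refl lie_eq.sym lie_eq.trans)

instantiation free_lie :: (type) ab_group_add
begin

lift_definition zero_free_lie :: "'a free_lie" is LZero .

lift_definition plus_free_lie :: "'a free_lie \<Rightarrow> 'a free_lie \<Rightarrow> 'a free_lie" is LAdd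
  by (rule lie_eq.cong_add)

lift_definition uminus_free_lie :: "'a free_lie \<Rightarrow> 'a free_lie" is "LScale (-1)"
  by (rule lie_eq.cong_scale)

definition minus_free_lie :: "'a free_lie \<Rightarrow> 'a free_lie \<Rightarrow> 'a free_lie" where
  "minus_free_lie x y = x + - y"

instance
proof
  fix a b c :: "'a free_lie"
  show "a + b + c = a + (b + c)"
    by transfer (rule lie_eq.add_assoc)
  show "a + b = b + a"
    by transfer (rule lie_eq.add_comm)
  show "0 + a = a"
    by transfer (rule lie_eq.add_zero)
  show "- a + a = 0"
    by transfer (meson lie_eq.add_comm lie_eq.add_neg lie_eq.trans)
  show "a - b = a + - b"
    by (rule minus_free_lie_def)
qed

end

lift_definition fscale :: "complex \<Rightarrow> 'x free_lie \<Rightarrow> 'x free_lie" is LScale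
  by (rule lie_eq.cong_scale)

lift_definition fbr :: "'x free_lie \<Rightarrow> 'x free_lie \<Rightarrow> 'x free_lie" is LBr
  by (rule lie_eq.cong_br)

lift_definition fgen :: "'x \<Rightarrow> 'x free_lie" is LGen .

lift_definition cls :: "'x lie_term \<Rightarrow> 'x free_lie" is "\<lambda>t. t" .

global_interpretation free_lie: vector_space fscale
proof
  fix a b :: complex and x y :: "'x free_lie"
  show "fscale a (x + y) = fscale a x + fscale a y"
    by transfer (rule lie_eq.scale_add)
  show "fscale (a + b) x = fscale a x + fscale b x"
    by transfer (rule lie_eq.add_scale)
  show "fscale a (fscale b x) = fscale (a * b) x"
    by transfer (rule lie_eq.scale_scale)
  show "fscale 1 x = x"
    by transfer (rule lie_eq.scale_one)
qed

lemma fbr_add_left: "fbr (x + y) z = fbr x z + fbr y z"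
  by transfer (rule lie_eq.br_add_left)

lemma fbr_add_right: "fbr z (x + y) = fbr z x + fbr z y"
  by transfer (rule lie_eq.br_add_right)

lemma fbr_scale_left: "fbr (fscale c x) y = fscale c (fbr x y)"
  by transfer (rule lie_eq.br_scale_left)

lemma fbr_scale_right: "fbr x (fscale c y) = fscale c (fbr x y)"
  by transfer (rule lie_eq.br_scale_right)

lemma fbr_self [simp]: "fbr x x = 0"
  by transfer (rule lie_eq.br_self)

lemma fbr_jacobi: "fbr x (fbr y z) + (fbr y (fbr z x) + fbr z (fbr x y)) = 0"
  by transfer (rule lie_eq.jacobi)

lemma fbr_zero_left [simp]: "fbr 0 x = 0"
  using fbr_add_left[of 0 0 x] by simp

lemma fbr_zero_right [simp]: "fbr x 0 = 0"
  using fbr_add_right[of x 0 0] by simp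

lemma fbr_minus_left: "fbr (- x) y = - fbr x y"
  using fbr_add_left[of "- x" x y] by (simp add: eq_neg_iff_add_eq_0)

lemma fbr_minus_right: "fbr x (- y) = - fbr x y"
  using fbr_add_right[of x "- y" y] by (simp add: eq_neg_iff_add_eq_0)

lemma fbr_diff_left: "fbr (x - y) z = fbr x z - fbr y z"
  using fbr_add_left[of x "- y" z] by (simp add: fbr_minus_left)

lemma fbr_diff_right: "fbr z (x - y) = fbr z x - fbr z y"
  using fbr_add_right[of z x "- y"] by (simp add: fbr_minus_right)

lemma fbr_anticomm: "fbr y x = - fbr x y"
proof -
  have "fbr x x + fbr x y + (fbr y x + fbr y y) = 0"
    using fbr_self[of "x + y"] by (simp only: fbr_add_left fbr_add_right add.assoc add.left_commute)
  then show ?thesis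
    by (simp add: add_eq_0_iff)
qed

lemma fbr_derivation: "fbr x (fbr y z) = fbr (fbr x y) z + fbr y (fbr x z)"
proof -
  have "fbr x (fbr y z) = - (fbr y (fbr z x) + fbr z (fbr x y))"
    using fbr_jacobi[of x y z] by (simp only: eq_neg_iff_add_eq_0)
  also have "\<dots> = fbr (fbr x y) z + fbr y (fbr x z)"
    using fbr_anticomm[of z x] fbr_anticomm[of z "fbr x y"] by (simp add: fbr_minus_right)
  finally show ?thesis .
qed

lemma cls_simps [simp]:
  "cls (LGen z) = fgen z" "cls LZero = 0" "cls (LAdd s t) = cls s + cls t"
  "cls (LScale c t) = fscale c (cls t)" "cls (LBr s t) = fbr (cls s) (cls t)"
  by (transfer, rule lie_eq.refl)+

lemma cls_surj: "\<exists>t. x = cls t"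
  by transfer (blast intro: lie_eq.refl)

lemma cls_eq_iff: "cls s = cls t \<longleftrightarrow> lie_eq {} s t"
  by transfer simp

lemma free_lie_induct [case_names gen zero add scale br]:
  assumes "\<And>z. P (fgen z)" "P 0" "\<And>x y. P x \<Longrightarrow> P y \<Longrightarrow> P (x + y)"
    "\<And>c x. P x \<Longrightarrow> P (fscale c x)" "\<And>x y. P x \<Longrightarrow> P y \<Longrightarrow> P (fbr x y)"
  shows "P x"
proof -
  obtain t where "x = cls t"
    using cls_surj by blast
  moreover have "P (cls t)"
    by (induction t) (auto intro: assms)
  ultimately show ?thesis
    by simp
qed

section \<open>Ideals of the free Lie algebra and congruence modulo an ideal\<close>

definition fideal :: "'x free_lie set \<Rightarrow> bool" where
  "fideal I \<longleftrightarrow> 0 \<in> I \<and> (\<forall>x\<in>I. \<forall>y\<in>I. x + y \<in> I) \<and> (\<forall>c. \<forall>x\<in>I. fscale c x \<in> I) \<and>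
     (\<forall>x. \<forall>y\<in>I. fbr x y \<in> I)"

lemma
  assumes "fideal I"
  shows fideal_zero: "0 \<in> I"
    and fideal_add: "\<And>x y. x \<in> I \<Longrightarrow> y \<in> I \<Longrightarrow> x + y \<in> I"
    and fideal_scale: "\<And>c x. x \<in> I \<Longrightarrow> fscale c x \<in> I"
    and fideal_br_right: "\<And>x y. y \<in> I \<Longrightarrow> fbr x y \<in> I"
  using assms by (auto simp: fideal_def)

lemma fideal_minus: "fideal I \<Longrightarrow> x \<in> I \<Longrightarrow> - x \<in> I"
  using fideal_scale[of I x "- 1"] by simp

lemma fideal_minus_iff: "fideal I \<Longrightarrow> - x \<in> I \<longleftrightarrow> x \<in> I"
  using fideal_minus by fastforce

lemma fideal_diff: "fideal I \<Longrightarrow> x \<in> I \<Longrightarrow> y \<in> I \<Longrightarrow> x - y \<in> I"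
  using fideal_add[of I x "- y"] fideal_minus[of I y] by simp

lemma fideal_br_left: "fideal I \<Longrightarrow> x \<in> I \<Longrightarrow> fbr x y \<in> I"
  using fbr_anticomm[of x y] by (simp add: fideal_minus fideal_br_right)

lemma fideal_scale_iff:
  assumes "fideal I" "c \<noteq> 0" shows "fscale c x \<in> I \<longleftrightarrow> x \<in> I"
proof
  assume "fscale c x \<in> I"
  then have "fscale (inverse c) (fscale c x) \<in> I"
    using assms fideal_scale by blast
  then show "x \<in> I"
    using assms by simp
qed (use assms fideal_scale in blast)

lemma fideal_cong: "fideal I \<Longrightarrow> x - y \<in> I \<Longrightarrow> x \<in> I \<longleftrightarrow> y \<in> I"
  using fideal_add[of I "x - y" y] fideal_diff[of I x "x - y"] by auto

lemma fideal_sym: "fideal I \<Longrightarrow> x - y \<in> I \<Longrightarrow> y - x \<in> I"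
  using fideal_minus[of I "x - y"] by simp

lemma fideal_trans: "fideal I \<Longrightarrow> x - y \<in> I \<Longrightarrow> y - z \<in> I \<Longrightarrow> x - z \<in> I"
  using fideal_add[of I "x - y" "y - z"] by simp

lemma fideal_sum:
  assumes "fideal I" "fideal J" shows "fideal {x + y |x y. x \<in> I \<and> y \<in> J}"
  unfolding fideal_def
proof (intro conjI ballI allI)
  show "0 \<in> {x + y |x y. x \<in> I \<and> y \<in> J}"
    using fideal_zero[OF assms(1)] fideal_zero[OF assms(2)]
      by (metis (mono_tags, lifting) add_0 mem_Collect_eq)
next
  fix a b assume "a \<in> {x + y |x y. x \<in> I \<and> y \<in> J}" "b \<in> {x + y |x y. x \<in> I \<and> y \<in> J}"
  then obtain x y x' y' where *: "a = x + y" "b = x' + y'" "x \<in> I" "x' \<in> I" "y \<in> J" "y' \<in> J"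
    by blast
  then have "a + b = (x + x') + (y + y')"
    by simp
  then show "a + b \<in> {x + y |x y. x \<in> I \<and> y \<in> J}"
    using * assms fideal_add by blast
next
  fix c z a assume "a \<in> {x + y |x y. x \<in> I \<and> y \<in> J}"
  then obtain x y where *: "a = x + y" "x \<in> I" "y \<in> J"
    by blast
  then have "fscale c a = fscale c x + fscale c y" "fbr z a = fbr z x + fbr z y"
    by (simp_all add: free_lie.scale_right_distrib fbr_add_right)
  then show "fscale c a \<in> {x + y |x y. x \<in> I \<and> y \<in> J}"
    and "fbr z a \<in> {x + y |x y. x \<in> I \<and> y \<in> J}"
    using * assms fideal_scale fideal_br_right by blast+
qed

text \<open>The kernel of the projection from the free Lie algebra to the Lie algebra presented by
  \<open>R\<close>.\<close>

definition rel_ideal :: "('x lie_term \<times> 'x lie_term) set \<Rightarrow> 'x free_lie set" where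
  "rel_ideal R = {cls t |t. lie_eq R t LZero}"

lemma lie_eq_mono:
  assumes "lie_eq R s t" "R \<subseteq> R'" shows "lie_eq R' s t"
  using assms by (induction rule: lie_eq.induct) (auto intro: lie_eq.intros)

lemma cls_eqD: "cls s = cls t \<Longrightarrow> lie_eq R s t"
  by (auto simp: cls_eq_iff intro: lie_eq_mono)

lemma cls_in_rel_ideal: "cls t \<in> rel_ideal R \<longleftrightarrow> lie_eq R t LZero"
  unfolding rel_ideal_def using cls_eqD lie_eq.trans by fastforce

text \<open>A congruence is determined by the class of zero, since \<open>t\<close> can be
  subtracted on both sides; questions about the presented algebra thus become questions about one
  ideal.\<close>

lemma lie_eq_iff_diff: "lie_eq R s t \<longleftrightarrow> cls s - cls t \<in> rel_ideal R"
proof -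
  have "cls s - cls t = cls (LAdd s (LScale (-1) t))"
    by simp
  then have *: "cls s - cls t \<in> rel_ideal R \<longleftrightarrow> lie_eq R (LAdd s (LScale (-1) t)) LZero"
    by (metis cls_in_rel_ideal)
  have "lie_eq R (LAdd s (LScale (-1) t)) LZero" if "lie_eq R s t"
    using that by (meson lie_eq.cong_add lie_eq.refl lie_eq.trans lie_eq.add_neg)
  moreover have "lie_eq R s t" if "lie_eq R (LAdd s (LScale (-1) t)) LZero"
  proof -
    have "lie_eq R s (LAdd (LAdd s (LScale (-1) t)) t)"
      by (rule cls_eqD) simp
    moreover have "lie_eq R (LAdd (LAdd s (LScale (-1) t)) t) (LAdd LZero t)"
      using that by (blast intro: lie_eq.cong_add lie_eq.refl)
    ultimately show ?thesis
      using lie_eq.add_zero lie_eq.trans by blast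
  qed
  ultimately show ?thesis
    using * by blast
qed

lemma fideal_rel_ideal: "fideal (rel_ideal R)"
  unfolding fideal_def
proof (intro conjI ballI allI)
  show "0 \<in> rel_ideal R"
    using cls_in_rel_ideal[of LZero R] by (simp add: lie_eq.refl)
next
  fix x y assume "x \<in> rel_ideal R" "y \<in> rel_ideal R"
  then obtain s t where *: "x = cls s" "lie_eq R s LZero" "y = cls t" "lie_eq R t LZero"
    by (auto simp: rel_ideal_def)
  then have "lie_eq R (LAdd s t) LZero"
    by (meson lie_eq.add_zero lie_eq.cong_add lie_eq.trans)
  then show "x + y \<in> rel_ideal R"
    using * cls_in_rel_ideal[of "LAdd s t" R] by simp
next
  fix c x assume "x \<in> rel_ideal R"
  then obtain s where *: "x = cls s" "lie_eq R s LZero"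
    by (auto simp: rel_ideal_def)
  have "lie_eq R (LScale c s) (LScale c LZero)"
    using * by (blast intro: lie_eq.cong_scale)
  also have "lie_eq R \<dots> LZero"
    by (rule cls_eqD) simp
  finally (lie_eq.trans) show "fscale c x \<in> rel_ideal R"
    using * cls_in_rel_ideal[of "LScale c s" R] by simp
next
  fix y x :: "'a free_lie" assume "x \<in> rel_ideal R"
  then obtain s where *: "x = cls s" "lie_eq R s LZero"
    by (auto simp: rel_ideal_def)
  obtain t where "y = cls t"
    using cls_surj by blast
  have "lie_eq R (LBr t s) (LBr t LZero)"
    using * by (blast intro: lie_eq.cong_br lie_eq.refl)
  also have "lie_eq R \<dots> LZero"
    by (rule cls_eqD) simp
  finally (lie_eq.trans) show "fbr y x \<in> rel_ideal R"
    using * \<open>y = cls t\<close> cls_in_rel_ideal[of "LBr t s" R] by simp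
qed

lemma rel_ideal_rel: "(s, t) \<in> R \<Longrightarrow> cls s - cls t \<in> rel_ideal R"
  using lie_eq.rel lie_eq_iff_diff by blast

text \<open>The universal property of the presentation. The axiom rules of \<open>lie_eq\<close>
  relate terms that already coincide in the free Lie algebra and contribute the difference 0;
  \<open>rel\<close> is the hypothesis, and the other rules use that \<open>I\<close> is an
  ideal.\<close>

lemma rel_ideal_least:
  assumes "fideal I" "\<And>s t. (s, t) \<in> R \<Longrightarrow> cls s - cls t \<in> I"
  shows "rel_ideal R \<subseteq> I"
proof -
  have "cls s - cls t \<in> I" if "lie_eq R s t" for s t
    using that
  proof (induction rule: lie_eq.induct)
    case (rel s t)
    then show ?case using assms by blast
  next
    case (sym s t)
    then show ?case using assms fideal_sym by blast
  next
    case (trans s t u)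
    then show ?case using assms fideal_trans by blast
  next
    case (cong_add s s' t t')
    then show ?case using fideal_add[OF assms(1) cong_add.IH] by (simp add: algebra_simps)
  next
    case (cong_scale t t' c)
    then show ?case using fideal_scale[OF assms(1) cong_scale.IH, of c]
      by (simp add: free_lie.scale_right_diff_distrib)
  next
    case (cong_br s s' t t')
    have "fbr (cls s - cls s') (cls t) + fbr (cls s') (cls t - cls t') \<in> I"
      using cong_br fideal_br_left[OF assms(1)] fideal_br_right[OF assms(1)] fideal_add[OF assms(1)]
      by blast
    then show ?case
      by (simp add: fbr_diff_left fbr_diff_right)
  qed (use fideal_zero[OF assms(1)] in \<open>simp_all add: fbr_add_left fbr_add_right fbr_scale_left
         fbr_scale_right fbr_jacobi free_lie.scale_right_distrib free_lie.scale_left_distrib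
           add.assoc
         add.commute\<close>)
  then show ?thesis
    unfolding rel_ideal_def using cls_simps(2) by fastforce
qed

subsection \<open>Presented Lie algebras and their quotients as quotients of the free Lie algebra\<close>

text \<open>The projection onto the presented algebra, taking elements of the free Lie algebra as
  arguments instead of terms as \<open>lie_class\<close> does.\<close>

definition pcls :: "('x lie_term \<times> 'x lie_term) set \<Rightarrow> 'x free_lie \<Rightarrow> 'x lie_term set" where
  "pcls R x = {t. x - cls t \<in> rel_ideal R}"

lemma pcls_cls: "pcls R (cls t) = lie_class R t"
  by (simp add: pcls_def lie_class_def lie_eq_iff_diff)

lemma in_pcls: "t \<in> pcls R x \<longleftrightarrow> x - cls t \<in> rel_ideal R"
  by (simp add: pcls_def)

lemma pcls_eq_iff: "pcls R x = pcls R y \<longleftrightarrow> x - y \<in> rel_ideal R"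
proof
  assume *: "pcls R x = pcls R y"
  obtain t where "y = cls t"
    using cls_surj by blast
  then have "t \<in> pcls R y"
    by (simp add: in_pcls fideal_zero fideal_rel_ideal)
  then show "x - y \<in> rel_ideal R"
    using * \<open>y = cls t\<close> by (auto simp: in_pcls)
next
  assume "x - y \<in> rel_ideal R"
  then show "pcls R x = pcls R y"
    unfolding pcls_def using fideal_trans[OF fideal_rel_ideal] fideal_sym[OF fideal_rel_ideal] by
      blast
qed

lemma car_presented: "car (lie_presented R) = range (pcls R)"
proof -
  have "lie_class R t \<in> range (pcls R)" for t
    by (metis pcls_cls rangeI)
  moreover have "pcls R x \<in> range (lie_class R)" for x
    by (metis cls_surj pcls_cls rangeI)
  ultimately show ?thesis
    unfolding lie_presented_def by auto
qed

lemma lzero_presented: "lzero (lie_presented R) = pcls R 0"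
  using pcls_cls[of R LZero] by (simp add: lie_presented_def)

text \<open>The operations of \<open>lie_presented\<close> collect the results for all
  representatives; by compatibility with the congruence one pair of representatives already yields
  the whole class.\<close>

lemma pcls_op:
  assumes "\<And>s s' t t'. lie_eq R s s' \<Longrightarrow> lie_eq R t t' \<Longrightarrow> lie_eq R (c s t) (c s' t')"
  shows "{u. \<exists>s\<in>lie_class R s0. \<exists>t\<in>lie_class R t0. lie_eq R (c s t) u} = lie_class R (c s0 t0)"
  unfolding lie_class_def using assms lie_eq.refl lie_eq.trans by (metis (lifting) mem_Collect_eq)

lemma ladd_presented: "ladd (lie_presented R) (pcls R x) (pcls R y) = pcls R (x + y)"
proof -
  obtain s t where "x = cls s" "y = cls t"
    using cls_surj by blast
  then show ?thesis
    using pcls_op[of R LAdd s t] pcls_cls[of R "LAdd s t"]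
    by (simp add: lie_presented_def pcls_cls lie_eq.cong_add)
qed

lemma lbr_presented: "lbr (lie_presented R) (pcls R x) (pcls R y) = pcls R (fbr x y)"
proof -
  obtain s t where "x = cls s" "y = cls t"
    using cls_surj by blast
  then show ?thesis
    using pcls_op[of R LBr s t] pcls_cls[of R "LBr s t"]
    by (simp add: lie_presented_def pcls_cls lie_eq.cong_br)
qed

lemma lscale_presented: "lscale (lie_presented R) c (pcls R x) = pcls R (fscale c x)"
proof -
  obtain t where "x = cls t"
    using cls_surj by blast
  then show ?thesis
    using pcls_op[of R "\<lambda>_. LScale c" t t] pcls_cls[of R "LScale c t"]
    by (simp add: lie_presented_def pcls_cls lie_eq.cong_scale) (auto simp: lie_class_def)
qed

lemmas presented_simps =
  car_presented lzero_presented ladd_presented lbr_presented lscale_presented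

lemma pcls_image_mem:
  assumes "fideal I" "rel_ideal R \<subseteq> I"
  shows "pcls R x \<in> pcls R ` I \<longleftrightarrow> x \<in> I"
  using assms fideal_cong by (fastforce simp: pcls_eq_iff)

lemma lie_ideal_presented_image:
  assumes "fideal I" "rel_ideal R \<subseteq> I"
  shows "lie_ideal (lie_presented R) (pcls R ` I)"
  using assms unfolding lie_ideal_def
  by (auto simp: presented_simps pcls_image_mem fideal_zero fideal_add fideal_scale fideal_br_right)

text \<open>The correspondence theorem for ideals: \<open>I\<close> is the preimage of
  \<open>X\<close> under \<open>pcls R\<close>.\<close>

lemma lie_ideal_presentedE:
  assumes "lie_ideal (lie_presented R) X"
  obtains I where "fideal I" "rel_ideal R \<subseteq> I" "X = pcls R ` I"
proof
  have X: "X \<subseteq> range (pcls R)" "pcls R 0 \<in> X"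
    using assms by (auto simp: lie_ideal_def presented_simps)
  show "X = pcls R ` {x. pcls R x \<in> X}"
    using X by auto
  show "rel_ideal R \<subseteq> {x. pcls R x \<in> X}"
    using X pcls_eq_iff[of R _ 0] by (metis (lifting) diff_zero mem_Collect_eq subsetI)
  show "fideal {x. pcls R x \<in> X}"
    unfolding fideal_def
  proof (intro conjI ballI allI; unfold mem_Collect_eq)
    fix c x y
    show "pcls R 0 \<in> X"
      by (rule X)
    show "pcls R (x + y) \<in> X" if "pcls R x \<in> X" "pcls R y \<in> X"
      using assms that unfolding lie_ideal_def by (metis ladd_presented)
    show "pcls R (fscale c x) \<in> X" if "pcls R x \<in> X"
      using assms that unfolding lie_ideal_def by (metis lscale_presented)
    show "pcls R (fbr x y) \<in> X" if "pcls R y \<in> X"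
      using assms that unfolding lie_ideal_def by (metis lbr_presented car_presented rangeI)
  qed
qed

lemma Collect_image_image2:
  "{h X Y |X Y. X \<in> f ` A \<and> Y \<in> g ` B} = {h (f u) (g w) |u w. u \<in> A \<and> w \<in> B}"
  by blast

lemma Collect_image_image3:
  "{h X Y Z |X Y Z. X \<in> f ` A \<and> Y \<in> g ` B \<and> Z \<in> k ` C} =
   {h (f u) (g w) (k v) |u w v. u \<in> A \<and> w \<in> B \<and> v \<in> C}"
  by blast

lemma image_Collect2: "f ` {h u w |u w. P u w} = {f (h u w) |u w. P u w}"
  by blast

lemma image_Collect3: "f ` {h u w v |u w v. P u w v} = {f (h u w v) |u w v. P u w v}"
  by blast

text \<open>The class of \<open>x\<close> in the free Lie algebra modulo \<open>I\<close>, in the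
  nested set encoding that \<open>lie_quotient\<close> produces from
  \<open>lie_presented\<close>.\<close>

definition qcls ::
  "('x lie_term \<times> 'x lie_term) set \<Rightarrow> 'x free_lie set \<Rightarrow> 'x free_lie \<Rightarrow> 'x lie_term set set" where
  "qcls R I x = pcls R ` {y. y - x \<in> I}"

context
  fixes R :: "('x lie_term \<times> 'x lie_term) set" and I
  assumes I: "fideal I" "rel_ideal R \<subseteq> I"
begin

lemma lie_coset_presented: "lie_coset (lie_presented R) (pcls R ` I) (pcls R x) = qcls R I x"
proof -
  have "lie_coset (lie_presented R) (pcls R ` I) (pcls R x) = (\<lambda>i. pcls R (x + i)) ` I"
    unfolding lie_coset_def by (simp add: setcompr_eq_image image_image ladd_presented)
  also have "\<dots> = pcls R ` ((+) x ` I)"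
    by (simp add: image_image)
  also have "(+) x ` I = {y. y - x \<in> I}"
    by (force simp: image_iff algebra_simps)
  finally show ?thesis
    by (simp add: qcls_def)
qed

lemma qcls_eq_iff: "qcls R I x = qcls R I y \<longleftrightarrow> x - y \<in> I"
proof
  assume *: "qcls R I x = qcls R I y"
  have "pcls R x \<in> qcls R I x"
    using fideal_zero[OF I(1)] by (simp add: qcls_def)
  then have "pcls R x \<in> qcls R I y"
    by (simp add: *)
  then obtain z where "x - z \<in> I" "z - y \<in> I"
    using I by (auto simp: qcls_def pcls_eq_iff)
  then show "x - y \<in> I"
    using I fideal_trans by blast
next
  assume "x - y \<in> I"
  then have "{z. z - x \<in> I} = {z. z - y \<in> I}"
    using I fideal_trans fideal_sym by blast
  then show "qcls R I x = qcls R I y"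
    by (simp add: qcls_def)
qed

lemma car_quotient: "car (lie_quotient (lie_presented R) (pcls R ` I)) = range (qcls R I)"
  by (simp add: lie_quotient_def car_presented image_image lie_coset_presented)

lemma ladd_quotient:
  "ladd (lie_quotient (lie_presented R) (pcls R ` I)) (qcls R I x) (qcls R I y) = qcls R I (x + y)"
proof -
  have "ladd (lie_quotient (lie_presented R) (pcls R ` I)) (qcls R I x) (qcls R I y)
      = pcls R ` {u + w |u w. u - x \<in> I \<and> w - y \<in> I}"
    by (simp add: lie_quotient_def qcls_def Collect_image_image2 image_Collect2 ladd_presented)
  also have "{u + w |u w. u - x \<in> I \<and> w - y \<in> I} = {z. z - (x + y) \<in> I}" (is "?A = ?B")
  proof
    show "?A \<subseteq> ?B"
    proof
      fix z assume "z \<in> ?A"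
      then obtain u w where "z = u + w" "u - x \<in> I" "w - y \<in> I"
        by blast
      then show "z \<in> ?B"
        using fideal_add[OF I(1), of "u - x" "w - y"] by (simp add: algebra_simps)
    qed
    show "?B \<subseteq> ?A"
    proof
      fix z assume "z \<in> ?B"
      then have "z = (z - y) + y" "z - y - x \<in> I" "y - y \<in> I"
        using fideal_zero[OF I(1)] by (simp_all add: algebra_simps)
      then show "z \<in> ?A"
        by blast
    qed
  qed
  finally show ?thesis
    by (simp add: qcls_def)
qed

lemma lscale_quotient:
  "lscale (lie_quotient (lie_presented R) (pcls R ` I)) c (qcls R I x) = qcls R I (fscale c x)"
proof -
  have "lscale (lie_quotient (lie_presented R) (pcls R ` I)) c (qcls R I x)
      = pcls R ` {fscale c u + i |u i. u - x \<in> I \<and> i \<in> I}"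
    by (simp add: lie_quotient_def qcls_def Collect_image_image2 image_Collect2 ladd_presented
        lscale_presented)
  also have "{fscale c u + i |u i. u - x \<in> I \<and> i \<in> I} = {z. z - fscale c x \<in> I}" (is "?A = ?B")
  proof
    show "?A \<subseteq> ?B"
    proof
      fix z assume "z \<in> ?A"
      then obtain u i where "z = fscale c u + i" "u - x \<in> I" "i \<in> I"
        by blast
      then show "z \<in> ?B"
        using fideal_add[OF I(1) fideal_scale[OF I(1), of "u - x" c]]
        by (simp add: free_lie.scale_right_diff_distrib algebra_simps) 
    qed
    show "?B \<subseteq> ?A"
    proof
      fix z assume "z \<in> ?B"
      then have "z = fscale c x + (z - fscale c x)" "x - x \<in> I" "z - fscale c x \<in> I"
        using fideal_zero[OF I(1)] by simp_all
      then show "z \<in> ?A"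
        by blast
    qed
  qed
  finally show ?thesis
    by (simp add: qcls_def)
qed

lemma lbr_quotient:
  "lbr (lie_quotient (lie_presented R) (pcls R ` I)) (qcls R I x) (qcls R I y) = qcls R I (fbr x y)"
proof -
  have "lbr (lie_quotient (lie_presented R) (pcls R ` I)) (qcls R I x) (qcls R I y)
      = pcls R ` {fbr u w + i |u w i. u - x \<in> I \<and> w - y \<in> I \<and> i \<in> I}"
    by (simp add: lie_quotient_def qcls_def Collect_image_image3 image_Collect3 ladd_presented
        lbr_presented)
  also have "{fbr u w + i |u w i. u - x \<in> I \<and> w - y \<in> I \<and> i \<in> I} = {z. z - fbr x y \<in> I}"
    (is "?A = ?B")
  proof
    show "?A \<subseteq> ?B"
    proof
      fix z assume "z \<in> ?A"
      then obtain u w i where *: "z = fbr u w + i" "u - x \<in> I" "w - y \<in> I" "i \<in> I"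
        by blast
      then have "fbr (u - x) w + fbr x (w - y) + i \<in> I"
        by (intro fideal_add fideal_br_left fideal_br_right I)
      then show "z \<in> ?B"
        using * by (simp add: fbr_diff_left fbr_diff_right algebra_simps)
    qed
    show "?B \<subseteq> ?A"
    proof
      fix z assume "z \<in> ?B"
      then have "z = fbr x y + (z - fbr x y)" "x - x \<in> I" "y - y \<in> I" "z - fbr x y \<in> I"
        using fideal_zero[OF I(1)] by simp_all
      then show "z \<in> ?A"
        by blast
    qed
  qed
  finally show ?thesis
    by (simp add: qcls_def)
qed

end

section \<open>The radical of the Kac-Moody presentation\<close>

lemma fideal_sum_mem:
  assumes "fideal I" "\<And>k. k \<in> S \<Longrightarrow> v k \<in> I" shows "sum v S \<in> I"
  using assms(2) by (induction S rule: infinite_finite_induct)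
    (auto simp: fideal_zero[OF assms(1)] intro: fideal_add[OF assms(1)])

lemma fbr_sum_right: "fbr x (sum v S) = (\<Sum>k\<in>S. fbr x (v k))"
  by (induction S rule: infinite_finite_induct) (simp_all add: fbr_add_right)

text \<open>The operator ad h - \<open>ev k0\<close> removes the summand \<open>v k0\<close> modulo
  \<open>I\<close> and multiplies every other \<open>v k\<close> by the nonzero number
  \<open>ev k - ev k0\<close>; the induction hypothesis applies to the rescaled summands
  \<open>?w k\<close>.\<close>

lemma eigenvector_split:
  fixes ev :: "'k \<Rightarrow> complex" and v :: "'k \<Rightarrow> 'x free_lie"
  assumes I: "fideal I" and "finite S" "inj_on ev S"
    and "\<And>k. k \<in> S \<Longrightarrow> fbr h (v k) - fscale (ev k) (v k) \<in> I"
    and "sum v S \<in> I" and "k \<in> S"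
  shows "v k \<in> I"
  using assms(2-)
proof (induction S arbitrary: v k)
  case (insert k0 S)
  let ?w = "\<lambda>k. fscale (ev k - ev k0) (v k)"
  have "fbr h (sum v (insert k0 S)) - (\<Sum>k\<in>insert k0 S. fbr h (v k) - fscale (ev k) (v k)) \<in> I"
    by (rule fideal_diff[OF I fideal_br_right[OF I] fideal_sum_mem[OF I]]) (use insert.prems in
      auto)
  then have "(\<Sum>k\<in>insert k0 S. fscale (ev k) (v k)) \<in> I"
    by (simp only: fbr_sum_right sum_subtractf) simp
  then have "(\<Sum>k\<in>insert k0 S. fscale (ev k) (v k)) - fscale (ev k0) (sum v (insert k0 S)) \<in> I"
    by (rule fideal_diff[OF I _ fideal_scale[OF I]]) (use insert.prems in auto)
  also have "(\<Sum>k\<in>insert k0 S. fscale (ev k) (v k)) - fscale (ev k0) (sum v (insert k0 S)) =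
    sum ?w (insert k0 S)"
    by (simp only: free_lie.scale_sum_right free_lie.scale_left_diff_distrib sum_subtractf)
  finally have sum: "sum ?w S \<in> I"
    using insert.hyps by simp
  have mem: "v k \<in> I" if "k \<in> S" for k
  proof -
    have "fbr h (?w k) - fscale (ev k) (?w k) \<in> I" if "k \<in> S" for k
    proof -
      have "fscale (ev k - ev k0) (fbr h (v k) - fscale (ev k) (v k)) \<in> I"
        by (rule fideal_scale[OF I]) (use insert.prems that in auto)
      then show ?thesis
        by (simp add: fbr_scale_right free_lie.scale_right_diff_distrib mult.commute)
    qed
    then have "?w k \<in> I"
      using insert.IH[of ?w k] sum that insert.prems by auto
    moreover have "ev k - ev k0 \<noteq> 0"
      using insert.prems(1) insert.hyps that by (auto simp: inj_on_def)
    ultimately show ?thesis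
      using fideal_scale_iff[OF I] by blast
  qed
  have "sum v (insert k0 S) - sum v S \<in> I"
    by (rule fideal_diff[OF I _ fideal_sum_mem[OF I]]) (use insert.prems mem in auto)
  then have "v k0 \<in> I"
    using insert.hyps by simp
  then show ?case
    using mem insert.prems by auto
qed simp

text \<open>For finitely many roots \<open>root_values\<close> is linear independence, in the form
  in which it is applied: it supplies Cartan elements with prescribed eigenvalues on the root
  vectors.\<close>

locale km_algebra =
  fixes sh :: "complex \<Rightarrow> 'h::ab_group_add \<Rightarrow> 'h"
    and \<alpha> :: "'n \<Rightarrow> 'h \<Rightarrow> complex" and \<alpha>v :: "'n \<Rightarrow> 'h"
  assumes vs_h: "vector_space sh"
    and linear_root: "\<And>i. Vector_Spaces.linear sh (*) (\<alpha> i)"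
    and root_values: "\<And>c. \<exists>x. \<forall>i. \<alpha> i x = c i"
begin

lemma root_add: "\<alpha> i (x + y) = \<alpha> i x + \<alpha> i y"
  using linear_root[of i] by (simp add: Vector_Spaces.linear_iff)

lemma root_scale: "\<alpha> i (sh c x) = c * \<alpha> i x"
  using linear_root[of i] by (simp add: Vector_Spaces.linear_iff)

abbreviation "R \<equiv> km_rels sh \<alpha> \<alpha>v"
abbreviation "K \<equiv> rel_ideal R"
abbreviation "hh x \<equiv> fgen (KH x) :: ('h, 'n) km_gen free_lie"
abbreviation "ee i \<equiv> fgen (KE i) :: ('h, 'n) km_gen free_lie"
abbreviation "ff i \<equiv> fgen (KF i) :: ('h, 'n) km_gen free_lie"

lemma fideal_K: "fideal K"
  by (rule fideal_rel_ideal)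

lemma
  shows hh_add: "hh (x + y) - (hh x + hh y) \<in> K"
    and hh_scale: "hh (sh c x) - fscale c (hh x) \<in> K"
    and br_hh: "fbr (hh x) (hh y) \<in> K"
    and br_h_e: "fbr (hh x) (ee i) - fscale (\<alpha> i x) (ee i) \<in> K"
    and br_h_f: "fbr (hh x) (ff i) - fscale (- \<alpha> i x) (ff i) \<in> K"
    and br_e_f: "fbr (ee i) (ff j) - (if i = j then hh (\<alpha>v i) else 0) \<in> K"
proof -
  note [intro] = km_rels.intros
  show "hh (x + y) - (hh x + hh y) \<in> K"
    using rel_ideal_rel[of "LGen (KH (x + y))" "LAdd (LGen (KH x)) (LGen (KH y))" R] by auto
  show "hh (sh c x) - fscale c (hh x) \<in> K"
    using rel_ideal_rel[of "LGen (KH (sh c x))" "LScale c (LGen (KH x))" R] by auto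
  show "fbr (hh x) (hh y) \<in> K"
    using rel_ideal_rel[of "LBr (LGen (KH x)) (LGen (KH y))" LZero R] by auto
  show "fbr (hh x) (ee i) - fscale (\<alpha> i x) (ee i) \<in> K"
    using rel_ideal_rel[of "LBr (LGen (KH x)) (LGen (KE i))" "LScale (\<alpha> i x) (LGen (KE i))" R] by
      auto
  show "fbr (hh x) (ff i) - fscale (- \<alpha> i x) (ff i) \<in> K"
    using rel_ideal_rel[of "LBr (LGen (KH x)) (LGen (KF i))" "LScale (- \<alpha> i x) (LGen (KF i))" R]
      km_rels.h_f[of x i \<alpha> sh \<alpha>v] by simp
  show "fbr (ee i) (ff j) - (if i = j then hh (\<alpha>v i) else 0) \<in> K"
    using rel_ideal_rel[OF km_rels.e_f[of i j \<alpha>v sh \<alpha>]] by (simp split: if_splits)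
qed

lemma hh_0: "hh 0 \<in> K"
  using fideal_minus[OF fideal_K hh_add[of 0 0]] by simp

lemma br_h_e': "fbr (ee i) (hh x) - fscale (- \<alpha> i x) (ee i) \<in> K"
  using fideal_minus[OF fideal_K br_h_e[of x i]] fbr_anticomm[of "ee i" "hh x"] by simp

lemma br_h_f': "fbr (ff i) (hh x) - fscale (\<alpha> i x) (ff i) \<in> K"
  using fideal_minus[OF fideal_K br_h_f[of x i]] fbr_anticomm[of "ff i" "hh x"] by simp

lemma br_f_e: "fbr (ff j) (ee i) - (if i = j then - hh (\<alpha>v i) else 0) \<in> K"
  using fideal_minus[OF fideal_K br_e_f[of i j]] fbr_anticomm[of "ff j" "ee i"]
    by (simp split: if_splits)

text \<open>The principal grading.  That its degree 0 part is the Cartan subalgebra is the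
  triangular decomposition.\<close>

inductive deg :: "int \<Rightarrow> ('h, 'n) km_gen free_lie \<Rightarrow> bool" where
  deg_h: "deg 0 (hh x)"
| deg_e: "deg 1 (ee i)"
| deg_f: "deg (-1) (ff i)"
| deg_br_e: "n \<ge> 1 \<Longrightarrow> deg n x \<Longrightarrow> deg (n + 1) (fbr (ee i) x)"
| deg_br_f: "n \<le> -1 \<Longrightarrow> deg n x \<Longrightarrow> deg (n - 1) (fbr (ff i) x)"
| deg_zero: "deg n 0"
| deg_add: "deg n x \<Longrightarrow> deg n y \<Longrightarrow> deg n (x + y)"
| deg_scale: "deg n x \<Longrightarrow> deg n (fscale c x)"
| deg_cong: "deg n x \<Longrightarrow> y - x \<in> K \<Longrightarrow> deg n y"

lemma deg_K: "x \<in> K \<Longrightarrow> deg n x"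
  using deg_cong[OF deg_zero] by simp

lemma deg_diff: "deg n x \<Longrightarrow> deg n y \<Longrightarrow> deg n (x - y)"
  using deg_add[OF _ deg_scale[of n y "-1"], of x] by simp

text \<open>The bracket rules of \<open>deg\<close> start in a nonzero degree and lead away from 0,
  so in degree 0 only linear combinations of Cartan generators arise, up to
  \<open>K\<close>.\<close>

lemma deg_0D: "deg 0 x \<Longrightarrow> \<exists>y. x - hh y \<in> K"
proof (induction "0::int" x rule: deg.induct)
  case (deg_h x)
  then show ?case using fideal_zero[OF fideal_K] by (auto intro: exI[of _ x])
next
  case deg_zero
  then show ?case using fideal_minus[OF fideal_K hh_0] by auto
next
  case (deg_add x y)
  then obtain a b where "x - hh a \<in> K" "y - hh b \<in> K"
    by blast
  then have "(x - hh a) + (y - hh b) - (hh (a + b) - (hh a + hh b)) \<in> K"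
    using fideal_diff[OF fideal_K fideal_add[OF fideal_K] hh_add] by blast
  then show ?case
    by (intro exI[of _ "a + b"]) (simp add: algebra_simps)
next
  case (deg_scale x c)
  then obtain a where "x - hh a \<in> K"
    by blast
  then have "fscale c (x - hh a) - (hh (sh c a) - fscale c (hh a)) \<in> K"
    using fideal_diff[OF fideal_K fideal_scale[OF fideal_K] hh_scale] by blast
  then show ?case
    by (intro exI[of _ "sh c a"]) (simp add: free_lie.scale_right_diff_distrib)
next
  case (deg_cong x y)
  then show ?case using fideal_trans[OF fideal_K] by blast
qed auto

lemma fbr_mod_right: "fideal I \<Longrightarrow> x - y \<in> I \<Longrightarrow> fbr z x - fbr z y \<in> I"
  using fideal_br_right[of I "x - y" z] by (simp add: fbr_diff_right)

lemma fbr_mod_left: "fideal I \<Longrightarrow> x - y \<in> I \<Longrightarrow> fbr x z - fbr y z \<in> I"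
  using fideal_br_left[of I "x - y" z] by (simp add: fbr_diff_left)

lemma deg_ad_h: "deg n x \<Longrightarrow> deg n (fbr (hh y) x)"
proof (induction rule: deg.induct)
  case (deg_h x)
  then show ?case using deg_K[OF br_hh] by simp
next
  case (deg_e i)
  show ?case by (rule deg.deg_cong[OF deg_scale[OF deg.deg_e] br_h_e])
next
  case (deg_f i)
  show ?case by (rule deg.deg_cong[OF deg_scale[OF deg.deg_f] br_h_f])
next
  case (deg_br_e n x i)
  have "deg (n + 1) (fbr (fbr (hh y) (ee i)) x)"
    by (rule deg.deg_cong[OF _ fbr_mod_left[OF fideal_K br_h_e]])
      (unfold fbr_scale_left, rule deg_scale[OF deg.deg_br_e[OF deg_br_e.hyps(1,2)]])
  then show ?case
    using deg_add deg.deg_br_e[OF deg_br_e.hyps(1) deg_br_e.IH]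
      by (simp add: fbr_derivation[of "hh y"])
next
  case (deg_br_f n x i)
  have "deg (n - 1) (fbr (fbr (hh y) (ff i)) x)"
    by (rule deg.deg_cong[OF _ fbr_mod_left[OF fideal_K br_h_f]])
      (unfold fbr_scale_left, rule deg_scale[OF deg.deg_br_f[OF deg_br_f.hyps(1,2)]])
  then show ?case
    using deg_add deg.deg_br_f[OF deg_br_f.hyps(1) deg_br_f.IH]
      by (simp add: fbr_derivation[of "hh y"])
next
  case (deg_cong n x y)
  then show ?case using deg.deg_cong[OF _ fbr_mod_right[OF fideal_K]] by blast
qed (auto simp: fbr_add_right fbr_scale_right intro: deg_add deg_scale deg_zero)

lemma deg_ad_hh_like:
  assumes "u - hh y \<in> K \<or> u - fscale c (hh y) \<in> K \<or> u \<in> K" "deg n x" shows "deg n (fbr u x)"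
  using assms(1)
proof (elim disjE)
  assume "u - hh y \<in> K"
  then show ?thesis
    using deg_cong[OF deg_ad_h[OF assms(2)] fbr_mod_left[OF fideal_K]] by blast
next
  assume "u - fscale c (hh y) \<in> K"
  then have "fbr u x - fbr (fscale c (hh y)) x \<in> K"
    by (rule fbr_mod_left[OF fideal_K])
  then show ?thesis
    using deg_cong[OF deg_scale[OF deg_ad_h[OF assms(2)]]] by (simp add: fbr_scale_left)
next
  assume "u \<in> K"
  then show ?thesis
    using deg_K fideal_br_left[OF fideal_K] by blast
qed

lemma deg_br_e_f: "deg n x \<Longrightarrow> deg n (fbr (fbr (ee i) (ff j)) x)"
  using deg_ad_hh_like[of "fbr (ee i) (ff j)" "\<alpha>v i" 1 n x] br_e_f[of i j]
    by (auto split: if_splits)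

lemma deg_br_f_e: "deg n x \<Longrightarrow> deg n (fbr (fbr (ff j) (ee i)) x)"
  using deg_ad_hh_like[of "fbr (ff j) (ee i)" "\<alpha>v i" "-1" n x] br_f_e[of j i]
    by (auto split: if_splits)

text \<open>In positive degree this is a rule of \<open>deg\<close>, in degree 0 it follows from
  \<open>deg_0D\<close>. In negative degree [e_j, [f_i, x]] = [[e_j, f_i], x] + [f_i, [e_j, x]],
  where the first term is the action of a Cartan element and the second is covered by
  induction.\<close>

lemma deg_ad_e: assumes "deg n x" shows "deg (n + 1) (fbr (ee j) x)"
proof -
  have 0: "deg 1 (fbr (ee j) z)" if z: "deg 0 z" for z
  proof -
    obtain y where "z - hh y \<in> K"
      using deg_0D z by blast
    then have "fbr (ee j) z - fbr (ee j) (hh y) \<in> K"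
      by (rule fbr_mod_right[OF fideal_K])
    moreover have "deg 1 (fbr (ee j) (hh y))"
      by (rule deg_cong[OF deg_scale[OF deg_e] br_h_e'])
    ultimately show ?thesis
      using deg_cong by blast
  qed
  have "deg (n + 1) (fbr (ee j) x)" if "deg n x" "n \<le> -1"
    using that
  proof (induction rule: deg.induct)
    case (deg_f i)
    show ?case
      by (rule deg_cong[OF _ br_e_f]) (auto intro: deg_h deg_zero)
  next
    case (deg_br_f n x i)
    \<comment> \<open>For n = -1 the bracket [e_j, x] has degree 0, where \<open>deg_br_f\<close>
      does not apply; by \<open>deg_0D\<close> it is a Cartan element there.\<close>
    have "deg (n - 1 + 1) (fbr (ff i) (fbr (ee j) x))"
    proof (cases "n = -1")
      case True
      then have "deg 0 (fbr (ee j) x)"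
        using deg_br_f by simp
      then obtain y where "fbr (ee j) x - hh y \<in> K"
        using deg_0D by blast
      then have "fbr (ff i) (fbr (ee j) x) - fbr (ff i) (hh y) \<in> K"
        by (rule fbr_mod_right[OF fideal_K])
      moreover have "deg (-1) (fbr (ff i) (hh y))"
        by (rule deg_cong[OF deg_scale[OF deg_f] br_h_f'])
      ultimately show ?thesis
        using deg_cong True by auto
    next
      case False
      then show ?thesis
        using deg_br_f deg.deg_br_f[of "n + 1" "fbr (ee j) x" i] by simp
    qed
    moreover have "deg (n - 1 + 1) (fbr (fbr (ee j) (ff i)) x)"
      using deg_br_e_f[of n x] deg_br_f by simp
    ultimately show ?case
      using deg_add by (simp add: fbr_derivation[of "ee j"])
  next
    case (deg_cong n x y)
    then show ?case using deg.deg_cong[OF _ fbr_mod_right[OF fideal_K]] by blast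
  qed (auto simp: fbr_add_right fbr_scale_right intro: deg_add deg_scale deg_zero)
  then show ?thesis
    using assms 0 deg_br_e by (cases n "0::int" rule: linorder_cases) auto
qed

lemma deg_ad_f: assumes "deg n x" shows "deg (n - 1) (fbr (ff j) x)"
proof -
  have 0: "deg (-1) (fbr (ff j) z)" if z: "deg 0 z" for z
  proof -
    obtain y where "z - hh y \<in> K"
      using deg_0D z by blast
    then have "fbr (ff j) z - fbr (ff j) (hh y) \<in> K"
      by (rule fbr_mod_right[OF fideal_K])
    moreover have "deg (-1) (fbr (ff j) (hh y))"
      by (rule deg_cong[OF deg_scale[OF deg_f] br_h_f'])
    ultimately show ?thesis
      using deg_cong by blast
  qed
  have "deg (n - 1) (fbr (ff j) x)" if "deg n x" "n \<ge> 1"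
    using that
  proof (induction rule: deg.induct)
    case (deg_e i)
    show ?case
      by (rule deg_cong[OF _ br_f_e]) (auto intro: deg_h deg_zero deg_diff[OF deg_zero, simplified])
  next
    case (deg_br_e n x i)
    have "deg (n + 1 - 1) (fbr (ee i) (fbr (ff j) x))"
    proof (cases "n = 1")
      case True
      then have "deg 0 (fbr (ff j) x)"
        using deg_br_e by simp
      then obtain y where "fbr (ff j) x - hh y \<in> K"
        using deg_0D by blast
      then have "fbr (ee i) (fbr (ff j) x) - fbr (ee i) (hh y) \<in> K"
        by (rule fbr_mod_right[OF fideal_K])
      moreover have "deg 1 (fbr (ee i) (hh y))"
        by (rule deg_cong[OF deg_scale[OF deg_e] br_h_e'])
      ultimately show ?thesis
        using deg_cong True by auto
    next
      case False
      then show ?thesis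
        using deg_br_e deg.deg_br_e[of "n - 1" "fbr (ff j) x" i] by simp
    qed
    moreover have "deg (n + 1 - 1) (fbr (fbr (ff j) (ee i)) x)"
      using deg_br_f_e[of n x] deg_br_e by simp
    ultimately show ?case
      using deg_add by (simp add: fbr_derivation[of "ff j"])
  next
    case (deg_cong n x y)
    then show ?case using deg.deg_cong[OF _ fbr_mod_right[OF fideal_K]] by blast
  qed (auto simp: fbr_add_right fbr_scale_right intro: deg_add deg_scale deg_zero)
  then show ?thesis
    using assms 0 deg_br_f by (cases n "0::int" rule: linorder_cases) auto
qed

text \<open>Makes the principal degree an eigenvalue of ad \<open>h0\<close>, so that
  \<open>eigenvector_split\<close> can extract homogeneous parts inside an ideal.\<close>

lemma deg_eigenvector:
  assumes "\<And>i. \<alpha> i h0 = 1" "deg n x"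
  shows "fbr (hh h0) x - fscale (of_int n) x \<in> K"
  using assms(2)
proof (induction rule: deg.induct)
  case (deg_h x)
  then show ?case using br_hh by simp
next
  case (deg_e i)
  then show ?case using br_h_e[of h0 i] assms(1) by simp
next
  case (deg_f i)
  then show ?case using br_h_f[of h0 i] assms(1) by simp
next
  case (deg_br_e n x i)
  have "fbr (fbr (hh h0) (ee i)) x - fbr (ee i) x \<in> K"
    using fbr_mod_left[OF fideal_K br_h_e[of h0 i]] assms(1) by simp
  moreover have "fbr (ee i) (fbr (hh h0) x) - fbr (ee i) (fscale (of_int n) x) \<in> K"
    using deg_br_e by (intro fbr_mod_right fideal_K)
  ultimately have "(fbr (fbr (hh h0) (ee i)) x - fbr (ee i) x)
      + (fbr (ee i) (fbr (hh h0) x) - fbr (ee i) (fscale (of_int n) x)) \<in> K"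
    by (rule fideal_add[OF fideal_K])
  then show ?case
    by (simp add: fbr_derivation[of "hh h0"] fbr_scale_right free_lie.scale_left_distrib
      algebra_simps)
next
  case (deg_br_f n x i)
  have "fbr (fbr (hh h0) (ff i)) x - fscale (-1) (fbr (ff i) x) \<in> K"
    using fbr_mod_left[OF fideal_K br_h_f[of h0 i], of x] assms(1) by (simp add: fbr_minus_left)
  moreover have "fbr (ff i) (fbr (hh h0) x) - fbr (ff i) (fscale (of_int n) x) \<in> K"
    using deg_br_f by (intro fbr_mod_right fideal_K)
  ultimately have "(fbr (fbr (hh h0) (ff i)) x - fscale (-1) (fbr (ff i) x))
      + (fbr (ff i) (fbr (hh h0) x) - fbr (ff i) (fscale (of_int n) x)) \<in> K"
    by (rule fideal_add[OF fideal_K])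
  then show ?case
    by (simp add: fbr_derivation[of "hh h0"] fbr_scale_right free_lie.scale_left_diff_distrib
      algebra_simps)
next
  case (deg_zero n)
  then show ?case by (simp add: fideal_zero fideal_K)
next
  case (deg_add n x y)
  then have "(fbr (hh h0) x - fscale (of_int n) x) + (fbr (hh h0) y - fscale (of_int n) y) \<in> K"
    using fideal_add[OF fideal_K] by blast
  then show ?case
    by (simp add: fbr_add_right free_lie.scale_right_distrib algebra_simps)
next
  case (deg_scale n x c)
  then have "fscale c (fbr (hh h0) x - fscale (of_int n) x) \<in> K"
    using fideal_scale[OF fideal_K] by blast
  then show ?case
    by (simp add: fbr_scale_right free_lie.scale_right_diff_distrib mult.commute)
next
  case (deg_cong n x y)
  have "(fbr (hh h0) x - fscale (of_int n) x) + fbr (hh h0) (y - x) - fscale (of_int n) (y - x) \<in> K"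
    by (rule fideal_diff[OF fideal_K fideal_add[OF fideal_K _ fideal_br_right[OF fideal_K]]
          fideal_scale[OF fideal_K]]) (use deg_cong in auto)
  then show ?case
    by (simp add: fbr_diff_right free_lie.scale_right_diff_distrib)
qed

section \<open>Decomposition into homogeneous parts\<close>

definition decomposable :: "('h, 'n) km_gen free_lie \<Rightarrow> bool" where
  "decomposable x \<longleftrightarrow> (\<exists>v S. finite S \<and> (\<forall>k. deg k (v k)) \<and> x - sum v S \<in> K)"

lemma decomposable_deg: "deg n x \<Longrightarrow> decomposable x"
  unfolding decomposable_def
  by (rule exI[of _ "\<lambda>k. if k = n then x else 0"], rule exI[of _ "{n}"])
    (simp add: deg_zero fideal_zero fideal_K)

lemma decomposable_add:
  assumes "decomposable x" "decomposable y" shows "decomposable (x + y)"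
proof -
  obtain v S w T where *: "finite S" "\<And>k. deg k (v k)" "x - sum v S \<in> K"
    "finite T" "\<And>k. deg k (w k)" "y - sum w T \<in> K"
    using assms by (auto simp: decomposable_def)
  define u where "u k = (if k \<in> S then v k else 0) + (if k \<in> T then w k else 0)" for k
  have "sum u (S \<union> T) = sum v S + sum w T"
    using *(1,4) by (simp add: u_def sum.distrib sum.If_cases Int_absorb1 Int_commute)
  then have "x + y - sum u (S \<union> T) = (x - sum v S) + (y - sum w T)"
    by (simp add: algebra_simps)
  then have "x + y - sum u (S \<union> T) \<in> K"
    using * fideal_add[OF fideal_K] by (simp only:)
  moreover have "deg k (u k)" for k
    using * by (auto simp: u_def intro: deg_add deg_zero)
  ultimately show ?thesis
    using * by (auto simp: decomposable_def intro!: exI[of _ u] exI[of _ "S \<union> T"])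
qed

lemma decomposable_scale:
  assumes "decomposable x" shows "decomposable (fscale c x)"
proof -
  obtain v S where *: "finite S" "\<And>k. deg k (v k)" "x - sum v S \<in> K"
    using assms by (auto simp: decomposable_def)
  have "fscale c x - (\<Sum>k\<in>S. fscale c (v k)) = fscale c (x - sum v S)"
    by (simp add: free_lie.scale_right_diff_distrib free_lie.scale_sum_right)
  then have "fscale c x - (\<Sum>k\<in>S. fscale c (v k)) \<in> K"
    using * fideal_scale[OF fideal_K] by simp
  then show ?thesis
    using * deg_scale unfolding decomposable_def by meson
qed

lemma decomposable_ad:
  assumes "decomposable x" "\<And>k y. deg k y \<Longrightarrow> deg (k + d) (fbr z y)" shows "decomposable (fbr z x)"
proof -
  obtain v S where *: "finite S" "\<And>k. deg k (v k)" "x - sum v S \<in> K"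
    using assms by (auto simp: decomposable_def)
  have "sum (\<lambda>k. fbr z (v (k - d))) ((\<lambda>k. k + d) ` S) = (\<Sum>k\<in>S. fbr z (v k))"
    by (subst sum.reindex) (auto simp: inj_on_def)
  then have "fbr z x - sum (\<lambda>k. fbr z (v (k - d))) ((\<lambda>k. k + d) ` S) \<in> K"
    using fbr_mod_right[OF fideal_K *(3), of z] by (simp add: fbr_sum_right)
  moreover have "deg k (fbr z (v (k - d)))" for k
    using assms(2)[OF *(2)[of "k - d"]] by simp
  ultimately show ?thesis
    using *(1) unfolding decomposable_def by (meson finite_imageI)
qed

text \<open>Generators shift the degree by 0, 1 or -1, and the Jacobi identity reduces the bracket
  with [s, t] to brackets with s and t; this needs the induction over \<open>t\<close> for all
  \<open>x\<close> at once.\<close>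

lemma decomposable_br: "decomposable x \<Longrightarrow> decomposable (fbr t x)"
proof (induction t arbitrary: x rule: free_lie_induct)
  case (gen z)
  then show ?case
    using decomposable_ad[of x 0 "fgen z"] decomposable_ad[of x 1 "fgen z"] decomposable_ad[of x
      "-1" "fgen z"]
      deg_ad_h deg_ad_e deg_ad_f by (cases z) auto
next
  case zero
  then show ?case using decomposable_deg[OF deg_zero] by simp
next
  case (add s t)
  then show ?case by (simp add: fbr_add_left decomposable_add)
next
  case (scale c t)
  then show ?case by (simp add: fbr_scale_left decomposable_scale)
next
  case (br s t)
  have "fbr (fbr s t) x = fbr s (fbr t x) + fscale (-1) (fbr t (fbr s x))"
    using fbr_derivation[of s t x] by simp
  then show ?case using br by (simp only: decomposable_add decomposable_scale)
qed

lemma decomposable: "decomposable x"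
proof (induction x rule: free_lie_induct)
  case (gen z)
  then show ?case by (cases z) (auto intro: decomposable_deg deg_h deg_e deg_f)
qed (auto intro: decomposable_deg[OF deg_zero] decomposable_add decomposable_scale decomposable_br)

section \<open>The largest ideal that meets the Cartan subalgebra trivially\<close>

definition htriv :: "('h, 'n) km_gen free_lie set \<Rightarrow> bool" where
  "htriv I \<longleftrightarrow> fideal I \<and> K \<subseteq> I \<and> (\<forall>x. hh x \<in> I \<longrightarrow> hh x \<in> K)"

text \<open>An ideal is stable under ad \<open>h0\<close> and therefore contains the homogeneous
  parts of its elements. If it is \<open>htriv\<close>, the part of degree 0, a Cartan element, lies
  in \<open>K\<close>. Elements of I and J thus have no part of degree 0, and neither has their
  sum.\<close>

lemma htriv_sum:
  assumes "htriv I" "htriv J" shows "htriv {x + y |x y. x \<in> I \<and> y \<in> J}"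
proof -
  have I: "fideal I" "K \<subseteq> I" and J: "fideal J" "K \<subseteq> J"
    using assms by (auto simp: htriv_def)
  obtain h0 where h0: "\<And>i. \<alpha> i h0 = 1"
    using root_values[of "\<lambda>_. 1"] by blast
  have split: "\<exists>v S. finite S \<and> 0 \<notin> S \<and> (\<forall>k. deg k (v k)) \<and> x - sum v S \<in> K"
    if x: "x \<in> I" "htriv I" for x I
  proof -
    have I: "fideal I" "K \<subseteq> I"
      using x by (auto simp: htriv_def)
    obtain v S where *: "finite S" "\<And>k. deg k (v k)" "x - sum v S \<in> K"
      using decomposable[of x] unfolding decomposable_def by blast
    have sum: "sum v S \<in> I"
      using fideal_cong[OF I(1), of x "sum v S"] * I x by blast
    have eig: "fbr (hh h0) (v k) - fscale (of_int k) (v k) \<in> I" for k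
      using deg_eigenvector[OF h0 *(2)] I by blast
    have inj: "inj_on (of_int :: int \<Rightarrow> complex) S"
      by (simp add: inj_on_def)
    have "v 0 \<in> K" if "0 \<in> S"
    proof -
      have "v 0 \<in> I"
        by (rule eigenvector_split[OF I(1) *(1) inj eig sum that])
      moreover obtain y where y: "v 0 - hh y \<in> K"
        using deg_0D[OF *(2)] by blast
      ultimately have "hh y \<in> I"
        using fideal_cong[OF I(1)] I by blast
      then have "hh y \<in> K"
        using x by (auto simp: htriv_def)
      then show ?thesis
        using y fideal_cong[OF fideal_K] by blast
    qed
    then have "sum v S - sum v (S - {0}) \<in> K"
      using *(1) fideal_zero[OF fideal_K] by (cases "0 \<in> S") (simp_all add: sum.remove[of S 0])
    then have "x - sum v (S - {0}) \<in> K"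
      using *(3) fideal_trans[OF fideal_K] by blast
    then show ?thesis
      using * by (intro exI[of _ v] exI[of _ "S - {0}"]) auto
  qed
  have "hh x \<in> K" if "a \<in> I" "b \<in> J" and x: "hh x = a + b" for a b x
  proof -
    obtain v S w T where *: "finite S" "0 \<notin> S" "\<And>k. deg k (v k)" "a - sum v S \<in> K"
      "finite T" "0 \<notin> T" "\<And>k. deg k (w k)" "b - sum w T \<in> K"
      using split[OF \<open>a \<in> I\<close> assms(1)] split[OF \<open>b \<in> J\<close> assms(2)] by blast
    define u where "u k = (if k \<in> S then v k else 0) + (if k \<in> T then w k else 0)" for k
    have su: "sum u (S \<union> T) = sum v S + sum w T"
      using *(1,5) by (simp add: u_def sum.distrib sum.If_cases Int_absorb1 Int_commute)
    have du: "deg k (u k)" for k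
      using * by (auto simp: u_def intro: deg_add deg_zero)
    \<comment> \<open>Entering \<open>- hh x\<close> in the free place of degree 0 gives a sum that
      lies in \<open>K\<close>, from which \<open>eigenvector_split\<close> for \<open>K\<close>
      itself extracts \<open>hh x\<close>.\<close>
    define u' where "u' k = (if k = 0 then - hh x else u k)" for k
    have du': "deg k (u' k)" for k
      using du deg_diff[OF deg_zero deg_h] by (simp add: u'_def)
    have "sum u' (S \<union> T) = sum u (S \<union> T)"
      using *(2,6) by (intro sum.cong) (auto simp: u'_def)
    then have "sum u' (insert 0 (S \<union> T)) = - ((a - sum v S) + (b - sum w T))"
      using * su x by (simp add: u'_def)
    then have "sum u' (insert 0 (S \<union> T)) \<in> K"
      using fideal_minus[OF fideal_K fideal_add[OF fideal_K *(4,8)]] by (simp only:)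
    moreover have "fbr (hh h0) (u' k) - fscale (of_int k) (u' k) \<in> K" for k
      using deg_eigenvector[OF h0 du'] .
    moreover have "inj_on (of_int :: int \<Rightarrow> complex) (insert 0 (S \<union> T))"
      by (simp add: inj_on_def)
    ultimately have "u' 0 \<in> K"
      using eigenvector_split[OF fideal_K, of "insert 0 (S \<union> T)" of_int "hh h0" u' 0] * by blast
    then show ?thesis
      using fideal_minus_iff[OF fideal_K] by (simp add: u'_def)
  qed
  moreover have "K \<subseteq> {x + y |x y. x \<in> I \<and> y \<in> J}"
    using I fideal_zero[OF J(1)] by force
  ultimately show ?thesis
    unfolding htriv_def using fideal_sum[OF I(1) J(1)] by blast
qed

definition Rad :: "('h, 'n) km_gen free_lie set" where
  "Rad = \<Union> {I. htriv I}"

lemma htriv_K: "htriv K"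
  by (simp add: htriv_def fideal_K)

text \<open>By \<open>htriv_sum\<close> any two of the ideals lie in a third one, so that the union
  is closed under addition.\<close>

lemma htriv_Rad: "htriv Rad"
  unfolding htriv_def
proof (intro conjI)
  show "K \<subseteq> Rad" "\<forall>x. hh x \<in> Rad \<longrightarrow> hh x \<in> K"
    using htriv_K by (auto simp: Rad_def htriv_def)
  show "fideal Rad"
    unfolding fideal_def
  proof (intro conjI ballI allI)
    show "0 \<in> Rad"
      using htriv_K fideal_zero[OF fideal_K] by (auto simp: Rad_def)
  next
    fix x y assume "x \<in> Rad" "y \<in> Rad"
    then obtain I J where "htriv I" "x \<in> I" "htriv J" "y \<in> J"
      by (auto simp: Rad_def)
    then show "x + y \<in> Rad"
      using htriv_sum unfolding Rad_def by blast
  next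
    fix c y x assume "x \<in> Rad"
    then obtain I where "htriv I" "x \<in> I"
      by (auto simp: Rad_def)
    then have "fscale c x \<in> I" "fbr y x \<in> I"
      by (auto simp: htriv_def fideal_scale fideal_br_right)
    then show "fscale c x \<in> Rad" "fbr y x \<in> Rad"
      using \<open>htriv I\<close> by (auto simp: Rad_def)
  qed
qed

lemma htriv_subset_Rad: "htriv I \<Longrightarrow> I \<subseteq> Rad"
  by (auto simp: Rad_def)

lemma fideal_Rad: "fideal Rad" and K_subset_Rad: "K \<subseteq> Rad"
  using htriv_Rad by (auto simp: htriv_def)

section \<open>Translation to the given radical and the Kac-Moody algebra\<close>

lemma km_h_trivial_ideal_iff:
  assumes "fideal I" "K \<subseteq> I"
  shows "km_h_trivial_ideal sh \<alpha> \<alpha>v (pcls R ` I) \<longleftrightarrow> htriv I"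
proof -
  have gen: "km_tilde_gen sh \<alpha> \<alpha>v (KH x) = pcls R (hh x)" for x
    using pcls_cls[of R "LGen (KH x)"] by (simp add: km_tilde_gen_def)
  have "pcls R ` I \<inter> range (\<lambda>x. pcls R (hh x)) = {pcls R 0} \<longleftrightarrow> (\<forall>x. hh x \<in> I \<longrightarrow> hh x \<in> K)"
  proof
    assume *: "pcls R ` I \<inter> range (\<lambda>x. pcls R (hh x)) = {pcls R 0}"
    show "\<forall>x. hh x \<in> I \<longrightarrow> hh x \<in> K"
    proof (intro allI impI)
      fix x assume "hh x \<in> I"
      then have "pcls R (hh x) \<in> {pcls R 0}"
        unfolding *[symmetric] by blast
      then show "hh x \<in> K"
        by (simp add: pcls_eq_iff)
    qed
  next
    assume *: "\<forall>x. hh x \<in> I \<longrightarrow> hh x \<in> K"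
    have "pcls R (hh 0) = pcls R 0"
      using hh_0 by (simp add: pcls_eq_iff)
    moreover have "pcls R 0 \<in> pcls R ` I"
      using fideal_zero assms by blast
    ultimately have m0: "pcls R 0 \<in> pcls R ` I \<inter> range (\<lambda>x. pcls R (hh x))"
      by (metis IntI rangeI)
    have zero: "pcls R (hh x) = pcls R 0" if "pcls R (hh x) \<in> pcls R ` I" for x
    proof -
      have "hh x \<in> I"
        using that by (simp only: pcls_image_mem[OF assms])
      then show ?thesis
        using * by (simp add: pcls_eq_iff)
    qed
    have mX: "X = pcls R 0" if "X \<in> pcls R ` I \<inter> range (\<lambda>x. pcls R (hh x))" for X
    proof -
      from that obtain x where "X = pcls R (hh x)"
        by blast
      then show ?thesis
        using that zero[of x] by (simp only: Int_iff)
    qed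
    show "pcls R ` I \<inter> range (\<lambda>x. pcls R (hh x)) = {pcls R 0}"
    proof (intro equalityI subsetI)
      fix X assume "X \<in> pcls R ` I \<inter> range (\<lambda>x. pcls R (hh x))"
      then show "X \<in> {pcls R 0}"
        using mX by simp
    next
      fix X assume "X \<in> {pcls R 0}"
      then show "X \<in> pcls R ` I \<inter> range (\<lambda>x. pcls R (hh x))"
        using m0 by (simp only: singleton_iff)
    qed
  qed
  then show ?thesis
    using assms lie_ideal_presented_image[OF assms]
    by (simp add: km_h_trivial_ideal_def htriv_def km_tilde_def gen lzero_presented)
qed

lemma km_h_trivial_idealE:
  assumes "km_h_trivial_ideal sh \<alpha> \<alpha>v X"
  obtains I where "htriv I" "X = pcls R ` I"
proof -
  obtain I where "fideal I" "K \<subseteq> I" "X = pcls R ` I"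
    using assms lie_ideal_presentedE[of R X] by (auto simp: km_h_trivial_ideal_def km_tilde_def)
  then show thesis
    using that assms km_h_trivial_ideal_iff by blast
qed

text \<open>\<open>Rad\<close> contains all competing ideals, so it is maximal and any other maximal
  one coincides with it.\<close>

lemma km_radical_eq: "km_radical sh \<alpha> \<alpha>v = pcls R ` Rad"
  unfolding km_radical_def
proof (rule the_equality)
  have le: "J \<subseteq> pcls R ` Rad" if J: "km_h_trivial_ideal sh \<alpha> \<alpha>v J" for J
  proof -
    obtain I where "htriv I" "J = pcls R ` I"
      by (rule km_h_trivial_idealE[OF J])
    then show ?thesis
      using htriv_subset_Rad by (simp add: image_mono)
  qed
  have Rad: "km_h_trivial_ideal sh \<alpha> \<alpha>v (pcls R ` Rad)"
    using htriv_Rad by (simp add: km_h_trivial_ideal_iff fideal_Rad K_subset_Rad)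
  then show "km_h_trivial_ideal sh \<alpha> \<alpha>v (pcls R ` Rad) \<and>
      (\<forall>J. km_h_trivial_ideal sh \<alpha> \<alpha>v J \<longrightarrow> pcls R ` Rad \<subseteq> J \<longrightarrow> J = pcls R ` Rad)"
    using le by (simp add: subset_antisym)
  show "X = pcls R ` Rad" if X: "km_h_trivial_ideal sh \<alpha> \<alpha>v X \<and>
      (\<forall>J. km_h_trivial_ideal sh \<alpha> \<alpha>v J \<longrightarrow> X \<subseteq> J \<longrightarrow> J = X)" for X
  proof -
    have "km_h_trivial_ideal sh \<alpha> \<alpha>v X" and max: "pcls R ` Rad = X" if "X \<subseteq> pcls R ` Rad"
      using X Rad that by simp_all
    moreover have "X \<subseteq> pcls R ` Rad"
      using X by (intro le) (rule conjunct1)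
    ultimately show ?thesis
      by simp
  qed
qed

text \<open>The projection from the free Lie algebra onto the Kac-Moody algebra.\<close>

definition kcls :: "('h, 'n) km_gen free_lie \<Rightarrow> ('h, 'n) km_gen lie_term set set" where
  "kcls = qcls R Rad"

lemma kac_moody_eq: "kac_moody sh \<alpha> \<alpha>v = lie_quotient (lie_presented R) (pcls R ` Rad)"
  by (simp add: kac_moody_def km_tilde_def km_radical_eq)

lemma km_elem_eq: "km_elem sh \<alpha> \<alpha>v z = kcls (fgen z)"
  using lie_coset_presented[OF fideal_Rad K_subset_Rad, of "fgen z"] pcls_cls[of R "LGen z"]
  by (simp add: km_elem_def km_tilde_def km_radical_eq km_tilde_gen_def kcls_def)

lemma kcls_eq_iff: "kcls x = kcls y \<longleftrightarrow> x - y \<in> Rad"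
  by (simp add: kcls_def qcls_eq_iff fideal_Rad K_subset_Rad)

lemma kac_moody_simps:
  "car (kac_moody sh \<alpha> \<alpha>v) = range kcls"
  "ladd (kac_moody sh \<alpha> \<alpha>v) (kcls x) (kcls y) = kcls (x + y)"
  "lscale (kac_moody sh \<alpha> \<alpha>v) c (kcls x) = kcls (fscale c x)"
  "lbr (kac_moody sh \<alpha> \<alpha>v) (kcls x) (kcls y) = kcls (fbr x y)"
  by (simp_all add: kac_moody_eq kcls_def car_quotient ladd_quotient lscale_quotient lbr_quotient
      fideal_Rad K_subset_Rad)

text \<open>Representations pulled back along \<open>kcls\<close>, so that the conditions range over
  a whole type and not over a carrier.\<close>

definition is_rep ::
  "(complex \<Rightarrow> 'm \<Rightarrow> 'm) \<Rightarrow> (('h, 'n) km_gen free_lie \<Rightarrow> 'm \<Rightarrow> 'm::ab_group_add) \<Rightarrow> bool" where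
  "is_rep sm \<tau> \<longleftrightarrow> vector_space sm \<and> (\<forall>x. Vector_Spaces.linear sm sm (\<tau> x)) \<and>
     (\<forall>x y m. \<tau> (x + y) m = \<tau> x m + \<tau> y m) \<and> (\<forall>c x m. \<tau> (fscale c x) m = sm c (\<tau> x m)) \<and>
     (\<forall>x y m. \<tau> (fbr x y) m = \<tau> x (\<tau> y m) - \<tau> y (\<tau> x m))"

lemma lie_module_kac_moody_iff:
  "lie_module (kac_moody sh \<alpha> \<alpha>v) sm \<rho> \<longleftrightarrow> is_rep sm (\<lambda>x. \<rho> (kcls x))"
  by (auto simp: lie_module_def is_rep_def kac_moody_simps)

end

subsection \<open>The radical in types A2 and B2\<close>

text \<open>Applied to \<open>(e, f, 1)\<close> and to \<open>(f, e, -1)\<close>, i.e. to both halves of the triangular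
  decomposition.  The roots are \<open>\<alpha>\<^sub>i\<close>, \<open>\<alpha>\<^sub>j\<close>, \<open>\<alpha>\<^sub>i + \<alpha>\<^sub>j\<close> and, for \<open>s = 2\<close>, \<open>\<alpha>\<^sub>i + 2 \<alpha>\<^sub>j\<close>.\<close>

locale finite_type_half = km_algebra sh \<alpha> \<alpha>v
  for sh :: "complex \<Rightarrow> 'h::ab_group_add \<Rightarrow> 'h" and \<alpha> :: "'n \<Rightarrow> 'h \<Rightarrow> complex" and \<alpha>v :: "'n \<Rightarrow> 'h" +
  fixes J :: "('h, 'n) km_gen free_lie set" and e f :: "'n \<Rightarrow> ('h, 'n) km_gen free_lie"
    and \<epsilon> s :: complex and i j :: 'n
  assumes J: "fideal J" "K \<subseteq> J"
    and ij: "i \<noteq> j" "UNIV = {i, j}"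
    and eps: "\<epsilon> * \<epsilon> = 1" and s: "s = 1 \<or> s = 2"
    and cartan: "\<alpha> i (\<alpha>v i) = 2" "\<alpha> j (\<alpha>v j) = 2" "\<alpha> j (\<alpha>v i) = -1" "\<alpha> i (\<alpha>v j) = - s"
    and h_e: "\<And>x k. fbr (hh x) (e k) - fscale (\<epsilon> * \<alpha> k x) (e k) \<in> J"
    and f_e: "\<And>k l. fbr (f k) (e l) - (if k = l then fscale (- \<epsilon>) (hh (\<alpha>v k)) else 0) \<in> J"
    and serre: "fbr (e i) (fbr (e i) (e j)) \<in> J" "fbr (e j) (fbr (e j) (fbr (e j) (e i))) \<in> J"
      "s = 1 \<Longrightarrow> fbr (e j) (fbr (e j) (e i)) \<in> J"
begin

abbreviation "g2 \<equiv> fbr (e j) (e i)"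
abbreviation "g3 \<equiv> fbr (e j) g2"

lemma h_bracket:
  assumes "fbr (hh x) u - fscale a u \<in> J" "fbr (hh x) v - fscale b v \<in> J"
  shows "fbr (hh x) (fbr u v) - fscale (a + b) (fbr u v) \<in> J"
proof -
  have "fbr (fbr (hh x) u - fscale a u) v + fbr u (fbr (hh x) v - fscale b v) \<in> J"
    using assms J by (intro fideal_add[OF J(1) fideal_br_left[OF J(1)] fideal_br_right[OF J(1)]])
  then show ?thesis
    by (simp add: fbr_derivation[of "hh x"] fbr_diff_left fbr_diff_right fbr_scale_left
        fbr_scale_right free_lie.scale_left_distrib algebra_simps)
qed

lemma h_g2: "fbr (hh x) g2 - fscale (\<epsilon> * (\<alpha> i x + \<alpha> j x)) g2 \<in> J"
  using h_bracket[OF h_e[of x j] h_e[of x i]] by (simp add: algebra_simps)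

lemma h_g3: "fbr (hh x) g3 - fscale (\<epsilon> * (\<alpha> i x + 2 * \<alpha> j x)) g3 \<in> J"
  using h_bracket[OF h_e[of x j] h_g2] by (simp add: algebra_simps)

lemma f_bracket:
  assumes "fbr (f k) u - p \<in> J" "fbr (f k) v - q \<in> J" "fbr p v - p' \<in> J" "fbr u q - q' \<in> J"
  shows "fbr (f k) (fbr u v) - (p' + q') \<in> J"
proof -
  have 1: "fbr (fbr (f k) u) v - p' \<in> J"
    by (rule fideal_trans[OF J(1) fbr_mod_left[OF J(1) assms(1)] assms(3)])
  have 2: "fbr u (fbr (f k) v) - q' \<in> J"
    by (rule fideal_trans[OF J(1) fbr_mod_right[OF J(1) assms(2)] assms(4)])
  show ?thesis
    using fideal_add[OF J(1) 1 2] by (simp add: fbr_derivation[of "f k"] algebra_simps)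
qed

lemma scaled_h:
  assumes "fbr (hh x) v - fscale (\<epsilon> * a) v \<in> J"
  shows "fbr (fscale (- \<epsilon>) (hh x)) v - fscale (- a) v \<in> J"
    and "fbr v (fscale (- \<epsilon>) (hh x)) - fscale a v \<in> J"
proof -
  have *: "fscale \<epsilon> (fbr (hh x) v) - fscale a v \<in> J"
    using fideal_scale[OF J(1) assms, of \<epsilon>]
    by (simp add: free_lie.scale_right_diff_distrib mult.assoc[symmetric] eps)
  then show "fbr v (fscale (- \<epsilon>) (hh x)) - fscale a v \<in> J"
    using fbr_anticomm[of v "hh x"] by (simp add: fbr_scale_right fbr_minus_right)
  show "fbr (fscale (- \<epsilon>) (hh x)) v - fscale (- a) v \<in> J"
    using fideal_minus[OF J(1) *] by (simp add: fbr_scale_left fbr_minus_left)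
qed

lemma zero_J: "0 \<in> J"
  using fideal_zero[OF J(1)] .

lemma f_i_g2: "fbr (f i) g2 - fscale (-1) (e j) \<in> J"
  using f_bracket[OF f_e[of i j] f_e[of i i], of 0 "fscale (-1) (e j)"] ij zero_J
    scaled_h(2)[OF h_e[of "\<alpha>v i" j]] cartan by simp

lemma f_j_g2: "fbr (f j) g2 - fscale s (e i) \<in> J"
  using f_bracket[OF f_e[of j j] f_e[of j i], of "fscale s (e i)" 0] ij zero_J
    scaled_h(1)[OF h_e[of "\<alpha>v j" i]] cartan by simp

lemma f_i_g3: "fbr (f i) g3 \<in> J"
  using f_bracket[OF f_e[of i j] f_i_g2, of 0 0] ij zero_J by (simp add: fbr_minus_right)

text \<open>The coroot contributes s - 2 and the bracket of e_j with s e_i contributes s. The total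
  vanishes exactly for s = 1, when \<open>g3\<close> itself lies in \<open>J\<close>.\<close>

lemma f_j_g3: "fbr (f j) g3 - fscale (2 * s - 2) g2 \<in> J"
  using f_bracket[OF f_e[of j j] f_j_g2, of "fscale (s - 2) g2" "fscale s g2"] zero_J
    scaled_h(1)[OF h_g2[of "\<alpha>v j"]] cartan
  by (simp add: fbr_scale_right free_lie.scale_left_distrib[symmetric])

lemma e_i_g2: "fbr (e i) g2 \<in> J"
  using fideal_minus[OF J(1) serre(1)] fbr_anticomm[of "e i" "e j"] by (simp add: fbr_minus_right)

text \<open>The element [e_i, e_j] = - \<open>g2\<close> commutes with \<open>g2\<close>, so by the
  derivation rule only [e_j, [e_i, g2]] remains.\<close>

lemma e_i_g3: "fbr (e i) g3 \<in> J"
proof -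
  have "fbr (fbr (e i) (e j)) g2 = 0"
    using fbr_anticomm[of "e j" "e i"] by (simp add: fbr_minus_left fbr_minus_right)
  then show ?thesis
    using fideal_br_right[OF J(1) e_i_g2] by (simp add: fbr_derivation[of "e i"])
qed

text \<open>\<open>W\<close> is left open because it will be the span of the Cartan subalgebra and
  the root vectors of both halves, and both instances of the locale have to speak about the same
  \<open>W\<close>.\<close>

lemma ad_closed:
  assumes W: "\<And>x y. x \<in> W \<Longrightarrow> y \<in> W \<Longrightarrow> x + y \<in> W" "\<And>c x. x \<in> W \<Longrightarrow> fscale c x \<in> W" "J \<subseteq> W"
    and W_gen: "\<And>x. hh x \<in> W" "e i \<in> W" "e j \<in> W" "g2 \<in> W" "g3 \<in> W"
    and t: "t \<in> {e i, e j, g2, g3}"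
  shows "fbr (hh x) t \<in> W" "fbr (e k) t \<in> W" "fbr (f k) t \<in> W"
proof -
  have cong: "u \<in> W" if "u - v \<in> J" "v \<in> W" for u v
    using W(1)[of "u - v" v] W(3) that by auto
  have J_W: "u \<in> W" if "u \<in> J" for u
    using W(3) that by blast
  show "fbr (hh x) t \<in> W"
    using t cong[OF h_e W(2)] cong[OF h_g2 W(2)] cong[OF h_g3 W(2)] W_gen by blast
  have k: "k = i \<or> k = j"
    using ij by blast
  have "fbr (e i) (e j) = fscale (-1) g2"
    using fbr_anticomm[of "e i" "e j"] by simp
  then have "fbr (e i) (e j) \<in> W"
    using W(2) W_gen by metis
  then show "fbr (e k) t \<in> W"
    using t k J_W[OF e_i_g2] J_W[OF e_i_g3] J_W[OF serre(2)] W_gen J_W[OF zero_J] by auto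
  have "fbr (f k) (e l) \<in> W" for k l
    by (rule cong[OF f_e]) (use W(2)[OF W_gen(1), of "- \<epsilon>"] J_W[OF zero_J] in auto)
  then show "fbr (f k) t \<in> W"
    using t k cong[OF f_i_g2 W(2)] cong[OF f_j_g2 W(2)] J_W[OF f_i_g3] cong[OF f_j_g3 W(2)] W_gen
      by blast
qed

text \<open>Descent by brackets with f: \<open>g3\<close> leads to \<open>g2\<close> (unless s = 1),
  \<open>g2\<close> to e_j, and e_k to its coroot, which is not in I because it is nonzero, a root
  taking the value 2 on it.\<close>

lemma root_vectors_notin:
  assumes I: "fideal I" "J \<subseteq> I" and faithful: "\<And>x. hh x \<in> I \<Longrightarrow> x = 0"
  shows "e k \<notin> I" "g2 \<notin> I" "g3 \<in> I \<Longrightarrow> g3 \<in> J"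
proof -
  have down: "v \<in> I" if "u \<in> I" "fbr w u - v \<in> J" for u v w
    using fideal_cong[OF I(1), of "fbr w u" v] fideal_br_right[OF I(1)] that I(2) by blast
  have eps0: "\<epsilon> \<noteq> 0"
    using eps by auto
  show e: "e k \<notin> I" for k
  proof
    assume "e k \<in> I"
    from down[OF this f_e[of k k]] have "hh (\<alpha>v k) \<in> I"
      using fideal_scale_iff[OF I(1), of "- \<epsilon>"] eps0 by simp
    then have "\<alpha>v k = 0"
      by (rule faithful)
    then have "\<alpha> k (\<alpha>v k) = 0"
      using root_scale[of k 0 0] root_add[of k 0 0] by simp
    then show False
      using cartan ij by (cases "k = i") auto
  qed
  show g2: "g2 \<notin> I"
    using down[OF _ f_i_g2] fideal_scale_iff[OF I(1), of "-1"] e by auto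
  show "g3 \<in> J" if "g3 \<in> I"
    using down[OF that f_j_g3] g2 fideal_scale_iff[OF I(1), of "2 * s - 2"] s serre(3) by auto
qed

end

context km_algebra
begin

text \<open>To be applied to the annihilator of a module. Being \<open>htriv\<close>,
  \<open>J\<close> is contained in \<open>Rad\<close>. Conversely an element of \<open>Rad\<close>
  is, modulo \<open>J\<close>, a combination of a Cartan element and root vectors; the components
  are again in \<open>Rad\<close>, where they lie in \<open>J\<close> by faithfulness and by
  \<open>root_vectors_notin\<close>.\<close>

lemma Rad_subset_finite_type:
  assumes J: "fideal J" "K \<subseteq> J" and faithful: "\<And>x. hh x \<in> J \<Longrightarrow> x = 0"
    and ij: "i \<noteq> j" "UNIV = {i, j}" and s: "s = 1 \<or> s = 2"
    and cartan: "\<alpha> i (\<alpha>v i) = 2" "\<alpha> j (\<alpha>v j) = 2" "\<alpha> j (\<alpha>v i) = -1" "\<alpha> i (\<alpha>v j) = - s"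
    and serre_e: "fbr (ee i) (fbr (ee i) (ee j)) \<in> J" "fbr (ee j) (fbr (ee j) (fbr (ee j) (ee i)))
      \<in> J"
      "s = 1 \<Longrightarrow> fbr (ee j) (fbr (ee j) (ee i)) \<in> J"
    and serre_f: "fbr (ff i) (fbr (ff i) (ff j)) \<in> J" "fbr (ff j) (fbr (ff j) (fbr (ff j) (ff i)))
      \<in> J"
      "s = 1 \<Longrightarrow> fbr (ff j) (fbr (ff j) (ff i)) \<in> J"
  shows "Rad \<subseteq> J"
proof -
  have f_e: "fbr (ff k) (ee l) - (if k = l then fscale (- 1) (hh (\<alpha>v k)) else 0) \<in> J" for k l
    using subsetD[OF J(2) br_f_e[of k l]] by (cases "k = l") simp_all
  have e_f: "fbr (ee k) (ff l) - (if k = l then fscale (- (- 1)) (hh (\<alpha>v k)) else 0) \<in> J" for k l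
    using subsetD[OF J(2) br_e_f[of k l]] by (cases "k = l") simp_all
  interpret pos: finite_type_half sh \<alpha> \<alpha>v J ee ff 1 s i j
    using subsetD[OF J(2) br_h_e] f_e
    by unfold_locales (simp_all only: mult_1 J ij s cartan serre_e not_False_eq_True)
  interpret neg: finite_type_half sh \<alpha> \<alpha>v J ff ee "-1" s i j
    using subsetD[OF J(2) br_h_f] e_f
    by unfold_locales (simp_all only: mult_minus1 minus_mult_minus mult_1 J ij s cartan serre_f
      not_False_eq_True)
  have "htriv J"
    using J faithful hh_0 by (auto simp: htriv_def)
  then have J_Rad: "J \<subseteq> Rad"
    by (rule htriv_subset_Rad)
  have faithful_Rad: "x = 0" if "hh x \<in> Rad" for x
    using htriv_Rad that faithful J(2) by (auto simp: htriv_def)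
  \<comment> \<open>The values 1 and 5 give the eight roots the eigenvalues 1, 5, 6, 11 and their
    negatives, distinct and nonzero, whereas the principal grading would not separate the two simple
    roots. The family \<open>b\<close> is indexed by these eigenvalues.\<close>
  obtain h0 where "\<forall>k. \<alpha> k h0 = (if k = i then 1 else 5)"
    using root_values[of "\<lambda>k. if k = i then 1 else 5"] by blast
  then have h0: "\<alpha> i h0 = 1" "\<alpha> j h0 = 5"
    using ij by auto
  define b :: "int \<Rightarrow> ('h, 'n) km_gen free_lie" where
    "b k = (if k = 1 then ee i else if k = 5 then ee j else if k = 6 then pos.g2 else if k =
      11 then pos.g3
      else if k = -1 then ff i else if k = -5 then ff j else if k =
        -6 then neg.g2 else neg.g3)" for k
  define S where "S = {1, 5, 6, 11, -1, -5, -6, -11 :: int}"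
  have S: "finite S" "0 \<notin> S"
    by (simp_all add: S_def)
  \<comment> \<open>\<open>W\<close> is shown to be everything: it contains the generators and is
    stable under brackets with them.\<close>
  define W where "W = {x. \<exists>y c. x - (hh y + (\<Sum>k\<in>S. fscale (c k) (b k))) \<in> J}"
  have W_cong: "x \<in> W" if xy: "x - y \<in> J" and "y \<in> W" for x y
    using \<open>y \<in> W\<close> fideal_trans[OF J(1) xy] unfolding W_def by blast
  have W_add: "x + y \<in> W" if xy: "x \<in> W" "y \<in> W" for x y
  proof -
    obtain a b' c d where *: "x - (hh a + (\<Sum>k\<in>S. fscale (c k) (b k))) \<in> J"
      "y - (hh b' + (\<Sum>k\<in>S. fscale (d k) (b k))) \<in> J"
      using xy unfolding W_def by blast
    have "(x - (hh a + (\<Sum>k\<in>S. fscale (c k) (b k)))) + (y - (hh b' + (\<Sum>k\<in>S. fscale (d k) (b k))))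
      - (hh (a + b') - (hh a + hh b')) \<in> J"
      using fideal_diff[OF J(1) fideal_add[OF J(1) *]] hh_add J(2) by blast
    then have "x + y - (hh (a + b') + (\<Sum>k\<in>S. fscale (c k + d k) (b k))) \<in> J"
      by (simp add: free_lie.scale_left_distrib sum.distrib algebra_simps)
    then show ?thesis
      unfolding W_def by (auto intro!: exI[of _ "a + b'"] exI[of _ "\<lambda>k. c k + d k"])
  qed
  have W_scale: "fscale r x \<in> W" if x: "x \<in> W" for r x
  proof -
    obtain a c where *: "x - (hh a + (\<Sum>k\<in>S. fscale (c k) (b k))) \<in> J"
      using x unfolding W_def by blast
    have "fscale r (x - (hh a + (\<Sum>k\<in>S. fscale (c k) (b k)))) - (hh (sh r a) - fscale r (hh a)) \<in> J"
      using fideal_diff[OF J(1) fideal_scale[OF J(1) *]] hh_scale J(2) by blast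
    then have "fscale r x - (hh (sh r a) + (\<Sum>k\<in>S. fscale (r * c k) (b k))) \<in> J"
      by (simp add: free_lie.scale_right_diff_distrib free_lie.scale_right_distrib
          free_lie.scale_sum_right algebra_simps)
    then show ?thesis
      unfolding W_def by (auto intro!: exI[of _ "sh r a"] exI[of _ "\<lambda>k. r * c k"])
  qed
  have W_J: "J \<subseteq> W"
  proof
    fix x assume "x \<in> J"
    then have "x - hh 0 \<in> J"
      using fideal_diff[OF J(1)] hh_0 J(2) by blast
    then show "x \<in> W"
      unfolding W_def by (auto intro!: exI[of _ 0] exI[of _ "\<lambda>_. 0"])
  qed
  have W_h: "hh y \<in> W" for y
    using fideal_zero[OF J(1)] unfolding W_def by (auto intro!: exI[of _ y] exI[of _ "\<lambda>_. 0"])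
  have W_b: "b k \<in> W" if k: "k \<in> S" for k
  proof -
    have "(\<Sum>l\<in>S. fscale (if l = k then 1 else 0) (b l)) = (\<Sum>l\<in>S. if k = l then b l else 0)"
      by (rule sum.cong) auto
    then have "(\<Sum>l\<in>S. fscale (if l = k then 1 else 0) (b l)) = b k"
      using k S by simp
    then show ?thesis
      using fideal_minus[OF J(1)] hh_0 J(2) unfolding W_def
      by (auto intro!: exI[of _ 0] exI[of _ "\<lambda>l. if l = k then 1 else 0"])
  qed
  have W_basis: "ee i \<in> W" "ee j \<in> W" "pos.g2 \<in> W" "pos.g3 \<in> W" "ff i \<in> W" "ff j \<in> W" "neg.g2 \<in> W"
    "neg.g3 \<in> W"
    using W_b[of 1] W_b[of 5] W_b[of 6] W_b[of 11] W_b[of "-1"] W_b[of "-5"] W_b[of "-6"] W_b[of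
      "-11"]
    by (simp_all add: S_def b_def)
  have W_minus: "x \<in> W" if "- x \<in> W" for x
    using W_scale[OF that, of "-1"] by simp
  have W_gen: "fgen z \<in> W" for z
  proof (cases z)
    case (KE k)
    then show ?thesis using W_basis ij by (cases "k = i") auto
  next
    case (KF k)
    then show ?thesis using W_basis ij by (cases "k = i") auto
  qed (simp add: W_h)
  have ad_b: "fbr (fgen z) (b k) \<in> W" if "k \<in> S" for z k
  proof -
    have "b k \<in> {ee i, ee j, pos.g2, pos.g3} \<or> b k \<in> {ff i, ff j, neg.g2, neg.g3}"
      by (simp add: b_def)
    then show ?thesis
    proof
      assume "b k \<in> {ee i, ee j, pos.g2, pos.g3}"
      note closed = pos.ad_closed[OF W_add W_scale W_J W_h W_basis(1-4) this]
      show ?thesis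
        by (cases z) (simp_all only: closed)
    next
      assume "b k \<in> {ff i, ff j, neg.g2, neg.g3}"
      note closed = neg.ad_closed[OF W_add W_scale W_J W_h W_basis(5-8) this]
      show ?thesis
        by (cases z) (simp_all only: closed)
    qed
  qed
  have ad_h: "fbr (fgen z) (hh y) \<in> W" for z y
  proof (cases z)
    case (KH x)
    then show ?thesis using br_hh J(2) W_J by auto
  next
    case (KE k)
    then show ?thesis
      using W_cong[OF subsetD[OF J(2) br_h_e'] W_scale[OF W_gen[of "KE k"]]] by simp
  next
    case (KF k)
    then show ?thesis
      using W_cong[OF subsetD[OF J(2) br_h_f'] W_scale[OF W_gen[of "KF k"]]] by simp
  qed
  have W_sum: "sum v A \<in> W" if "\<And>k. k \<in> A \<Longrightarrow> v k \<in> W" for v and A :: "int set"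
    using that W_J fideal_zero[OF J(1)] by (induction A rule: infinite_finite_induct) (auto intro:
      W_add)
  have ad_gen: "fbr (fgen z) x \<in> W" if x: "x \<in> W" for z x
  proof -
    obtain a c where *: "x - (hh a + (\<Sum>k\<in>S. fscale (c k) (b k))) \<in> J"
      using x unfolding W_def by blast
    show ?thesis
      by (rule W_cong[OF fbr_mod_right[OF J(1) *]])
        (auto simp: fbr_add_right fbr_sum_right fbr_scale_right intro!: W_add W_sum W_scale ad_h
          ad_b)
  qed
  have ad: "fbr t x \<in> W" if "x \<in> W" for t x
    using that
  proof (induction t arbitrary: x rule: free_lie_induct)
    case zero
    then show ?case using fideal_zero[OF J(1)] W_J by auto
  next
    case (br s t)
    have "fbr (fbr s t) x = fbr s (fbr t x) + fscale (-1) (fbr t (fbr s x))"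
      using fbr_derivation[of s t x] by simp
    then show ?case using br W_add W_scale by (simp only:)
  qed (simp_all add: ad_gen fbr_add_left fbr_scale_left W_add W_scale)
  have W_all: "t \<in> W" for t
    using fideal_zero[OF J(1)] W_J
    by (induction t rule: free_lie_induct) (auto intro: W_gen W_add W_scale ad)
  have eig: "fbr (hh h0) (b k) - fscale (of_int k) (b k) \<in> J" if "k \<in> S" for k
    using that pos.h_e[of h0 i] pos.h_e[of h0 j] pos.h_g2[of h0] pos.h_g3[of h0]
      neg.h_e[of h0 i] neg.h_e[of h0 j] neg.h_g2[of h0] neg.h_g3[of h0]
    by (auto simp: S_def b_def h0)
  show "Rad \<subseteq> J"
  proof
    fix x assume x: "x \<in> Rad"
    obtain y c where *: "x - (hh y + (\<Sum>k\<in>S. fscale (c k) (b k))) \<in> J"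
      using W_all[of x] unfolding W_def by blast
    define v where "v k = (if k = 0 then hh y else fscale (c k) (b k))" for k
    have sum_v: "sum v (insert 0 S) = hh y + (\<Sum>k\<in>S. fscale (c k) (b k))"
      using S by (simp add: v_def) (rule sum.cong, auto)
    have sum_Rad: "sum v (insert 0 S) \<in> Rad"
      using fideal_cong[OF fideal_Rad, of x "sum v (insert 0 S)"] * J_Rad x sum_v by auto
    have eig_v: "fbr (hh h0) (v k) - fscale (of_int k) (v k) \<in> Rad" if k: "k \<in> insert 0 S" for k
    proof (cases "k = 0")
      case True
      then show ?thesis using br_hh K_subset_Rad by (auto simp: v_def)
    next
      case False
      then have "fscale (c k) (fbr (hh h0) (b k) - fscale (of_int k) (b k)) \<in> Rad"
        using eig[of k] k J_Rad fideal_scale[OF fideal_Rad] by blast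
      then show ?thesis
        using False by (simp add: v_def fbr_scale_right free_lie.scale_right_diff_distrib
          mult.commute)
    qed
    have inj: "inj_on (of_int :: int \<Rightarrow> complex) (insert 0 S)"
      by (simp add: inj_on_def)
    have v_Rad: "v k \<in> Rad" if "k \<in> insert 0 S" for k
      by (rule eigenvector_split[OF fideal_Rad _ inj eig_v sum_Rad that]) (simp add: S)
    \<comment> \<open>Only the two elements \<open>g3\<close> can lie in \<open>Rad\<close>; for the
      other root vectors the assumption is contradictory.\<close>
    have b_J: "b k \<in> J" if "k \<in> S" "b k \<in> Rad" for k
      using that pos.root_vectors_notin[OF fideal_Rad J_Rad faithful_Rad]
        neg.root_vectors_notin[OF fideal_Rad J_Rad faithful_Rad]
      by (auto simp: S_def b_def)
    have "v k \<in> J" if k: "k \<in> insert 0 S" for k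
    proof (cases "k = 0")
      case True
      then show ?thesis
        using v_Rad[OF k] faithful_Rad[of y] hh_0 J(2) by (auto simp: v_def)
    next
      case False
      then have "k \<in> S" "fscale (c k) (b k) \<in> Rad"
        using k v_Rad[OF k] by (auto simp: v_def)
      then show ?thesis
        using False b_J fideal_scale_iff[OF fideal_Rad, of "c k"] fideal_zero[OF J(1)]
          fideal_scale[OF J(1)] by (cases "c k = 0") (auto simp: v_def)
    qed
    then have "sum v (insert 0 S) \<in> J"
      by (rule fideal_sum_mem[OF J(1)])
    then show "x \<in> J"
      using * fideal_cong[OF J(1)] sum_v by metis
  qed
qed

end

section \<open>Evaluation of polynomials in two variables\<close>

lemma poly_ext:
  fixes p q :: "complex poly"
  assumes "\<And>x. poly p x = poly q x" shows "p = q"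
  using assms by (simp add: poly_eq_poly_eq_iff[symmetric] fun_eq_iff)

definition ev2 :: "poly2 \<Rightarrow> complex \<Rightarrow> complex \<Rightarrow> complex" where
  "ev2 p x y = poly (poly p [:y:]) x"

lemma ev2_simps [simp]:
  "ev2 0 x y = 0" "ev2 1 x y = 1" "ev2 (numeral n) x y = numeral n"
  "ev2 (p + q) x y = ev2 p x y + ev2 q x y" "ev2 (p - q) x y = ev2 p x y - ev2 q x y"
  "ev2 (- p) x y = - ev2 p x y" "ev2 (p * q) x y = ev2 p x y * ev2 q x y" "ev2 (p ^ k) x y =
    ev2 p x y ^ k"
  "ev2 (const2 c) x y = c" "ev2 (Hvar (Suc 0)) x y = x" "ev2 (Hvar 2) x y = y" "ev2 (Hvar 0) x y =
    0"
  "ev2 (Hvar 3) x y = 0"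
  by (simp_all add: ev2_def const2_def Hvar_def poly_power)

lemma ev2_shift2_1 [simp]: "ev2 (shift2 (Suc 0) c p) x y = ev2 p (x + c) y"
proof -
  have "ev2 (map_poly (\<lambda>q. pcompose q [:c, 1:]) p) x y = ev2 p (x + c) y"
    unfolding ev2_def by (induction p) (simp_all add: map_poly_pCons poly_pcompose add.commute)
  then show ?thesis
    by (simp add: shift2_def)
qed

lemma ev2_shift2_2 [simp]: "ev2 (shift2 2 c p) x y = ev2 p x (y + c)"
  by (simp add: shift2_def ev2_def poly_pcompose add.commute)

lemma poly2_eqI:
  assumes "\<And>x y. ev2 p x y = ev2 q x y" shows "p = q"
proof -
  have "poly (p - q) [:y:] = 0" for y
    using assms by (intro poly_ext) (simp add: ev2_def)
  then have "range (\<lambda>y. [:y:]) \<subseteq> {z. poly (p - q) z = 0}"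
    by auto
  moreover have "infinite (range (\<lambda>y :: complex. [:y:]))"
    by (simp add: finite_image_iff inj_on_def infinite_UNIV_char_0)
  ultimately have "infinite {z. poly (p - q) z = 0}"
    using finite_subset by blast
  then have "p - q = 0"
    using poly_roots_finite by blast
  then show ?thesis
    by simp
qed

lemma periodic_poly_const:
  fixes d :: "complex poly"
  assumes "\<And>y. poly d y = poly d (y - 1)" shows "d = [:poly d 0:]"
proof -
  have nat: "poly d (of_nat n) = poly d 0" for n
  proof (induction n)
    case (Suc n)
    then show ?case using assms[of "of_nat (Suc n)"] by simp
  qed simp
  have "d - [:poly d 0:] = 0"
  proof (rule ccontr)
    assume "d - [:poly d 0:] \<noteq> 0"
    then have "finite {x. poly (d - [:poly d 0:]) x = 0}"
      by (rule poly_roots_finite)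
    moreover have "range (of_nat :: nat \<Rightarrow> complex) \<subseteq> {x. poly (d - [:poly d 0:]) x = 0}"
      using nat by auto
    ultimately have "finite (range (of_nat :: nat \<Rightarrow> complex))"
      by (rule rev_finite_subset)
    then show False
      by (simp add: finite_image_iff inj_of_nat)
  qed
  then show ?thesis by simp
qed

lemma linear_difference_quadratic:
  fixes c :: "complex poly"
  assumes "\<And>y. poly c y - poly c (y - 1) = p + q * y"
  shows "\<exists>a0 a1 a2. c = [:a0, a1, a2:]"
proof -
  \<comment> \<open>The subtracted quadratic polynomial has the backward difference p + q y, so
    \<open>d\<close> is periodic.\<close>
  define d where "d = c - [:0, p + q / 2, q / 2:]"
  have "poly d y = poly d (y - 1)" for y
    using assms[of y] by (simp add: d_def field_simps)
  then have "d = [:poly d 0:]"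
    by (rule periodic_poly_const)
  then have "c = [:poly d 0:] + [:0, p + q / 2, q / 2:]"
    by (metis d_def diff_add_cancel)
  then have "c = [:poly d 0, p + q / 2, q / 2:]"
    by simp
  then show ?thesis
    by blast
qed

section \<open>The exchange equation in the invariant polynomials c1 and c2\<close>

context
  fixes c1 c2 :: "complex poly" and \<rho> \<kappa> u w :: complex
  assumes nz: "\<rho> \<noteq> 0" "\<kappa> \<noteq> 0"
    and star: "\<And>x y. (poly c1 y - (x - \<rho> * y + u)\<^sup>2) * (poly c2 x - (y - \<kappa> * x + w)\<^sup>2) =
      (poly c1 (y - 1) - (x - \<rho> * y + u + \<rho>)\<^sup>2) * (poly c2 (x - 1) - (y - \<kappa> * x + w + \<kappa>)\<^sup>2)"
begin

text \<open>Compare the coefficients of x^n for n = degree c2, with y as a parameter. The square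
  subtracted from c2 has degree 2 in x and enters only through \<open>T\<close>, and the terms with
  y^2 cancel because c2 and its translate have the same leading coefficient. So c1(y) - c1(y - 1) is
  linear in y.\<close>

lemma star_high_degree:
  assumes "degree c2 \<ge> 3" shows "\<exists>a0 a1 a2. c1 = [:a0, a1, a2:]"
proof -
  obtain m where m: "degree c2 = Suc (Suc (Suc m))"
    using assms by (metis Suc_diff_le add_2_eq_Suc le_add_diff_inverse numeral_3_eq_3
      plus_nat.simps(2))
  define n where "n = degree c2"
  define c2' where "c2' = pcompose c2 [:-1, 1:]"
  have deg': "degree c2' = n"
    by (simp add: c2'_def n_def degree_pcompose)
  have lead: "coeff c2' n = coeff c2 n"
    using lead_coeff_comp[of "[:-1, 1:] :: complex poly" c2] deg' by (simp add: c2'_def n_def)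
  have nz': "coeff c2 n \<noteq> 0"
    using m unfolding n_def by (metis degree_0 leading_coeff_0_iff nat.distinct(1))
  define T where "T y = [:u - \<rho> * y, 1:]\<^sup>2 * [:y + w, - \<kappa>:]\<^sup>2 - [:u - \<rho> * y + \<rho>, 1:]\<^sup>2 * [:y + w +
    \<kappa>, - \<kappa>:]\<^sup>2"
    for y
  have coef: "coeff ([:a, 1:]\<^sup>2 * c) n = coeff c (n - 2) + 2 * a * coeff c (n - 1) + a\<^sup>2 * coeff c
    n"
    for a and c :: "complex poly"
    by (simp add: power2_eq_square n_def m algebra_simps coeff_pCons)
  have coefY: "coeff ([:a, - \<kappa>:]\<^sup>2) n = 0" for a
    by (simp add: power2_eq_square n_def m coeff_pCons)
  \<comment> \<open>\<open>T y\<close> has formal degree 4 in x. Its x^4 terms cancel, and in the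
    coefficient of x^3 everything containing y cancels; m = 0 is the case n = 3.\<close>
  have "\<exists>t. \<forall>y. coeff (T y) n = t"
  proof (cases m)
    case 0
    show ?thesis
      by (rule exI[of _ "2 * \<rho> * \<kappa>\<^sup>2 * -1 + 2 * \<kappa>\<^sup>2"])
        (simp add: T_def power2_eq_square n_def m 0 coeff_pCons algebra_simps)
  next
    case (Suc m')
    then show ?thesis
      by (auto simp: T_def power2_eq_square n_def m coeff_pCons algebra_simps split: nat.splits)
  qed
  then obtain t where t: "\<And>y. coeff (T y) n = t"
    by blast
  have eq: "coeff c2 n * (poly c1 y - poly c1 (y - 1)) =
      (coeff c2 (n - 2) + 2 * (u - \<rho> * y) * coeff c2 (n - 1) + (u - \<rho> * y)\<^sup>2 * coeff c2 n)
      - (coeff c2' (n - 2) + 2 * (u - \<rho> * y + \<rho>) * coeff c2' (n - 1) + (u - \<rho> * y + \<rho>)\<^sup>2 * coeff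
        c2 n) - t" for y
  proof -
    have "([:poly c1 y:] - [:u - \<rho> * y, 1:]\<^sup>2) * (c2 - [:y + w, - \<kappa>:]\<^sup>2)
        = ([:poly c1 (y - 1):] - [:u - \<rho> * y + \<rho>, 1:]\<^sup>2) * (c2' - [:y + w + \<kappa>, - \<kappa>:]\<^sup>2)"
    proof (rule poly_ext)
      fix x
      show "poly (([:poly c1 y:] - [:u - \<rho> * y, 1:]\<^sup>2) * (c2 - [:y + w, - \<kappa>:]\<^sup>2)) x
        = poly (([:poly c1 (y - 1):] - [:u - \<rho> * y + \<rho>, 1:]\<^sup>2) * (c2' - [:y + w + \<kappa>, - \<kappa>:]\<^sup>2)) x"
        using star[of y x] by (simp add: c2'_def poly_pcompose poly_power algebra_simps)
    qed
    then have "smult (poly c1 y) c2 - smult (poly c1 (y - 1)) c2' - smult (poly c1 y) ([:y + w, -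
      \<kappa>:]\<^sup>2)
        + smult (poly c1 (y - 1)) ([:y + w + \<kappa>, - \<kappa>:]\<^sup>2)
      = [:u - \<rho> * y, 1:]\<^sup>2 * c2 - [:u - \<rho> * y + \<rho>, 1:]\<^sup>2 * c2' - T y"
      by (simp add: T_def algebra_simps)
    then have "coeff (smult (poly c1 y) c2 - smult (poly c1 (y - 1)) c2' - smult (poly c1 y) ([:y
      + w, - \<kappa>:]\<^sup>2)
        + smult (poly c1 (y - 1)) ([:y + w + \<kappa>, - \<kappa>:]\<^sup>2)) n
      = coeff ([:u - \<rho> * y, 1:]\<^sup>2 * c2 - [:u - \<rho> * y + \<rho>, 1:]\<^sup>2 * c2' - T y) n"
      by simp
    then show ?thesis
      by (simp only: coeff_diff coeff_add coeff_smult coef coefY t lead) (simp add: algebra_simps)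
  qed
  define g g1 g2 d1 d2 where "g = coeff c2 n" and "g1 = coeff c2 (n - 1)" and "g2 =
    coeff c2 (n - 2)"
    and "d1 = coeff c2' (n - 1)" and "d2 = coeff c2' (n - 2)"
  have "poly c1 y - poly c1 (y - 1) =
      (g2 + 2 * u * g1 + u\<^sup>2 * g - d2 - 2 * (u + \<rho>) * d1 - (u + \<rho>)\<^sup>2 * g - t) / g
      + ((- 2 * \<rho> * g1 - 2 * u * \<rho> * g + 2 * \<rho> * d1 + 2 * (u + \<rho>) * \<rho> * g) / g) * y" for y
  proof -
    have g: "g \<noteq> 0"
      using nz' by (simp add: g_def)
    have "g * (poly c1 y - poly c1 (y - 1)) =
      (g2 + 2 * u * g1 + u\<^sup>2 * g - d2 - 2 * (u + \<rho>) * d1 - (u + \<rho>)\<^sup>2 * g - t)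
      + (- 2 * \<rho> * g1 - 2 * u * \<rho> * g + 2 * \<rho> * d1 + 2 * (u + \<rho>) * \<rho> * g) * y"
      using eq[of y] unfolding g_def[symmetric] g1_def[symmetric] g2_def[symmetric]
        d1_def[symmetric] d2_def[symmetric] by (simp add: power2_eq_square algebra_simps)
    then show ?thesis
      using g by (simp add: nonzero_eq_divide_eq add_divide_distrib[symmetric] mult.commute)
  qed
  then show ?thesis
    by (rule linear_difference_quadratic)
qed

text \<open>With x as a parameter both sides are products of quadratics in y. If A2 differs from
  \<rho>^2, the coefficient of y^2 shows that c2(x) - c2(x - 1) is linear in x. Otherwise the
  coefficient of y is used: the same linear factor \<open>L\<close> occurs on both sides, and
  \<open>L * D\<close> has degree at most 2.\<close>

lemma star_quadratic_right:
  assumes c1: "c1 = [:A0, A1, A2:]" shows "\<exists>b0 b1 b2. c2 = [:b0, b1, b2:]"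
proof -
  have coefs:
    "(A2 - \<rho>\<^sup>2) * (poly c2 x - (w - \<kappa> * x)\<^sup>2) - 2 * (w - \<kappa> * x) * (A1 + 2 * \<rho> * (x + u)) - (A0 -
      (x + u)\<^sup>2)
     = (A2 - \<rho>\<^sup>2) * (poly c2 (x - 1) - (w - \<kappa> * x + \<kappa>)\<^sup>2)
       - 2 * (w - \<kappa> * x + \<kappa>) * (A1 - 2 * A2 + 2 * \<rho> * (x + u + \<rho>)) - (A2 - A1 + A0 - (x + u +
         \<rho>)\<^sup>2)" (is ?goal2)
    "(A1 + 2 * \<rho> * (x + u)) * (poly c2 x - (w - \<kappa> * x)\<^sup>2) - 2 * (w - \<kappa> * x) * (A0 - (x + u)\<^sup>2)
     = (A1 - 2 * A2 + 2 * \<rho> * (x + u + \<rho>)) * (poly c2 (x - 1) - (w - \<kappa> * x + \<kappa>)\<^sup>2)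
       - 2 * (w - \<kappa> * x + \<kappa>) * (A2 - A1 + A0 - (x + u + \<rho>)\<^sup>2)" (is ?goal1) for x
  proof -
    define b d P P' where "b = x + u" and "d = w - \<kappa> * x" and "P = poly c2 x - d\<^sup>2"
      and "P' = poly c2 (x - 1) - (d + \<kappa>)\<^sup>2"
    have "[:A0 - b\<^sup>2, A1 + 2 * \<rho> * b, A2 - \<rho>\<^sup>2:] * [:P, - 2 * d, -1:]
        = [:A2 - A1 + A0 - (b + \<rho>)\<^sup>2, A1 - 2 * A2 + 2 * \<rho> * (b + \<rho>), A2 - \<rho>\<^sup>2:] * [:P', - 2 * (d +
          \<kappa>), -1:]"
    proof (rule poly_ext)
      fix y
      have 1: "poly [:A0 - b\<^sup>2, A1 + 2 * \<rho> * b, A2 - \<rho>\<^sup>2:] y = poly c1 y - (x - \<rho> * y + u)\<^sup>2"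
        by (simp add: c1 b_def power2_eq_square algebra_simps)
      have 2: "poly [:P, - 2 * d, -1:] y = poly c2 x - (y - \<kappa> * x + w)\<^sup>2"
        by (simp add: P_def d_def power2_eq_square algebra_simps)
      have 3: "poly [:A2 - A1 + A0 - (b + \<rho>)\<^sup>2, A1 - 2 * A2 + 2 * \<rho> * (b + \<rho>), A2 - \<rho>\<^sup>2:] y
          = poly c1 (y - 1) - (x - \<rho> * y + u + \<rho>)\<^sup>2"
        by (simp add: c1 b_def power2_eq_square algebra_simps)
      have 4: "poly [:P', - 2 * (d + \<kappa>), -1:] y = poly c2 (x - 1) - (y - \<kappa> * x + w + \<kappa>)\<^sup>2"
        by (simp add: P'_def d_def power2_eq_square algebra_simps)
      show "poly ([:A0 - b\<^sup>2, A1 + 2 * \<rho> * b, A2 - \<rho>\<^sup>2:] * [:P, - 2 * d, -1:]) y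
        = poly ([:A2 - A1 + A0 - (b + \<rho>)\<^sup>2, A1 - 2 * A2 + 2 * \<rho> * (b + \<rho>), A2 - \<rho>\<^sup>2:] * [:P', - 2
          * (d + \<kappa>), -1:]) y"
        unfolding poly_mult 1 2 3 4 by (rule star)
    qed
    note eq = this
    have cf: "coeff ([:a0, a1, a2:] * [:p0, p1, p2:]) 1 = a1 * p0 + p1 * a0"
      "coeff ([:a0, a1, a2:] * [:p0, p1, p2:]) 2 =
        a2 * p0 + p1 * a1 + p2 * a0" for a0 a1 a2 p0 p1 p2 :: complex
      by (simp_all add: numeral_2_eq_2 algebra_simps)
    show ?goal2 ?goal1
      using arg_cong[OF eq, of "\<lambda>p. coeff p 2"] arg_cong[OF eq, of "\<lambda>p. coeff p 1"]
      unfolding cf P_def P'_def b_def d_def by algebra+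
  qed
  show ?thesis
  proof (cases "A2 = \<rho>\<^sup>2")
    case False
    define q0 where "q0 = - (A2 - \<rho>\<^sup>2) * (2 * w * \<kappa> + \<kappa>\<^sup>2) + 2 * w * (A1 + 2 * \<rho> * u)
      - 2 * (w + \<kappa>) * (A1 - 2 * A2 + 2 * \<rho> * (u + \<rho>)) + A0 - (A2 - A1 + A0) + (u + \<rho>)\<^sup>2 - u\<^sup>2"
    define q1 where "q1 = (A2 - \<rho>\<^sup>2) * (2 * \<kappa>\<^sup>2) + 4 * w * \<rho> - 2 * \<kappa> * (A1 + 2 * \<rho> * u)
      - 4 * (w + \<kappa>) * \<rho> + 2 * \<kappa> * (A1 - 2 * A2 + 2 * \<rho> * (u + \<rho>)) + 2 * (u + \<rho>) - 2 * u"
    have "(A2 - \<rho>\<^sup>2) * (poly c2 x - poly c2 (x - 1)) = q0 + q1 * x" for x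
      using coefs(1)[of x] unfolding q0_def q1_def by algebra
    then have "poly c2 x - poly c2 (x - 1) = q0 / (A2 - \<rho>\<^sup>2) + (q1 / (A2 - \<rho>\<^sup>2)) * x" for x
      using False by (simp add: nonzero_eq_divide_eq add_divide_distrib[symmetric] mult.commute)
    then show ?thesis
      by (rule linear_difference_quadratic)
  next
    case True
    define L where "L = [:A1 + 2 * \<rho> * u, 2 * \<rho>:]"
    define D where "D = c2 - pcompose c2 [:-1, 1:]"
    define q0 where "q0 = - (A1 + 2 * \<rho> * u) * (2 * w * \<kappa> + \<kappa>\<^sup>2) + 2 * w * (A0 - u\<^sup>2)
      - 2 * (w + \<kappa>) * (A2 - A1 + A0 - (u + \<rho>)\<^sup>2)"
    define q1 where "q1 = (A1 + 2 * \<rho> * u) * (2 * \<kappa>\<^sup>2) - 2 * \<rho> * (2 * w * \<kappa> + \<kappa>\<^sup>2) - 4 * w * u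
      - 2 * \<kappa> * (A0 - u\<^sup>2) + 4 * (w + \<kappa>) * (u + \<rho>) + 2 * \<kappa> * (A2 - A1 + A0 - (u + \<rho>)\<^sup>2)"
    define q2 where "q2 = 2 * \<rho> * (2 * \<kappa>\<^sup>2) - 2 * w + 4 * \<kappa> * u + 2 * (w + \<kappa>) - 4 * \<kappa> * (u + \<rho>)"
    have "L * D = [:q0, q1, q2:]"
    proof (rule poly_ext)
      fix x
      show "poly (L * D) x = poly [:q0, q1, q2:] x"
        using coefs(2)[of x] True unfolding q0_def q1_def q2_def L_def D_def
        by (simp add: poly_pcompose) algebra
    qed
    then have "degree (L * D) \<le> 2"
      by simp
    moreover have "degree L = 1" "L \<noteq> 0"
      using nz by (simp_all add: L_def)
    ultimately have "degree D \<le> 1 \<or> D = 0"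
      by (cases "D = 0") (auto simp: degree_mult_eq)
    then have "degree D \<le> 1"
      by auto
    then have "D = [:coeff D 0, coeff D 1:]"
      by (intro poly_eqI) (auto simp: coeff_pCons coeff_eq_0 split: nat.splits)
    then have "poly D x = coeff D 0 + coeff D 1 * x" for x
      by (metis add.right_neutral mult.commute mult_zero_right poly_0 poly_pCons)
    then have "poly c2 x - poly c2 (x - 1) = coeff D 0 + coeff D 1 * x" for x
      by (simp add: D_def poly_pcompose)
    then show ?thesis
      by (rule linear_difference_quadratic)
  qed
qed

end

lemma degree_less_3: "degree (c :: complex poly) < 3 \<Longrightarrow> \<exists>a0 a1 a2. c = [:a0, a1, a2:]"
proof -
  assume "degree c < 3"
  then have "c = [:coeff c 0, coeff c 1, coeff c 2:]"
    by (intro poly_eqI) (auto simp: coeff_pCons coeff_eq_0 numeral_2_eq_2 split: nat.splits)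
  then show ?thesis
    by blast
qed

definition star_eq ::
  "complex poly \<Rightarrow> complex poly \<Rightarrow> complex \<Rightarrow> complex \<Rightarrow> complex \<Rightarrow> complex \<Rightarrow> bool" where
  "star_eq c1 c2 \<rho> \<kappa> u w \<longleftrightarrow> (\<forall>x y.
     (poly c1 y - (x - \<rho> * y + u)\<^sup>2) * (poly c2 x - (y - \<kappa> * x + w)\<^sup>2) =
     (poly c1 (y - 1) - (x - \<rho> * y + u + \<rho>)\<^sup>2) * (poly c2 (x - 1) - (y - \<kappa> * x + w + \<kappa>)\<^sup>2))"

text \<open>The equation is invariant under exchanging (c1, \<rho>, u, x) with (c2, \<kappa>, w, y).
  So it suffices that one of c1, c2 is quadratic, and if c2 is not, then c1 is by
  \<open>star_high_degree\<close>.\<close>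

lemma star_quadratic:
  fixes c1 c2 :: "complex poly" and \<rho> \<kappa> u w :: complex
  assumes nz: "\<rho> \<noteq> 0" "\<kappa> \<noteq> 0"
    and star_eq: "star_eq c1 c2 \<rho> \<kappa> u w"
  obtains A0 A1 A2 B0 B1 B2 where "c1 = [:A0, A1, A2:]" "c2 = [:B0, B1, B2:]"
proof -
  note star = star_eq[unfolded star_eq_def, rule_format]
  have star': "(poly c2 y - (x - \<kappa> * y + w)\<^sup>2) * (poly c1 x - (y - \<rho> * x + u)\<^sup>2) =
      (poly c2 (y - 1) - (x - \<kappa> * y + w + \<kappa>)\<^sup>2) * (poly c1 (x - 1) - (y - \<rho> * x + u + \<rho>)\<^sup>2)" for x y
    using star[of x y] by (simp add: mult.commute)
  show thesis
  proof (cases "degree c2 < 3")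
    case True
    then obtain B0 B1 B2 where "c2 = [:B0, B1, B2:]"
      using degree_less_3 by blast
    then show thesis
      using star_quadratic_right[OF nz(2,1) star'] that by blast
  next
    case False
    then obtain A0 A1 A2 where "c1 = [:A0, A1, A2:]"
      using star_high_degree[OF nz star] by (meson not_less)
    then show thesis
      using star_quadratic_right[OF nz star] that by blast
  qed
qed


lemma cubic_zero:
  fixes k30 :: complex
  assumes "\<And>x y. k30 * x^3 + k21 * x^2 * y + k12 * x * y^2 + k03 * y^3 + k20 * x^2 + k11 * x * y +
    k02 * y^2
    + k10 * x + k01 * y + k00 = 0"
  shows "k30 = 0" "k21 = 0" "k12 = 0" "k03 = 0" "k20 = 0" "k11 = 0" "k02 = 0" "k10 = 0" "k01 =
    0" "k00 = 0"
proof -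
  have "[:[:k00, k10, k20, k30:], [:k01, k11, k21:], [:k02, k12:], [:k03:]:] = (0 :: poly2)"
    by (rule poly2_eqI) (use assms in \<open>simp add: ev2_def power2_eq_square power3_eq_cube
      algebra_simps\<close>)
  then show "k30 = 0" "k21 = 0" "k12 = 0" "k03 = 0" "k20 = 0" "k11 = 0" "k02 = 0" "k10 = 0" "k01 =
    0" "k00 = 0"
    by simp_all
qed

text \<open>The difference of the two sides of \<open>star_eq\<close>. Its terms of degree 4 cancel,
  and the others are sorted in the order of the monomials of \<open>cubic_zero\<close>.\<close>

lemma star_coefficients:
  fixes A0 A1 A2 B0 B1 B2 \<rho> \<kappa> u w :: complex
  assumes "star_eq [:A0, A1, A2:] [:B0, B1, B2:] \<rho> \<kappa> u w"
  shows
   "(2 * B2 * \<rho> - 2 * B2 - 2 * \<rho> * \<kappa>^2 + 2 * \<kappa>^2) * x^3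
    + (2 * A2 * B2 - 2 * A2 * \<kappa>^2 - 2 * B2 * \<rho>^2 + 4 * B2 * \<rho> + 2 * \<rho>^2 *
      \<kappa>^2 - 4 * \<rho> * \<kappa>^2 + 4 * \<rho> * \<kappa> - 2 * \<kappa>) * x^2 * y
    + (2 * A2 * B2 - 2 * A2 * \<kappa>^2 + 4 * A2 * \<kappa> - 2 * B2 * \<rho>^2 + 2 * \<rho>^2
      * \<kappa>^2 - 4 * \<rho>^2 * \<kappa> + 4 * \<rho> * \<kappa> - 2 * \<rho>) * x * y^2
    + (2 * A2 * \<kappa> - 2 * A2 - 2 * \<rho>^2 * \<kappa> + 2 * \<rho>^2) * y^3
    + (A1 * B2 - A1 * \<kappa>^2 - A2 * B2 + A2 * \<kappa>^2 + 2 * B1 * \<rho> - B1 + B2 *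
      \<rho>^2 + 2 * B2 * \<rho> * u - 4 * B2 * \<rho> - 4 * B2 * u + B2 - \<rho>^2 * \<kappa>^2
      - 2 * \<rho> * \<kappa>^2 * u + 4 * \<rho> * \<kappa>^2 + 4 * \<rho> * \<kappa> * w + 4 *
      \<kappa>^2 * u - \<kappa>^2 - 2 * \<kappa> * w) * x^2
    + (2 * A1 * B2 - 2 * A1 * \<kappa>^2 + 2 * A1 * \<kappa> + 2 * A2 * B1 - 4 * A2 * B2 + 4 *
      A2 * \<kappa>^2 + 4 * A2 * \<kappa> * w - 2 * A2 * \<kappa> - 2 * B1 * \<rho>^2 + 2 * B1 *
      \<rho> + 4 * B2 * \<rho>^2 + 4 * B2 * \<rho> * u - 2 * B2 * \<rho> - 4 * \<rho>^2 *
      \<kappa>^2 - 4 * \<rho>^2 * \<kappa> * w + 2 * \<rho>^2 * \<kappa> - 4 * \<rho> *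
      \<kappa>^2 * u + 2 * \<rho> * \<kappa>^2 + 4 * \<rho> * \<kappa> * u + 4 * \<rho> *
      \<kappa> * w - 4 * \<rho> * \<kappa> - 4 * \<rho> * w - 4 * \<kappa> * u) * x * y
    + (2 * A1 * \<kappa> - A1 + A2 * B1 - A2 * B2 + A2 * \<kappa>^2 + 2 * A2 * \<kappa> * w - 4
      * A2 * \<kappa> - 4 * A2 * w + A2 - B1 * \<rho>^2 + B2 * \<rho>^2 - \<rho>^2 * \<kappa>^2
      - 2 * \<rho>^2 * \<kappa> * w + 4 * \<rho>^2 * \<kappa> + 4 * \<rho>^2 * w - \<rho>^2 + 4
      * \<rho> * \<kappa> * u - 2 * \<rho> * u) * y^2
    + (2 * A0 * B2 - 2 * A0 * \<kappa>^2 + A1 * B1 - 2 * A1 * B2 + 2 * A1 * \<kappa>^2 + 2 * A1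
      * \<kappa> * w - A2 * B1 + 2 * A2 * B2 - 2 * A2 * \<kappa>^2 - 2 * A2 * \<kappa> * w + 2 *
      B0 * \<rho> + B1 * \<rho>^2 + 2 * B1 * \<rho> * u - 2 * B1 * \<rho> - 2 * B1 * u - 2 * B2
      * \<rho>^2 - 4 * B2 * \<rho> * u + 2 * B2 * \<rho> - 2 * B2 * u^2 + 2 * B2 * u + 2 *
      \<rho>^2 * \<kappa>^2 + 2 * \<rho>^2 * \<kappa> * w + 4 * \<rho> * \<kappa>^2 * u - 2 *
      \<rho> * \<kappa>^2 + 4 * \<rho> * \<kappa> * u * w - 4 * \<rho> * \<kappa> * w - 2 *
      \<rho> * w^2 + 2 * \<kappa>^2 * u^2 - 2 * \<kappa>^2 * u - 4 * \<kappa> * u * w) * x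
    + (2 * A0 * \<kappa> + A1 * B1 - A1 * B2 + A1 * \<kappa>^2 + 2 * A1 * \<kappa> * w - 2 * A1
      * \<kappa> - 2 * A1 * w + 2 * A2 * B0 - 2 * A2 * B1 + 2 * A2 * B2 - 2 * A2 * \<kappa>^2 -
      4 * A2 * \<kappa> * w + 2 * A2 * \<kappa> - 2 * A2 * w^2 + 2 * A2 * w - 2 * B0 * \<rho>^2
      + 2 * B1 * \<rho>^2 + 2 * B1 * \<rho> * u - 2 * B2 * \<rho>^2 - 2 * B2 * \<rho> * u + 2 *
      \<rho>^2 * \<kappa>^2 + 4 * \<rho>^2 * \<kappa> * w - 2 * \<rho>^2 * \<kappa> + 2 *
      \<rho>^2 * w^2 - 2 * \<rho>^2 * w + 2 * \<rho> * \<kappa>^2 * u + 4 * \<rho> * \<kappa> *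
      u * w - 4 * \<rho> * \<kappa> * u - 4 * \<rho> * u * w - 2 * \<kappa> * u^2) * y
    + (A0 * B1 - A0 * B2 + A0 * \<kappa>^2 + 2 * A0 * \<kappa> * w + A1 * B0 - A1 * B1 + A1 * B2
      - A1 * \<kappa>^2 - 2 * A1 * \<kappa> * w - A1 * w^2 - A2 * B0 + A2 * B1 - A2 * B2 + A2 *
      \<kappa>^2 + 2 * A2 * \<kappa> * w + A2 * w^2 + B0 * \<rho>^2 + 2 * B0 * \<rho> * u - B1 *
      \<rho>^2 - 2 * B1 * \<rho> * u - B1 * u^2 + B2 * \<rho>^2 + 2 * B2 * \<rho> * u + B2 * u^2
      - \<rho>^2 * \<kappa>^2 - 2 * \<rho>^2 * \<kappa> * w - \<rho>^2 * w^2 - 2 * \<rho> *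
      \<kappa>^2 * u - 4 * \<rho> * \<kappa> * u * w - 2 * \<rho> * u * w^2 - \<kappa>^2 * u^2 -
      2 * \<kappa> * u^2 * w) = 0"
  using assms[unfolded star_eq_def, rule_format, of y x] unfolding poly_pCons poly_0 by algebra

text \<open>The coefficients of x^3 and y^3 give \<rho> = 1 or B2 = \<kappa>^2, and \<kappa> = 1 or
  A2 = \<rho>^2. If \<rho> is not 1, the coefficient of x^2 y reduces to \<kappa> (2 \<rho> - 1) =
  0, hence r = 1; likewise for s. For r = s = 2 both A2 and B2 vanish, and adding the coefficients
  of x^2 and y^2 yields u + w = -1. In the other two claims u = w = -1/2 stands for \<nu>1 = \<nu>2
  = 0.\<close>

lemma star_cartan:
  fixes c1 c2 :: "complex poly" and r s :: nat and u w :: complex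
  assumes rs: "r > 0" "s > 0"
    and star: "star_eq c1 c2 (of_nat r / 2) (of_nat s / 2) u w"
  shows "r * s \<le> 2 \<or> r = 2 \<and> s = 2 \<and> u + w = -1"
    and "r = 1 \<Longrightarrow> s = 1 \<Longrightarrow> u = -1/2 \<Longrightarrow> w = -1/2 \<Longrightarrow>
      \<exists>b. c1 = [:((1 + 2 * b) / 2)\<^sup>2, - (1 + 2 * b) / 2, 1/4:] \<and> c2 =
        [:((1 + 2 * b) / 2)\<^sup>2, (1 + 2 * b) / 2, 1/4:]"
    and "r = 1 \<Longrightarrow> s = 2 \<Longrightarrow> u = -1/2 \<Longrightarrow> w = -1/2 \<Longrightarrow> c1 = [:1/16:] \<and> c2 = [:0, 0, 1:]"
proof -
  define \<rho> \<kappa> :: complex where rk: "\<rho> = of_nat r / 2" "\<kappa> = of_nat s / 2"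
  have nz: "\<rho> \<noteq> 0" "\<kappa> \<noteq> 0"
    using rs by (simp_all add: rk)
  note star' = star[folded rk]
  obtain A0 A1 A2 B0 B1 B2 where c: "c1 = [:A0, A1, A2:]" "c2 = [:B0, B1, B2:]"
    using star_quadratic[OF nz star'] by metis
  note k = cubic_zero[OF star_coefficients[OF star'[unfolded c]]]
  have k30: "(\<rho> - 1) * (B2 - \<kappa>\<^sup>2) = 0"
    using k(1) by algebra
  have k03: "(\<kappa> - 1) * (A2 - \<rho>\<^sup>2) = 0"
    using k(4) by algebra
  have k21: "(A2 - \<rho>\<^sup>2) * (B2 - \<kappa>\<^sup>2) + 2 * \<rho> * (B2 - \<kappa>\<^sup>2) + \<kappa> * (2 * \<rho> - 1) = 0"
    using k(2) by algebra
  have k12: "(A2 - \<rho>\<^sup>2) * (B2 - \<kappa>\<^sup>2) + 2 * \<kappa> * (A2 - \<rho>\<^sup>2) + \<rho> * (2 * \<kappa> - 1) = 0"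
    using k(3) by algebra
  have two: "complex_of_nat n = 2 \<longleftrightarrow> n = 2" for n
    by (metis of_nat_eq_iff of_nat_numeral)
  have r: "r = 2 \<or> r = 1 \<and> B2 = \<kappa>\<^sup>2"
  proof (cases "\<rho> = 1")
    case False
    then have B2: "B2 - \<kappa>\<^sup>2 = 0"
      using k30 by simp
    then have "2 * \<rho> = 1"
      using k21 nz by simp
    then show ?thesis
      using B2 by (simp add: rk)
  qed (simp add: rk two)
  have s: "s = 2 \<or> s = 1 \<and> A2 = \<rho>\<^sup>2"
  proof (cases "\<kappa> = 1")
    case False
    then have A2: "A2 - \<rho>\<^sup>2 = 0"
      using k03 by simp
    then have "2 * \<kappa> = 1"
      using k12 nz by simp
    then show ?thesis
      using A2 by (simp add: rk)
  qed (simp add: rk two)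
  have "u + w = -1" if "r = 2" "s = 2"
  proof -
    have rk1: "\<rho> = 1" "\<kappa> = 1"
      using that by (simp_all add: rk)
    then have "(A2 - 1) * (B2 - 1) + 2 * (B2 - 1) + 1 =
      0" "(A2 - 1) * (B2 - 1) + 2 * (A2 - 1) + 1 = 0"
      using k21 k12 by simp_all
    then have AB: "A2 = B2" "A2 * A2 = 0"
      by algebra+
    then have AB0: "A2 = 0" "B2 = 0"
      by simp_all
    have "B1 - A1 + 2 + 2 * u + 2 * w = 0" "A1 - B1 + 2 + 2 * u + 2 * w = 0"
      using k(5,7) unfolding rk1 AB0 by (simp_all add: algebra_simps)
    then show ?thesis
      by algebra
  qed
  then show "r * s \<le> 2 \<or> r = 2 \<and> s = 2 \<and> u + w = -1"
    using r s by auto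
  show "\<exists>b. c1 = [:((1 + 2 * b) / 2)\<^sup>2, - (1 + 2 * b) / 2, 1/4:] \<and> c2 =
    [:((1 + 2 * b) / 2)\<^sup>2, (1 + 2 * b) / 2, 1/4:]"
    if *: "r = 1" "s = 1" "u = -1/2" "w = -1/2"
  proof -
    have rk1: "\<rho> = 1/2" "\<kappa> = 1/2"
      using * by (simp_all add: rk)
    have AB2: "A2 = 1/4" "B2 = 1/4"
      using r s * by (auto simp: rk power2_eq_square)
    have "B1 = - A1"
      using k(6) unfolding rk1 AB2 * by (simp add: field_simps power2_eq_square add_eq_0_iff)
    moreover from this have "B0 = A1\<^sup>2" "A0 = A1\<^sup>2"
      using k(8,9) unfolding rk1 AB2 * by (simp_all add: field_simps power2_eq_square)
    \<comment> \<open>The linear coefficient -(1 + 2 b) / 2 of c1 has to be A1, which determines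
      b.\<close>
    ultimately show ?thesis
      unfolding c AB2 by (intro exI[of _ "- A1 - 1/2"]) (simp add: power2_eq_square)
  qed
  show "c1 = [:1/16:] \<and> c2 = [:0, 0, 1:]" if *: "r = 1" "s = 2" "u = -1/2" "w = -1/2"
  proof -
    have rk1: "\<rho> = 1/2" "\<kappa> = 1"
      using * by (simp_all add: rk)
    have B2: "B2 = 1"
      using r * by (auto simp: rk)
    have A2: "A2 = 0"
      using k12 unfolding rk1 B2 by (simp add: field_simps power2_eq_square)
    have "A1 = 0" "B1 = 0" "A0 = 1/16" "B0 = 0"
      using k(5-9) unfolding rk1 A2 B2 * 
      by (simp_all add: field_simps power2_eq_square)
    then show ?thesis
      unfolding c A2 B2 by simp
  qed
qed

section \<open>Classification of the polynomials defining a module\<close>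

text \<open>The simple coroots act by \<open>2 H\<^sub>1 - r H\<^sub>2 + \<nu>\<^sub>1\<close> and \<open>2 H\<^sub>2 - s H\<^sub>1 + \<nu>\<^sub>2\<close>.  The constants
  are needed
  only for a singular Cartan matrix, where a central element is specialized to a number.\<close>

definition weyl_rels ::
  "nat \<Rightarrow> nat \<Rightarrow> complex \<Rightarrow> complex \<Rightarrow> (nat \<Rightarrow> poly2) \<Rightarrow> (nat \<Rightarrow> poly2) \<Rightarrow> bool" where
  "weyl_rels r s \<nu>1 \<nu>2 E F \<longleftrightarrow> (\<forall>x y.
     ev2 (E 1) x y * ev2 (F 1) (x - 1) y - ev2 (F 1) x y * ev2 (E 1) (x + 1) y =
       2 * x - of_nat r * y + \<nu>1 \<and>
     ev2 (E 2) x y * ev2 (F 2) x (y - 1) - ev2 (F 2) x y * ev2 (E 2) x (y + 1) =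
       2 * y - of_nat s * x + \<nu>2 \<and>
     ev2 (E 1) x y * ev2 (F 2) (x - 1) y = ev2 (F 2) x y * ev2 (E 1) x (y + 1) \<and>
     ev2 (E 2) x y * ev2 (F 1) x (y - 1) = ev2 (F 1) x y * ev2 (E 2) (x + 1) y)"

lemma period_1_const_left:
  assumes "\<And>x y. ev2 D x y = ev2 D (x - 1) y" shows "ev2 D x y = ev2 D 0 y"
proof -
  have "poly D [:y:] = [:poly (poly D [:y:]) 0:]"
    using assms by (intro periodic_poly_const) (simp add: ev2_def)
  then show ?thesis
    unfolding ev2_def by (metis mult_zero_right poly_0 poly_pCons add.right_neutral)
qed

lemma poly_at_fst_zero: "poly (map_poly (\<lambda>q. poly q 0) D) y = ev2 D 0 y"
  unfolding ev2_def by (induction D) (simp_all add: map_poly_pCons)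

lemma period_1_const_right:
  assumes "\<And>x y. ev2 D x y = ev2 D x (y - 1)" shows "ev2 D x y = ev2 D x 0"
proof -
  define d where "d = map_poly (\<lambda>q. poly q x) D"
  have d: "poly d y = ev2 D x y" for y
    unfolding d_def ev2_def by (induction D) (simp_all add: map_poly_pCons)
  have "d = [:poly d 0:]"
    using assms by (intro periodic_poly_const) (simp add: d)
  then have "poly d y = poly d 0"
    by (metis mult_zero_right poly_0 poly_pCons add.right_neutral)
  then show ?thesis
    by (simp add: d)
qed

lemma ev2_Hvar_Suc [simp]:
  "ev2 (Hvar (Suc (Suc 0))) x y = y" "ev2 (Hvar (Suc (Suc (Suc 0)))) x y = 0"
  by (simp_all add: ev2_def Hvar_def)

lemma shift2_cancel [simp]:
  "shift2 1 1 (shift2 1 (-1) p) = p" "shift2 2 1 (shift2 2 (-1) p) = p"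
  by (rule poly2_eqI, simp)+

lemma shift2_eq_0_iff: "shift2 1 (-1) p = 0 \<longleftrightarrow> p = 0" "shift2 2 (-1) p = 0 \<longleftrightarrow> p = 0"
proof -
  have "shift2 i c 0 = 0" for i c
    by (simp add: shift2_def)
  then show "shift2 1 (-1) p = 0 \<longleftrightarrow> p = 0" "shift2 2 (-1) p = 0 \<longleftrightarrow> p = 0"
    by (metis shift2_cancel)+
qed

text \<open>For z = x - r y / 2 + (\<nu>1 - 1) / 2 the right-hand side of the first relation is (z +
  1)^2 - z^2. Hence G1 + z^2 is invariant under translation of x and is a polynomial in y alone;
  similarly for G2.\<close>

lemma weyl_rels_star:
  assumes "weyl_rels r s \<nu>1 \<nu>2 E F"
  obtains c1 c2 where
    "\<And>x y. ev2 (E 1) x y * ev2 (F 1) (x - 1) y = poly c1 y - (x - of_nat r / 2 * y + (\<nu>1 - 1) /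
      2)\<^sup>2"
    "\<And>x y. ev2 (E 2) x y * ev2 (F 2) x (y - 1) = poly c2 x - (y - of_nat s / 2 * x + (\<nu>2 - 1) /
      2)\<^sup>2"
    "star_eq c1 c2 (of_nat r / 2) (of_nat s / 2) ((\<nu>1 - 1) / 2) ((\<nu>2 - 1) / 2)"
proof -
  have rels: "ev2 (E 1) x y * ev2 (F 1) (x - 1) y - ev2 (F 1) x y * ev2 (E 1) (x + 1) y =
    2 * x - of_nat r * y + \<nu>1"
    "ev2 (E 2) x y * ev2 (F 2) x (y - 1) - ev2 (F 2) x y * ev2 (E 2) x (y + 1) =
      2 * y - of_nat s * x + \<nu>2"
    "ev2 (E 1) x y * ev2 (F 2) (x - 1) y = ev2 (F 2) x y * ev2 (E 1) x (y + 1)"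
    "ev2 (E 2) x y * ev2 (F 1) x (y - 1) = ev2 (F 1) x y * ev2 (E 2) (x + 1) y" for x y
    using assms unfolding weyl_rels_def by blast+
  define R S :: complex where RS: "R = of_nat r / 2" "S = of_nat s / 2"
  define G1 G2 where "G1 = E 1 * shift2 1 (-1) (F 1)" and "G2 = E 2 * shift2 2 (-1) (F 2)"
  have G: "ev2 G1 x y = ev2 (E 1) x y * ev2 (F 1) (x - 1) y" "ev2 G2 x y =
    ev2 (E 2) x y * ev2 (F 2) x (y - 1)" for x y
    by (simp_all add: G1_def G2_def)
  define D1 where "D1 = G1 + (Hvar 1 - const2 R * Hvar 2 + const2 ((\<nu>1 - 1) / 2))\<^sup>2"
  define D2 where "D2 = G2 + (Hvar 2 - const2 S * Hvar 1 + const2 ((\<nu>2 - 1) / 2))\<^sup>2"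
  have D1: "ev2 D1 x y = ev2 G1 x y + (x - R * y + (\<nu>1 - 1) / 2)\<^sup>2"
    and D2: "ev2 D2 x y = ev2 G2 x y + (y - S * x + (\<nu>2 - 1) / 2)\<^sup>2" for x y
    by (simp_all add: D1_def D2_def)
  have nu: "of_nat r = 2 * R" "of_nat s = 2 * S" "\<nu>1 = 2 * ((\<nu>1 - 1) / 2) + 1" "\<nu>2 =
    2 * ((\<nu>2 - 1) / 2) + 1"
    by (simp_all add: RS field_simps)
  have "ev2 D1 x y = ev2 D1 (x - 1) y" for x y
  proof -
    have "ev2 G1 (x - 1) y - ev2 G1 x y = 2 * (x - 1) - 2 * R * y + (2 * ((\<nu>1 - 1) / 2) + 1)"
      using rels(1)[of "x - 1" y] unfolding nu(3)[symmetric] by (simp add: G nu(1) mult.commute)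
    then show ?thesis
      unfolding D1 by algebra
  qed
  from period_1_const_left[OF this] have 1: "ev2 D1 x y = ev2 D1 0 y" for x y .
  have "ev2 D2 x y = ev2 D2 x (y - 1)" for x y
  proof -
    have "ev2 G2 x (y - 1) - ev2 G2 x y = 2 * (y - 1) - 2 * S * x + (2 * ((\<nu>2 - 1) / 2) + 1)"
      using rels(2)[of x "y - 1"] unfolding nu(4)[symmetric] by (simp add: G nu(2) mult.commute)
    then show ?thesis
      unfolding D2 by algebra
  qed
  from period_1_const_right[OF this] have 2: "ev2 D2 x y = ev2 D2 x 0" for x y .
  define c1 where "c1 = map_poly (\<lambda>q. poly q 0) D1"
  define c2 where "c2 = poly D2 0"
  have c1: "poly c1 y = ev2 D1 0 y" for y
    by (simp add: c1_def poly_at_fst_zero)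
  have c2: "poly c2 x = ev2 D2 x 0" for x
    by (simp add: c2_def ev2_def)
  have g1: "ev2 G1 x y = poly c1 y - (x - R * y + (\<nu>1 - 1) / 2)\<^sup>2" for x y
    using 1[of x y] by (simp add: c1 D1 algebra_simps)
  have g2: "ev2 G2 x y = poly c2 x - (y - S * x + (\<nu>2 - 1) / 2)\<^sup>2" for x y
    using 2[of x y] by (simp add: c2 D2 algebra_simps)
  \<comment> \<open>The vanishing brackets relate E and F with different indices. Multiplied by
    suitable translates of E they express the change of G2 and of G1 through \<open>U\<close> and
    \<open>W\<close>, which cancel in the product of the two equations.\<close>
  define U W where "U = E 1 * shift2 1 (-1) (E 2)" and "W = E 2 * shift2 2 (-1) (E 1)"
  have UW: "ev2 U x y = ev2 (E 1) x y * ev2 (E 2) (x - 1) y" "ev2 W x y =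
    ev2 (E 2) x y * ev2 (E 1) x (y - 1)" for x y
    by (simp_all add: U_def W_def)
  have "U * G2 = W * shift2 1 (-1) G2"
  proof (rule poly2_eqI)
    fix x y
    show "ev2 (U * G2) x y = ev2 (W * shift2 1 (-1) G2) x y"
      using rels(3)[of x "y - 1"] by (simp add: UW G)
  qed
  moreover have "W * G1 = U * shift2 2 (-1) G1"
  proof (rule poly2_eqI)
    fix x y
    show "ev2 (W * G1) x y = ev2 (U * shift2 2 (-1) G1) x y"
      using rels(4)[of "x - 1" y] by (simp add: UW G)
  qed
  ultimately have *: "(U * W) * (G1 * G2) = (U * W) * (shift2 2 (-1) G1 * shift2 1 (-1) G2)"
    by algebra
  \<comment> \<open>Otherwise 2 x - r y + \<nu>1 would vanish at (0, 0) and at (1, 0).\<close>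
  have "E 1 \<noteq> 0"
    using rels(1)[of 0 0] rels(1)[of 1 0] by auto
  moreover have "E 2 \<noteq> 0"
    using rels(2)[of 0 0] rels(2)[of 0 1] by auto
  ultimately have "U * W \<noteq> 0"
    by (simp add: U_def W_def shift2_eq_0_iff[simplified])
  then have "G1 * G2 = shift2 2 (-1) G1 * shift2 1 (-1) G2"
    using * by simp
  then have "ev2 (G1 * G2) x y = ev2 (shift2 2 (-1) G1 * shift2 1 (-1) G2) x y" for x y
    by simp
  then have G12: "ev2 G1 x y * ev2 G2 x y = ev2 G1 x (y - 1) * ev2 G2 (x - 1) y" for x y
    by simp
  have "star_eq c1 c2 R S ((\<nu>1 - 1) / 2) ((\<nu>2 - 1) / 2)"
    unfolding star_eq_def
  proof (intro allI)
    fix x y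
    have "x - R * (y - 1) + (\<nu>1 - 1) / 2 = x - R * y + (\<nu>1 - 1) / 2 + R"
      "y - S * (x - 1) + (\<nu>2 - 1) / 2 = y - S * x + (\<nu>2 - 1) / 2 + S"
      by (simp_all add: algebra_simps)
    then show "(poly c1 y - (x - R * y + (\<nu>1 - 1) / 2)\<^sup>2) * (poly c2 x - (y - S * x + (\<nu>2 - 1) /
      2)\<^sup>2) =
      (poly c1 (y - 1) - (x - R * y + (\<nu>1 - 1) / 2 + R)\<^sup>2) * (poly c2 (x - 1) - (y - S * x + (\<nu>2 -
        1) / 2 + S)\<^sup>2)"
      using G12[of x y] unfolding g1 g2 by (simp only:)
  qed
  then show thesis
    using that[of c1 c2] g1 g2 unfolding G RS by blast
qed

lemma weyl_rels_cartan:
  assumes "weyl_rels r s \<nu>1 \<nu>2 E F" "r > 0" "s > 0" "r = 2 \<Longrightarrow> s = 2 \<Longrightarrow> \<nu>1 + \<nu>2 \<noteq> 0"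
  shows "r * s \<le> 2"
proof -
  obtain c1 c2 where star: "star_eq c1 c2 (of_nat r / 2) (of_nat s / 2) ((\<nu>1 - 1) / 2) ((\<nu>2 - 1) /
    2)"
    using weyl_rels_star[OF assms(1)] by metis
  have eq: "\<nu>1 + \<nu>2 = 2 * ((\<nu>1 - 1) / 2 + (\<nu>2 - 1) / 2) + 2"
    by (simp add: field_simps)
  have "\<nu>1 + \<nu>2 = 0" if "(\<nu>1 - 1) / 2 + (\<nu>2 - 1) / 2 = -1"
    using eq unfolding that by simp
  then show ?thesis
    using star_cartan(1)[OF assms(2,3) star] assms(4) by auto
qed

subsection \<open>Factorizations into linear polynomials\<close>

lemma prime_elem_monic_linear: "prime_elem [:- q, 1:]" for q :: "'a::idom"
proof (rule prime_elemI)
  show "\<not> [:- q, 1:] dvd 1"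
    by (metis dvd_1_iff_1 poly_eq_0_iff_dvd poly_1 zero_neq_one)
  show "[:- q, 1:] dvd a \<or> [:- q, 1:] dvd b" if "[:- q, 1:] dvd a * b" for a b
    using that by (simp add: poly_eq_0_iff_dvd[symmetric])
qed simp

definition lin2 :: "complex \<Rightarrow> complex \<Rightarrow> complex \<Rightarrow> poly2" where
  "lin2 a b c = [:[:c, a:], [:b:]:]"

lemma ev2_lin2 [simp]: "ev2 (lin2 a b c) x y = a * x + b * y + c"
  by (simp add: ev2_def lin2_def algebra_simps)

text \<open>If H2 occurs, the polynomial is a unit times a monic linear polynomial in the outer
  variable; otherwise it is a linear polynomial in H1, and primality lifts from the coefficient
  ring.\<close>

lemma prime_elem_lin2:
  assumes "a \<noteq> 0 \<or> b \<noteq> 0" shows "prime_elem (lin2 a b c)"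
proof (cases "b = 0")
  case False
  have "lin2 a b c = [:[:b:]:] * [:- smult (- 1 / b) [:c, a:], 1:]"
    using False by (simp add: lin2_def)
  moreover have "is_unit [:[:b:]:]"
    using False by (simp add: is_unit_const_poly_iff dvd_field_iff)
  ultimately show ?thesis
    using prime_elem_mult_unit_left prime_elem_monic_linear by metis
next
  case True
  then have a: "a \<noteq> 0"
    using assms by simp
  have "[:c, a:] = [:a:] * [:- (- c / a), 1:]"
    using a by simp
  moreover have "is_unit [:a:]"
    using a by (simp add: is_unit_const_poly_iff dvd_field_iff)
  ultimately have "prime_elem [:c, a:]"
    using prime_elem_mult_unit_left prime_elem_monic_linear by metis
  then show ?thesis
    using True lift_prime_elem_poly[of "[:c, a:]"] by (simp add: lin2_def)
qed

lemma mult_eq_prime: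
  fixes P Q A :: "'a::idom"
  assumes A: "prime_elem A" and PQ: "P * Q = u * A"
  obtains P' where "P = P' * A" "P' * Q = u" | Q' where "Q = Q' * A" "P * Q' = u"
proof -
  have "A dvd P * Q"
    by (simp add: PQ)
  then consider "A dvd P" | "A dvd Q"
    using A by (auto simp: prime_elem_dvd_mult_iff)
  then show thesis
  proof cases
    case 1
    then obtain P' where "P = P' * A"
      by (metis dvdE mult.commute)
    moreover from this have "(P' * Q) * A = u * A"
      using PQ by (simp add: ac_simps)
    ultimately show thesis
      using that(1) A by auto
  next
    case 2
    then obtain Q' where "Q = Q' * A"
      by (metis dvdE mult.commute)
    moreover from this have "(P * Q') * A = u * A"
      using PQ by (simp add: ac_simps)
    ultimately show thesis
      using that(2) A by auto
  qed
qed

lemma poly2_units: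
  assumes "(P :: poly2) * Q = 1" obtains a where "a \<noteq> 0" "P = const2 a" "Q = const2 (inverse a)"
proof -
  have "is_unit P" "is_unit Q"
    using assms by (auto simp: dvd_def) (metis mult.commute)
  then obtain a b where "P = [:[:a:]:]" "Q = [:[:b:]:]"
    by (auto simp: is_unit_poly_iff)
  moreover from this have "a * b = 1"
    using assms by (simp add: one_pCons)
  then have "a \<noteq> 0" "b = inverse a"
    by (auto simp: inverse_unique)
  ultimately show thesis
    using that by (simp add: const2_def)
qed

definition factor_splits :: "poly2 \<Rightarrow> poly2 \<Rightarrow> complex \<Rightarrow> (poly2 \<times> poly2) set" where
  "factor_splits A B a = {(const2 a, const2 (inverse a) * A * B), (const2 a * A, const2 (inverse
    a) * B),
     (const2 a * B, const2 (inverse a) * A), (const2 a * A * B, const2 (inverse a))}"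

lemma mult_eq_two_primes:
  fixes P Q A B :: poly2
  assumes "prime_elem A" "prime_elem B" and PQ: "P * Q = A * B"
  obtains a where "a \<noteq> 0"
    "(P, Q) \<in> factor_splits A B a"
proof -
  have 1: "U * V = 1 * X" if "U * V = X" for U V X :: poly2
    using that by simp
  show thesis
  proof (rule mult_eq_prime[OF assms(2) PQ])
    fix P' assume P: "P = P' * B" "P' * Q = A"
    show thesis
      by (rule mult_eq_prime[OF assms(1) 1[OF P(2)]]; elim poly2_units)
        (use P in \<open>auto intro!: that simp: factor_splits_def ac_simps\<close>)
  next
    fix Q' assume Q: "Q = Q' * B" "P * Q' = A"
    show thesis
      by (rule mult_eq_prime[OF assms(1) 1[OF Q(2)]]; elim poly2_units)
        (use Q in \<open>auto intro!: that simp: factor_splits_def ac_simps\<close>)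
  qed
qed

subsection \<open>The two lists of modules\<close>

lemma weyl_rels_A2:
  assumes "weyl_rels 1 1 0 0 E F"
  obtains a b S where "a $ 1 \<noteq> 0" "a $ 2 \<noteq> 0" "S \<subseteq> {1, 2, 3}"
    "\<And>i. i \<in> {1, 2} \<Longrightarrow> E i = E_A2 a b S i \<and> F i = F_A2 a b S i"
proof -
  obtain c1 c2
    where g: "\<And>x y. ev2 (E 1) x y * ev2 (F 1) (x - 1) y =
      poly c1 y - (x - of_nat 1 / 2 * y + (0 - 1) / 2)\<^sup>2"
      "\<And>x y. ev2 (E 2) x y * ev2 (F 2) x (y - 1) =
        poly c2 x - (y - of_nat 1 / 2 * x + (0 - 1) / 2)\<^sup>2"
    and star: "star_eq c1 c2 (of_nat 1 / 2) (of_nat 1 / 2) ((0 - 1) / 2) ((0 - 1) / 2)"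
    using weyl_rels_star[OF assms] by metis
  obtain b where c: "c1 = [:((1 + 2 * b) / 2)\<^sup>2, - (1 + 2 * b) / 2, 1/4:]"
      "c2 = [:((1 + 2 * b) / 2)\<^sup>2, (1 + 2 * b) / 2, 1/4:]"
    using star_cartan(2)[OF _ _ star] by auto
  \<comment> \<open>c1 and c2 are the squares of (1 + 2 b - y) / 2 and (1 + 2 b + x) / 2, so both
    left-hand sides are differences of squares.\<close>
  have quad: "poly c1 y - (x - of_nat 1 / 2 * y + (0 - 1) / 2)\<^sup>2 =
    (x + (- 1 - b)) * (- x + y + - b)"
      "poly c2 x - (y - of_nat 1 / 2 * x + (0 - 1) / 2)\<^sup>2 =
        (- y + - b) * (- x + y + (- b - 1))" for x y
    by (simp_all add: c power2_eq_square field_simps)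
  define P1 P2 where "P1 = shift2 1 (-1) (F 1)" and "P2 = shift2 2 (-1) (F 2)"
  then have F: "F 1 = shift2 1 1 P1" "F 2 = shift2 2 1 P2"
    by (simp_all only: shift2_cancel)
  have "E 1 * P1 = lin2 1 0 (- 1 - b) * lin2 (-1) 1 (- b)"
  proof (rule poly2_eqI)
    fix x y
    show "ev2 (E 1 * P1) x y = ev2 (lin2 1 0 (- 1 - b) * lin2 (-1) 1 (- b)) x y"
      using g(1)[of x y] quad(1)[of y x] by (simp add: P1_def)
  qed
  then obtain a1 where a1: "a1 \<noteq> 0" and 1: "(E 1, P1) \<in> factor_splits (lin2 1 0 (- 1 - b)) (lin2
    (-1) 1 (- b)) a1"
    by (rule mult_eq_two_primes[rotated 2]) (auto intro: prime_elem_lin2)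
  have "E 2 * P2 = lin2 0 (-1) (- b) * lin2 (-1) 1 (- b - 1)"
  proof (rule poly2_eqI)
    fix x y
    show "ev2 (E 2 * P2) x y = ev2 (lin2 0 (-1) (- b) * lin2 (-1) 1 (- b - 1)) x y"
      using g(2)[of x y] quad(2)[of x y] by (simp add: P2_def)
  qed
  then obtain a2 where a2: "a2 \<noteq> 0" and 2: "(E 2, P2) \<in> factor_splits (lin2 0 (-1) (- b)) (lin2
    (-1) 1 (- b - 1)) a2"
    by (rule mult_eq_two_primes[rotated 2]) (auto intro: prime_elem_lin2)
  text \<open>At this point the two factors that do not enter the condition have the values 1 and -1.\<close>
  have "ev2 (E 1) (b + 2) (- b) * ev2 (F 2) (b + 1) (- b) =
    ev2 (F 2) (b + 2) (- b) * ev2 (E 1) (b + 2) (1 - b)"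
    using assms[unfolded weyl_rels_def, rule_format, of "b + 2" "- b"] by (simp add: add.commute)
  then have compat: "ev2 (E 1) (b + 2) (- b) * ev2 P2 (b + 1) (1 - b) =
    ev2 P2 (b + 2) (1 - b) * ev2 (E 1) (b + 2) (1 - b)"
    by (simp add: F add.commute)
  let ?a = "vector [a1, a2] :: complex^2"
  have eqs: "E_A2 ?a b S 1 = E 1 \<and> F_A2 ?a b S 1 = F 1 \<and> E_A2 ?a b S 2 = E 2 \<and> F_A2 ?a b S 2 =
    F 2 \<Longrightarrow> S \<subseteq> {1, 2, 3} \<Longrightarrow> thesis"
    for S
    using a1 a2 by (intro that[of ?a S b]) auto
  \<comment> \<open>Of the sixteen combinations \<open>compat\<close> keeps the eight in which - H1
    + H2 - b divides E 1 exactly when - H1 + H2 - b - 1 is assigned to P2. They correspond to the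
    subsets of {1, 2, 3}.\<close>
  show thesis
    using 1 2 compat a1 a2
    apply (simp only: factor_splits_def insert_iff empty_iff prod.inject simp_thms)
    apply (elim disjE conjE; (simp; fail)?)
    supply [simp] = F[simplified] E_A2_def F_A2_def algebra_simps and [intro!] = poly2_eqI
    subgoal by (rule eqs[of "{1}"]) auto
    subgoal by (rule eqs[of "{1, 3}"]) auto
    subgoal by (rule eqs[of "{1, 2}"]) auto
    subgoal by (rule eqs[of "{2}"]) auto
    subgoal by (rule eqs[of "{}"]) auto
    subgoal by (rule eqs[of "{3}"]) auto
    subgoal by (rule eqs[of "{1, 2, 3}"]) auto
    subgoal by (rule eqs[of "{2, 3}"]) auto
    done
qed

lemma weyl_rels_B2:
  assumes "weyl_rels 1 2 0 0 E F"
  obtains a S where "a $ 1 \<noteq> 0" "a $ 2 \<noteq> 0" "S \<subseteq> {1, 2}"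
    "\<And>i. i \<in> {1, 2} \<Longrightarrow> E i = E_B2 a S i \<and> F i = F_B2 a S i"
proof -
  obtain c1 c2
    where g: "\<And>x y. ev2 (E 1) x y * ev2 (F 1) (x - 1) y =
      poly c1 y - (x - of_nat 1 / 2 * y + (0 - 1) / 2)\<^sup>2"
      "\<And>x y. ev2 (E 2) x y * ev2 (F 2) x (y - 1) =
        poly c2 x - (y - of_nat 2 / 2 * x + (0 - 1) / 2)\<^sup>2"
    and star: "star_eq c1 c2 (of_nat 1 / 2) (of_nat 2 / 2) ((0 - 1) / 2) ((0 - 1) / 2)"
    using weyl_rels_star[OF assms] by metis
  have c: "c1 = [:1/16:]" "c2 = [:0, 0, 1:]"
    using star_cartan(3)[OF _ _ star] by auto
  have quad: "poly c1 y - (x - of_nat 1 / 2 * y + (0 - 1) / 2)\<^sup>2 =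
    (- x + y / 2 + 1/4) * (x + - (y / 2) + - (3/4))"
      "poly c2 x - (y - of_nat 2 / 2 * x + (0 - 1) / 2)\<^sup>2 =
        (- (2 * x) + y + - (1/2)) * (- y + 1/2)" for x y
    by (simp_all add: c power2_eq_square field_simps)
  define P1 P2 where "P1 = shift2 1 (-1) (F 1)" and "P2 = shift2 2 (-1) (F 2)"
  then have F: "F 1 = shift2 1 1 P1" "F 2 = shift2 2 1 P2"
    by (simp_all only: shift2_cancel)
  have "E 1 * P1 = lin2 (-1) (1/2) (1/4) * lin2 1 (-1/2) (-3/4)"
  proof (rule poly2_eqI)
    fix x y
    show "ev2 (E 1 * P1) x y = ev2 (lin2 (-1) (1/2) (1/4) * lin2 1 (-1/2) (-3/4)) x y"
      using g(1)[of x y] quad(1)[of y x] by (simp add: P1_def)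
  qed
  then obtain a1 where a1: "a1 \<noteq> 0" and 1: "(E 1, P1) \<in> factor_splits (lin2 (-1) (1/2) (1/4))
    (lin2 1 (-1/2) (-3/4)) a1"
    by (rule mult_eq_two_primes[rotated 2]) (auto intro: prime_elem_lin2)
  have "E 2 * P2 = lin2 (-2) 1 (-1/2) * lin2 0 (-1) (1/2)"
  proof (rule poly2_eqI)
    fix x y
    show "ev2 (E 2 * P2) x y = ev2 (lin2 (-2) 1 (-1/2) * lin2 0 (-1) (1/2)) x y"
      using g(2)[of x y] quad(2)[of x y] by (simp add: P2_def)
  qed
  then obtain a2 where a2: "a2 \<noteq> 0" and 2: "(E 2, P2) \<in> factor_splits (lin2 (-2) 1 (-1/2)) (lin2 0
    (-1) (1/2)) a2"
    by (rule mult_eq_two_primes[rotated 2]) (auto intro: prime_elem_lin2)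
  text \<open>At this point no factor vanishes, before or after a shift.\<close>
  have "ev2 (E 1) 4 (3/2) * ev2 (F 2) 3 (3/2) = ev2 (F 2) 4 (3/2) * ev2 (E 1) 4 (5/2)"
    using assms[unfolded weyl_rels_def, rule_format, of 4 "3/2"] by simp
  then have compat: "ev2 (E 1) 4 (3/2) * ev2 P2 3 (5/2) = ev2 P2 4 (5/2) * ev2 (E 1) 4 (5/2)"
    by (simp add: F)
  have eqs: "E_B2 a S 1 = E 1 \<and> F_B2 a S 1 = F 1 \<and> E_B2 a S 2 = E 2 \<and> F_B2 a S 2 = F 2 \<Longrightarrow>
      a $ 1 \<noteq> 0 \<Longrightarrow> a $ 2 \<noteq> 0 \<Longrightarrow> S \<subseteq> {1, 2} \<Longrightarrow> thesis" for a S
    by (intro that[of a S]) auto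
  \<comment> \<open>The quotient of the two values of E 1 in \<open>compat\<close> is 1, 6/5, 5/4 or
    3/2 for the four splittings, that of P2 is 1 or 3/2. So the two factors of the first product
    stay together, and four of the sixteen combinations remain.\<close>
  show thesis
    using 1 2 compat a1 a2
    apply (simp only: factor_splits_def insert_iff empty_iff prod.inject simp_thms)
    apply (elim disjE conjE; (simp; fail)?)
    supply [simp] = F[simplified] E_B2_def F_B2_def field_simps and [intro!] = poly2_eqI
    subgoal by (rule eqs[of "vector [a1, a2]" "{1, 2}"]) auto
    subgoal by (rule eqs[of "vector [a1, a2]" "{1}"]) auto
    subgoal by (rule eqs[of "vector [a1, a2]" "{2}"]) auto
    \<comment> \<open>The listed E 2 has the factor H2 - 1/2, the negative of the prime factor used
      here; hence the sign.\<close>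
    subgoal by (rule eqs[of "vector [a1, - a2]" "{}"]) auto
    done
qed

section \<open>The enveloping algebra of an abelian Lie algebra\<close>

primrec env_ev :: "('x \<Rightarrow> poly2) \<Rightarrow> 'x env_term \<Rightarrow> poly2" where
  "env_ev L (UGen x) = L x"
| "env_ev L UZero = 0"
| "env_ev L UOne = 1"
| "env_ev L (UAdd s t) = env_ev L s + env_ev L t"
| "env_ev L (UScale c t) = const2 c * env_ev L t"
| "env_ev L (UMult s t) = env_ev L s * env_ev L t"

lemma const2_simps:
  "const2 0 = 0" "const2 1 = 1" "const2 (a + b) = const2 a + const2 b" "const2 (a * b) =
    const2 a * const2 b"
  "const2 (- a) = - const2 a"
  by (simp_all add: const2_def one_pCons)

lemma env_ev_sound:
  assumes "\<And>x y. L (x + y) = L x + L y" "\<And>c x. L (sc c x) = const2 c * L x"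
    and "env_eq sc (\<lambda>_ _. 0) s t"
  shows "env_ev L s = env_ev L t"
  using assms(3)
proof (induction rule: env_eq.induct)
  case (gen_br x y)
  have "L 0 = 0"
    using assms(1)[of 0 0] by simp
  then show ?case by (simp add: const2_simps)
qed (simp_all add: assms(1,2) const2_simps algebra_simps)

text \<open>A criterion for terms such as products with \<open>UZero\<close> and the generator 0,
  for which t + t = t is immediate.\<close>

lemma env_cancel:
  assumes "env_eq sc br (UAdd t t) t" shows "env_eq sc br t UZero"
proof -
  let ?n = "UScale (-1) t"
  have "env_eq sc br (UAdd (UAdd t t) ?n) (UAdd t ?n)"
    using assms by (blast intro: env_eq.cong_add env_eq.refl)
  then have "env_eq sc br (UAdd t (UAdd t ?n)) UZero"
    by (meson env_eq.add_assoc env_eq.add_neg env_eq.sym env_eq.trans)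
  moreover have "env_eq sc br (UAdd t (UAdd t ?n)) (UAdd t UZero)"
    by (blast intro: env_eq.cong_add env_eq.refl env_eq.add_neg)
  moreover have "env_eq sc br (UAdd t UZero) t"
    by (meson env_eq.add_comm env_eq.add_zero env_eq.trans)
  ultimately show ?thesis
    by (meson env_eq.sym env_eq.trans)
qed

lemma env_eq_diff:
  assumes "env_eq sc br (UAdd s (UScale (-1) t)) UZero" shows "env_eq sc br s t"
proof -
  have "env_eq sc br s (UAdd s (UAdd (UScale (-1) t) t))"
    by (meson env_eq.add_comm env_eq.add_neg env_eq.add_zero env_eq.cong_add env_eq.refl
      env_eq.sym env_eq.trans)
  moreover have "env_eq sc br (UAdd (UAdd s (UScale (-1) t)) t) (UAdd UZero t)"
    using assms by (blast intro: env_eq.cong_add env_eq.refl)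
  ultimately show ?thesis
    by (meson env_eq.add_assoc env_eq.add_zero env_eq.sym env_eq.trans)
qed

lemma env_mult_zero_right: "env_eq sc br (UMult t UZero) UZero"
  by (rule env_cancel) (meson env_eq.add_zero env_eq.cong_mult env_eq.mult_add_right env_eq.refl
    env_eq.sym env_eq.trans)

lemma env_mult_zero_left: "env_eq sc br (UMult UZero t) UZero"
  by (rule env_cancel) (meson env_eq.add_zero env_eq.cong_mult env_eq.mult_add_left env_eq.refl
    env_eq.sym env_eq.trans)

lemma env_gen_zero: "env_eq sc br (UGen 0) UZero"
  using env_eq.gen_add[of sc br 0 0] by (intro env_cancel) (auto intro: env_eq.sym)

definition env_commute where
  "env_commute sc br s t \<longleftrightarrow> env_eq sc br (UMult s t) (UMult t s)"

lemma env_commute_sym: "env_commute sc br s t \<Longrightarrow> env_commute sc br t s"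
  unfolding env_commute_def by (rule env_eq.sym)

lemma env_commute_closed:
  assumes "\<And>x. env_commute sc br s (UGen x)" shows "env_commute sc br s t"
proof (induction t)
  case (UGen x)
  then show ?case by (rule assms)
next
  case UZero
  then show ?case unfolding env_commute_def
    by (meson env_mult_zero_left env_mult_zero_right env_eq.sym env_eq.trans)
next
  case UOne
  then show ?case unfolding env_commute_def
    by (meson env_eq.mult_one_left env_eq.mult_one_right env_eq.sym env_eq.trans)
next
  case (UAdd t u)
  then show ?case unfolding env_commute_def
    by (meson env_eq.mult_add_left env_eq.mult_add_right env_eq.cong_add env_eq.sym env_eq.trans)
next
  case (UScale c t)
  then show ?case unfolding env_commute_def
    by (meson env_eq.mult_scale_left env_eq.mult_scale_right env_eq.cong_scale env_eq.sym
      env_eq.trans)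
next
  case (UMult t u)
  let ?E = "env_eq sc br"
  have "?E (UMult s (UMult t u)) (UMult (UMult s t) u)"
    by (rule env_eq.sym[OF env_eq.mult_assoc])
  moreover have "?E (UMult (UMult s t) u) (UMult (UMult t s) u)"
    using UMult unfolding env_commute_def by (blast intro: env_eq.cong_mult env_eq.refl)
  moreover have "?E (UMult (UMult t s) u) (UMult t (UMult s u))"
    by (rule env_eq.mult_assoc)
  moreover have "?E (UMult t (UMult s u)) (UMult t (UMult u s))"
    using UMult unfolding env_commute_def by (blast intro: env_eq.cong_mult env_eq.refl)
  moreover have "?E (UMult t (UMult u s)) (UMult (UMult t u) s)"
    by (rule env_eq.sym[OF env_eq.mult_assoc])
  ultimately show ?case unfolding env_commute_def
    by (meson env_eq.trans)
qed

text \<open>Generators commute because their bracket is the generator 0.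
  \<open>env_commute_closed\<close> extends this to arbitrary terms, once in each argument.\<close>

lemma env_mult_comm: "env_eq sc (\<lambda>_ _. 0) (UMult s t) (UMult t s)"
proof -
  have "env_commute sc (\<lambda>_ _. 0) (UGen x) (UGen y)" for x y
    unfolding env_commute_def
    using env_eq.trans[OF env_eq.gen_br[of sc "\<lambda>_ _. 0" x y] env_gen_zero] by (rule env_eq_diff)
  then have "env_commute sc (\<lambda>_ _. 0) (UGen x) t" for x t
    by (rule env_commute_closed)
  then have "env_commute sc (\<lambda>_ _. 0) t (UGen x)" for x t
    by (rule env_commute_sym)
  then have "env_commute sc (\<lambda>_ _. 0) s t"
    by (rule env_commute_closed)
  then show ?thesis
    by (simp add: env_commute_def)
qed

text \<open>Quantifying over the scalar multiplication makes the relation, and hence the quotient,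
  independent of it; the result is a commutative ring in which the relations \<open>env_eq\<close> can be
  expressed by an ideal.\<close>

quotient_type (overloaded) 'x comm_env = "'x::ab_group_add env_term" / "\<lambda>s t. \<forall>sc. env_eq sc (\<lambda>_
  _. 0) s t"
  by (rule equivpI) (auto intro!: reflpI sympI transpI intro: env_eq.refl env_eq.sym env_eq.trans)

instantiation comm_env :: (ab_group_add) comm_ring_1
begin

lift_definition zero_comm_env :: "'a comm_env" is UZero .
lift_definition one_comm_env :: "'a comm_env" is UOne .
lift_definition plus_comm_env :: "'a comm_env \<Rightarrow> 'a comm_env \<Rightarrow> 'a comm_env" is UAdd
  by (blast intro: env_eq.cong_add)
lift_definition times_comm_env :: "'a comm_env \<Rightarrow> 'a comm_env \<Rightarrow> 'a comm_env" is UMult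
  by (blast intro: env_eq.cong_mult)
lift_definition uminus_comm_env :: "'a comm_env \<Rightarrow> 'a comm_env" is "UScale (-1)"
  by (blast intro: env_eq.cong_scale)
definition minus_comm_env :: "'a comm_env \<Rightarrow> 'a comm_env \<Rightarrow> 'a comm_env" where
  "minus_comm_env x y = x + - y"

instance
proof
  fix a b c :: "'a comm_env"
  show "a + b + c = a + (b + c)" by transfer (blast intro: env_eq.add_assoc)
  show "a + b = b + a" by transfer (blast intro: env_eq.add_comm)
  show "0 + a = a" by transfer (blast intro: env_eq.add_zero)
  show "- a + a = 0" by transfer (meson env_eq.add_comm env_eq.add_neg env_eq.trans)
  show "a - b = a + - b" by (rule minus_comm_env_def)
  show "a * b * c = a * (b * c)" by transfer (blast intro: env_eq.mult_assoc)
  show "a * b = b * a" by transfer (blast intro: env_mult_comm)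
  show "1 * a = a" by transfer (blast intro: env_eq.mult_one_left)
  show "(a + b) * c = a * c + b * c" by transfer (blast intro: env_eq.mult_add_left)
  \<comment> \<open>Sending every generator to 0 is compatible with all scalar multiplications and
    keeps 0 and 1 apart.\<close>
  show "(0 :: 'a comm_env) \<noteq> 1"
    by transfer (use env_ev_sound[of "\<lambda>_. 0"] in fastforce)
qed

end

lift_definition cc :: "'x::ab_group_add env_term \<Rightarrow> 'x comm_env" is "\<lambda>t. t" .

lift_definition cemb :: "complex \<Rightarrow> 'x::ab_group_add comm_env" is "\<lambda>c. UScale c UOne" .

text \<open>The ideal of elements that vanish in the enveloping algebra for the scalar
  multiplication \<open>sc\<close>, which enters only here.\<close>

lift_definition env_null :: "(complex \<Rightarrow> 'x \<Rightarrow> 'x) \<Rightarrow> 'x::ab_group_add comm_env \<Rightarrow> bool"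
  is "\<lambda>sc t. env_eq sc (\<lambda>_ _. 0) t UZero"
  by (meson env_eq.sym env_eq.trans)

lemma cc_simps [simp]:
  "cc UZero = 0" "cc UOne = 1" "cc (UAdd s t) = cc s + cc t" "cc (UMult s t) = cc s * cc t"
  by (transfer, blast intro: env_eq.refl)+

lemma cc_scale [simp]: "cc (UScale c t) = cemb c * cc t"
  by transfer (meson env_eq.cong_scale env_eq.mult_one_left env_eq.mult_scale_left env_eq.sym
    env_eq.trans)

lemma cemb_hom:
  "cemb (a + b) = (cemb a + cemb b :: 'a::ab_group_add comm_env)" "cemb (a * b) =
    (cemb a * cemb b :: 'a comm_env)"
  "cemb 0 = (0 :: 'a comm_env)" "cemb 1 = (1 :: 'a comm_env)"
proof -
  show "cemb (a + b) = (cemb a + cemb b :: 'a comm_env)"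
    by transfer (blast intro: env_eq.add_scale)
  have "cemb (0 + 0) = cemb 0 + (cemb 0 :: 'a comm_env)"
    by (transfer, blast intro: env_eq.add_scale)
  then show "cemb 0 = (0 :: 'a comm_env)"
    by simp
  show "cemb 1 = (1 :: 'a comm_env)"
    by transfer (blast intro: env_eq.scale_one)
  show "cemb (a * b) = cemb a * (cemb b :: 'a comm_env)"
    by transfer (meson env_eq.cong_scale env_eq.mult_one_left env_eq.mult_scale_left
      env_eq.scale_scale
        env_eq.sym env_eq.trans)
qed

lemma env_null_cc: "env_null sc (cc t) \<longleftrightarrow> env_eq sc (\<lambda>_ _. 0) t UZero"
  by transfer simp

lemma env_null_diff: "env_null sc (cc s - cc t) \<longleftrightarrow> env_eq sc (\<lambda>_ _. 0) s t"
proof -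
  have "cc s - cc t = cc (UAdd s (UScale (-1) t))"
    unfolding minus_comm_env_def by (simp, transfer)
      (meson env_eq.cong_scale env_eq.mult_one_left env_eq.mult_scale_left env_eq.sym env_eq.trans)
  then have "env_null sc (cc s - cc t) \<longleftrightarrow> env_eq sc (\<lambda>_ _. 0) (UAdd s (UScale (-1) t)) UZero"
    using env_null_cc by metis
  also have "\<dots> \<longleftrightarrow> env_eq sc (\<lambda>_ _. 0) s t"
    using env_eq_diff by (meson env_eq.add_neg env_eq.cong_add env_eq.refl env_eq.trans)
  finally show ?thesis .
qed

lemma env_null_0: "env_null sc 0"
  by transfer (rule env_eq.refl)

lemma env_null_add: "env_null sc x \<Longrightarrow> env_null sc y \<Longrightarrow> env_null sc (x + y)"
  by transfer (meson env_eq.add_zero env_eq.cong_add env_eq.trans)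

lemma env_null_mult: "env_null sc x \<Longrightarrow> env_null sc (y * x)"
  by transfer (meson env_mult_zero_right env_eq.cong_mult env_eq.refl env_eq.trans)

lemma
  fixes f :: "'a::comm_ring_1 \<Rightarrow> 'b::comm_ring_1"
  assumes "\<And>a b. f (a + b) = f a + f b" "\<And>a b. f (a * b) = f a * f b"
  shows poly_map_poly_add: "poly (map_poly f (p + q)) x =
    poly (map_poly f p) x + poly (map_poly f q) x"
    and poly_map_poly_mult: "poly (map_poly f (p * q)) x =
      poly (map_poly f p) x * poly (map_poly f q) x"
proof -
  have f0: "f 0 = 0"
    using assms(1)[of 0 0] by simp
  show add: "poly (map_poly f (p + q)) x = poly (map_poly f p) x + poly (map_poly f q) x" for p q
  proof -
    have "map_poly f (p + q) = map_poly f p + map_poly f q"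
      by (rule poly_eqI) (simp add: coeff_map_poly f0 assms)
    then show ?thesis
      by simp
  qed
  show "poly (map_poly f (p * q)) x = poly (map_poly f p) x * poly (map_poly f q) x"
    by (induction p) (simp_all add: f0 assms add map_poly_pCons map_poly_smult algebra_simps)
qed

text \<open>Substitution of h1 and h2 for the variables, the inverse of \<open>env_ev\<close> modulo
  \<open>env_null\<close> when they form a basis.\<close>

definition env_of_poly2 :: "'x \<Rightarrow> 'x \<Rightarrow> poly2 \<Rightarrow> 'x::ab_group_add comm_env" where
  "env_of_poly2 h1 h2 p = poly (map_poly (\<lambda>q. poly (map_poly cemb q) (cc (UGen h1))) p) (cc (UGen
    h2))"

lemma env_of_poly2_hom:
  "env_of_poly2 h1 h2 (p + q) = env_of_poly2 h1 h2 p + env_of_poly2 h1 h2 q"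
  "env_of_poly2 h1 h2 (p * q) = env_of_poly2 h1 h2 p * env_of_poly2 h1 h2 q"
  "env_of_poly2 h1 h2 0 = 0" "env_of_poly2 h1 h2 1 = 1" "env_of_poly2 h1 h2 (const2 c) = cemb c"
  "env_of_poly2 h1 h2 (Hvar 1) = cc (UGen h1)" "env_of_poly2 h1 h2 (Hvar 2) = cc (UGen h2)"
proof -
  let ?f = "\<lambda>q. poly (map_poly cemb q) (cc (UGen h1))"
  have f: "?f (p + q) = ?f p + ?f q" "?f (p * q) = ?f p * ?f q" for p q
    by (rule poly_map_poly_add poly_map_poly_mult; rule cemb_hom)+
  show "env_of_poly2 h1 h2 (p + q) = env_of_poly2 h1 h2 p + env_of_poly2 h1 h2 q"
    unfolding env_of_poly2_def by (rule poly_map_poly_add; rule f)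
  show "env_of_poly2 h1 h2 (p * q) = env_of_poly2 h1 h2 p * env_of_poly2 h1 h2 q"
    unfolding env_of_poly2_def by (rule poly_map_poly_mult; rule f)
qed (simp_all add: env_of_poly2_def const2_def Hvar_def one_pCons map_poly_pCons cemb_hom)

text \<open>Both maps are multiplicative and additive, so it is enough to compare them on
  generators, where the basis expansion is used. This gives the injectivity of \<open>env_ev\<close>
  on the enveloping algebra.\<close>

lemma env_null_normal_form:
  assumes "\<And>x. x = sc (a x) h1 + sc (b x) h2" "\<And>x. L x =
    const2 (a x) * Hvar 1 + const2 (b x) * Hvar 2"
  shows "env_null sc (cc u - env_of_poly2 h1 h2 (env_ev L u))"
proof (induction u)
  case (UGen x)
  have "env_eq sc (\<lambda>_ _. 0) (UGen (sc (a x) h1 + sc (b x) h2))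
      (UAdd (UScale (a x) (UGen h1)) (UScale (b x) (UGen h2)))"
    by (meson env_eq.gen_add env_eq.gen_scale env_eq.cong_add env_eq.trans)
  then have "env_eq sc (\<lambda>_ _. 0) (UGen x) (UAdd (UScale (a x) (UGen h1)) (UScale (b x) (UGen h2)))"
    using assms(1)[of x] by metis
  then show ?case
    unfolding env_null_diff[symmetric] by (simp add: assms(2) env_of_poly2_hom[simplified])
next
  case (UAdd s t)
  show ?case
    using env_null_add[OF UAdd] by (simp add: env_of_poly2_hom algebra_simps)
next
  case (UScale c t)
  show ?case
    using env_null_mult[OF UScale, of "cemb c"] by (simp add: env_of_poly2_hom algebra_simps)
next
  case (UMult s t)
  show ?case
    using env_null_add[OF env_null_mult[OF UMult(1), of "cc t"]
        env_null_mult[OF UMult(2), of "env_of_poly2 h1 h2 (env_ev L s)"]]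
    by (simp add: env_of_poly2_hom algebra_simps)
qed (simp_all add: env_of_poly2_hom env_null_0)

lemma env_ev_eq_0:
  assumes "\<And>x. x = sc (a x) h1 + sc (b x) h2" "\<And>x. L x =
    const2 (a x) * Hvar 1 + const2 (b x) * Hvar 2"
    and "env_ev L u = 0"
  shows "env_eq sc (\<lambda>_ _. 0) u UZero"
  using env_null_normal_form[of sc a h1 b h2 L u, OF assms(1,2)] assms(3)
  by (simp add: env_of_poly2_hom env_null_cc)

lemma env_ev_surj:
  assumes "L h1 = Hvar 1" "L h2 = Hvar 2" shows "\<exists>u. env_ev L u = p"
proof (induction p)
  case (pCons q p)
  have "\<exists>u. env_ev L u = [:q:]"
  proof (induction q)
    case (pCons c q)
    then obtain u where "env_ev L u = [:q:]"
      by blast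
    then have "env_ev L (UAdd (UScale c UOne) (UMult (UGen h1) u)) = [:pCons c q:]"
      using assms(1) by (simp add: const2_def Hvar_def)
    then show ?case
      by blast
  qed (auto intro: exI[of _ UZero])
  then obtain u v where "env_ev L u = [:q:]" "env_ev L v = p"
    using pCons by blast
  then have "env_ev L (UAdd u (UMult (UGen h2) v)) = pCons q p"
    using assms(2) by (simp add: Hvar_def)
  then show ?case
    by blast
qed (auto intro: exI[of _ UZero])

section \<open>Modules over the Kac-Moody algebra\<close>

primrec term_act ::
  "(complex \<Rightarrow> 'm \<Rightarrow> 'm) \<Rightarrow> ('z \<Rightarrow> 'm \<Rightarrow> 'm) \<Rightarrow> 'z lie_term \<Rightarrow> 'm \<Rightarrow> 'm::ab_group_add" where
  "term_act sm op (LGen z) m = op z m"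
| "term_act sm op LZero m = 0"
| "term_act sm op (LAdd s t) m = term_act sm op s m + term_act sm op t m"
| "term_act sm op (LScale c t) m = sm c (term_act sm op t m)"
| "term_act sm op (LBr s t) m = term_act sm op s (term_act sm op t m) - term_act sm op t (term_act
  sm op s m)"

text \<open>A representative is chosen because independence of it holds only for linear operators on
  a vector space, which is assumed in \<open>term_act_cong\<close>.\<close>

definition free_act ::
  "(complex \<Rightarrow> 'm \<Rightarrow> 'm) \<Rightarrow> ('z \<Rightarrow> 'm \<Rightarrow> 'm) \<Rightarrow> 'z free_lie \<Rightarrow> 'm \<Rightarrow> 'm::ab_group_add" where
  "free_act sm op x = term_act sm op (SOME t. cls t = x)"

context
  fixes sm :: "complex \<Rightarrow> 'm::ab_group_add \<Rightarrow> 'm" and op :: "'z \<Rightarrow> 'm \<Rightarrow> 'm"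
  assumes vs: "vector_space sm" and lin: "\<And>z. Vector_Spaces.linear sm sm (op z)"
begin

interpretation vector_space sm by (rule vs)

lemma linear_term_act: "Vector_Spaces.linear sm sm (term_act sm op t)"
proof -
  have "term_act sm op t (x + y) = term_act sm op t x + term_act sm op t y \<and>
      term_act sm op t (sm c x) = sm c (term_act sm op t x)" for c x y
    using lin by (induction t arbitrary: c x y)
      (simp_all add: Vector_Spaces.linear_iff scale_right_distrib scale_right_diff_distrib
        mult.commute)
  then show ?thesis
    using vs by (simp add: Vector_Spaces.linear_iff)
qed

lemma term_act_simps:
  "term_act sm op t (x + y) = term_act sm op t x + term_act sm op t y"
  "term_act sm op t (sm c x) = sm c (term_act sm op t x)"
  "term_act sm op t (x - y) = term_act sm op t x - term_act sm op t y"
  "term_act sm op t 0 = 0"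
proof -
  show add: "term_act sm op t (x + y) = term_act sm op t x + term_act sm op t y" for x y
    using linear_term_act[of t] by (simp add: Vector_Spaces.linear_iff)
  show "term_act sm op t (sm c x) = sm c (term_act sm op t x)"
    using linear_term_act[of t] by (simp add: Vector_Spaces.linear_iff)
  show "term_act sm op t (x - y) = term_act sm op t x - term_act sm op t y"
    using add[of "x - y" y] by simp
  show "term_act sm op t 0 = 0"
    using add[of 0 0] by simp
qed

lemma term_act_cong: "lie_eq {} s t \<Longrightarrow> term_act sm op s m = term_act sm op t m"
proof (induction arbitrary: m rule: lie_eq.induct)
  case (add_neg t)
  then show ?case by simp
qed (simp_all add: term_act_simps scale_right_distrib scale_left_distrib scale_right_diff_distrib
      algebra_simps)

lemma free_act_cls: "free_act sm op (cls t) = term_act sm op t"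
proof -
  have "cls (SOME u. cls u = cls t) = cls t"
    by (rule someI_ex) blast
  then show ?thesis
    unfolding free_act_def using term_act_cong by (auto simp: cls_eq_iff fun_eq_iff)
qed

lemma free_act_simps:
  "free_act sm op (fgen z) m = op z m"
  "free_act sm op 0 m = 0"
  "free_act sm op (x + y) m = free_act sm op x m + free_act sm op y m"
  "free_act sm op (fscale c x) m = sm c (free_act sm op x m)"
  "free_act sm op (fbr x y) m = free_act sm op x (free_act sm op y m) - free_act sm op y (free_act
    sm op x m)"
proof -
  show "free_act sm op (fgen z) m = op z m"
    using free_act_cls[of "LGen z"] by simp
  show "free_act sm op 0 m = 0"
    using free_act_cls[of LZero] by simp
  obtain s t where "x = cls s" "y = cls t"
    using cls_surj by blast
  then show "free_act sm op (x + y) m = free_act sm op x m + free_act sm op y m"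
    "free_act sm op (fscale c x) m = sm c (free_act sm op x m)"
    "free_act sm op (fbr x y) m = free_act sm op x (free_act sm op y m) - free_act sm op y
      (free_act sm op x m)"
    using free_act_cls[of "LAdd s t"] free_act_cls[of "LScale c s"] free_act_cls[of "LBr s t"]
    by (simp_all add: free_act_cls)
qed

lemma linear_free_act: "Vector_Spaces.linear sm sm (free_act sm op x)"
  using cls_surj[of x] linear_term_act by (auto simp: free_act_cls)

end

lemma (in km_algebra) is_rep_free_act:
  assumes "vector_space sm" "\<And>z. Vector_Spaces.linear sm sm (op z)"
  shows "is_rep sm (free_act sm op)"
  using assms by (simp add: is_rep_def linear_free_act free_act_simps)

lemma vector_space_scale2: "vector_space scale2"
  by unfold_locales (simp_all add: scale2_def const2_simps algebra_simps)

lemma linear_scale2_iff: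
  "Vector_Spaces.linear scale2 scale2 f \<longleftrightarrow> (\<forall>p q. f (p + q) =
    f p + f q) \<and> (\<forall>c p. f (const2 c * p) = const2 c * f p)"
  using vector_space_scale2 by (auto simp: Vector_Spaces.linear_iff scale2_def)

subsection \<open>Serre relations for weighted shift operators\<close>

text \<open>A translation followed by multiplication with the function \<open>p\<close>. Commutators
  of such operators are again of this form, so a Serre relation becomes a pointwise identity;
  \<open>shift_bracket\<close> is the coefficient function of a commutator.\<close>

definition weighted_shift :: "(poly2 \<Rightarrow> poly2) \<Rightarrow> (complex \<Rightarrow> complex \<Rightarrow> complex) \<Rightarrow> complex \<Rightarrow> complex
  \<Rightarrow> bool" where
  "weighted_shift T p a b \<longleftrightarrow> (\<forall>g x y. ev2 (T g) x y = p x y * ev2 g (x + a) (y + b))"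

definition shift_bracket where
  "shift_bracket p a b q c d = (\<lambda>x y :: complex. p x y * q (x + a) (y + b) - q x y * p (x + c) (y
    + d) :: complex)"

lemma weighted_shift_commutator:
  assumes "weighted_shift T p a b" "weighted_shift U q c d" "\<And>g. V g = T (U g) - U (T g)"
  shows "weighted_shift V (shift_bracket p a b q c d) (a + c) (b + d)"
  unfolding weighted_shift_def
proof (intro allI)
  fix g x y
  have "ev2 (V g) x y = ev2 (T (U g)) x y - ev2 (U (T g)) x y"
    by (simp add: assms(3))
  then show "ev2 (V g) x y = shift_bracket p a b q c d x y * ev2 g (x + (a + c)) (y + (b + d))"
    using assms(1,2) by (simp add: weighted_shift_def shift_bracket_def algebra_simps)
qed

definition serre2 where
  "serre2 p a b q c d \<longleftrightarrow>
     (\<forall>x y. shift_bracket p a b (shift_bracket p a b q c d) (a + c) (b + d) x y = 0)"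

definition serre3 where
  "serre3 p a b q c d \<longleftrightarrow>
     (\<forall>x y. shift_bracket p a b (shift_bracket p a b (shift_bracket p a b q c d) (a + c) (b + d))
        (a + (a + c)) (b + (b + d)) x y = 0)"

definition idx :: "2 \<Rightarrow> nat" where
  "idx i = (if i = 1 then 1 else 2)"

definition shx :: "2 \<Rightarrow> complex" where
  "shx i = (if i = 1 then 1 else 0)"

definition shy :: "2 \<Rightarrow> complex" where
  "shy i = (if i = 1 then 0 else 1)"

lemma ev2_shift2_idx: "ev2 (shift2 (idx i) c p) x y = ev2 p (x + c * shx i) (y + c * shy i)"
  by (simp add: idx_def shx_def shy_def)

text \<open>The relations for the off-diagonal Cartan entries -1 and -s, for the e with \<epsilon> =
  -1 and for the f with \<epsilon> = 1. The cubic relation is included for s = 1 too, so that both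
  types share one statement.\<close>

definition serre_rels :: "complex \<Rightarrow> 2 \<Rightarrow> 2 \<Rightarrow> (nat \<Rightarrow> poly2) \<Rightarrow> complex \<Rightarrow> bool" where
  "serre_rels s i j P \<epsilon> \<longleftrightarrow>
     serre2 (ev2 (P (idx i))) (\<epsilon> * shx i) (\<epsilon> * shy i) (ev2 (P (idx j))) (\<epsilon> * shx j) (\<epsilon> * shy j) \<and>
     serre3 (ev2 (P (idx j))) (\<epsilon> * shx j) (\<epsilon> * shy j) (ev2 (P (idx i))) (\<epsilon> * shx i) (\<epsilon> * shy i) \<and>
     (s = 1 \<longrightarrow> serre2 (ev2 (P (idx j))) (\<epsilon> * shx j) (\<epsilon> * shy j) (ev2 (P (idx i))) (\<epsilon> * shx i) (\<epsilon> *
       shy i))"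

subsection \<open>Rank two\<close>

locale km2 = km_algebra sh \<alpha> \<alpha>v
  for sh :: "complex \<Rightarrow> 'h::ab_group_add \<Rightarrow> 'h" and \<alpha> :: "2 \<Rightarrow> 'h \<Rightarrow> complex" and \<alpha>v :: "2 \<Rightarrow> 'h" +
  fixes r s :: nat
  assumes cartan: "\<alpha> 1 (\<alpha>v 1) = 2" "\<alpha> 2 (\<alpha>v 2) = 2" "\<alpha> 2 (\<alpha>v 1) = - of_nat r" "\<alpha> 1 (\<alpha>v 2) =
    - of_nat s"

text \<open>The Cartan subalgebra has a basis dual to the simple roots, so that its enveloping
  algebra is the polynomial ring in H1 and H2.\<close>

locale km2_dual = km2 sh \<alpha> \<alpha>v r s
  for sh :: "complex \<Rightarrow> 'h::ab_group_add \<Rightarrow> 'h" and \<alpha> :: "2 \<Rightarrow> 'h \<Rightarrow> complex" and \<alpha>v :: "2 \<Rightarrow> 'h"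
    and r s :: nat +
  fixes H1 H2 :: 'h
  assumes dual: "\<alpha> 1 H1 = 1" "\<alpha> 2 H1 = 0" "\<alpha> 1 H2 = 0" "\<alpha> 2 H2 = 1"
    and span: "\<And>x. x = sh (\<alpha> 1 x) H1 + sh (\<alpha> 2 x) H2"

context km2
begin

text \<open>For linear \<nu> this extends to a homomorphism from the enveloping algebra to
  polynomials. Replacing h by h - \<open>\<alpha> i h\<close> becomes a translation of the variable
  with index i, whatever \<nu> is; see \<open>ev2_env_shift\<close>.\<close>

definition cartan_poly :: "('h \<Rightarrow> complex) \<Rightarrow> 'h \<Rightarrow> poly2" where
  "cartan_poly \<nu> x = const2 (\<alpha> 1 x) * Hvar 1 + const2 (\<alpha> 2 x) * Hvar 2 + const2 (\<nu> x)"

lemma ev2_cartan_poly [simp]: "ev2 (cartan_poly \<nu> h) x y = \<alpha> 1 h * x + \<alpha> 2 h * y + \<nu> h"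
  by (simp add: cartan_poly_def)

fun poly_op :: "(nat \<Rightarrow> poly2) \<Rightarrow> (nat \<Rightarrow> poly2) \<Rightarrow> ('h, 2) km_gen \<Rightarrow> poly2 \<Rightarrow> poly2" where
  "poly_op E F (KH x) g = cartan_poly (\<lambda>_. 0) x * g"
| "poly_op E F (KE i) g = E (idx i) * shift2 (idx i) (-1) g"
| "poly_op E F (KF i) g = F (idx i) * shift2 (idx i) 1 g"

lemma linear_poly_op: "Vector_Spaces.linear scale2 scale2 (poly_op E F z)"
  unfolding linear_scale2_iff
  by (cases z; intro conjI allI poly2_eqI) (simp_all add: ev2_shift2_idx algebra_simps)

abbreviation "poly_act E F \<equiv> free_act scale2 (poly_op E F)"

lemma poly_act_simps:
  "poly_act E F (fgen z) g = poly_op E F z g"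
  "poly_act E F 0 g = 0"
  "poly_act E F (x + y) g = poly_act E F x g + poly_act E F y g"
  "poly_act E F (fscale c x) g = scale2 c (poly_act E F x g)"
  "poly_act E F (fbr x y) g = poly_act E F x (poly_act E F y g) - poly_act E F y (poly_act E F x g)"
  by (rule free_act_simps[OF vector_space_scale2 linear_poly_op])+

lemma poly_act_diff: "poly_act E F (x - y) g = poly_act E F x g - poly_act E F y g"
  using poly_act_simps(3)[of E F "x - y" y g] by simp

lemma UNIV_2': "i = 1 \<or> i = (2 :: 2)"
  using exhaust_2 by blast

lemma poly_act_minus: "poly_act E F (- x) g = - poly_act E F x g"
  using poly_act_diff[of E F 0 x g] by (simp add: poly_act_simps(2))

lemma root_coordinates: "\<alpha> i x = \<alpha> 1 x * shx i + \<alpha> 2 x * shy i"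
  using UNIV_2'[of i] by (auto simp: shx_def shy_def)

text \<open>The relations [e_i, f_j] are the four identities of \<open>weyl_rels\<close>, multiplied
  by the value of g at the translated point; the others hold for arbitrary E and F.\<close>

lemma poly_act_rels:
  assumes "weyl_rels r s 0 0 E F" "(t, t') \<in> R"
  shows "poly_act E F (cls t) g = poly_act E F (cls t') g"
  using assms(2)
proof (cases rule: km_rels.cases)
  case (e_f i j)
  have E: "ev2 (E (Suc 0)) x y * ev2 (F (Suc 0)) (x - 1) y - ev2 (F (Suc 0)) x y * ev2 (E (Suc 0))
    (x + 1) y = 2 * x - of_nat r * y"
    "ev2 (E 2) x y * ev2 (F 2) x (y - 1) - ev2 (F 2) x y * ev2 (E 2) x (y + 1) =
      2 * y - of_nat s * x"
    "ev2 (E (Suc 0)) x y * ev2 (F 2) (x - 1) y = ev2 (F 2) x y * ev2 (E (Suc 0)) x (y + 1)"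
    "ev2 (E 2) x y * ev2 (F (Suc 0)) x (y - 1) = ev2 (F (Suc 0)) x y * ev2 (E 2) (x + 1) y" for x y
    using assms(1) by (simp_all add: weyl_rels_def)
  show ?thesis
  proof (rule poly2_eqI)
    fix x y
    note [simp] = poly_act_simps idx_def cartan
    have "(i = 1 \<or> i = 2) \<and> (j = 1 \<or> j = 2)"
      using UNIV_2' by blast
    then show "ev2 (poly_act E F (cls t) g) x y = ev2 (poly_act E F (cls t') g) x y"
    proof (elim conjE disjE)
      assume ij: "i = 1" "j = 1"
      show ?thesis
        using arg_cong[OF E(1)[of x y], of "\<lambda>t. t * ev2 g x y"] by (simp add: e_f ij algebra_simps)
    next
      assume ij: "i = 1" "j = 2"
      show ?thesis
        using arg_cong[OF E(3)[of x y], of "\<lambda>t. t * ev2 g (x - 1) (y + 1)"]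
          by (simp add: e_f ij algebra_simps)
    next
      assume ij: "i = 2" "j = 1"
      show ?thesis
        using arg_cong[OF E(4)[of x y], of "\<lambda>t. t * ev2 g (x + 1) (y - 1)"]
          by (simp add: e_f ij algebra_simps)
    next
      assume ij: "i = 2" "j = 2"
      show ?thesis
        using arg_cong[OF E(2)[of x y], of "\<lambda>t. t * ev2 g x y"] by (simp add: e_f ij algebra_simps)
    qed
  qed
next
  case (h_e x i)
  show ?thesis
    unfolding h_e root_coordinates[of i x]
    by (rule poly2_eqI) (simp add: poly_act_simps ev2_shift2_idx scale2_def algebra_simps)
next
  case (h_f x i)
  show ?thesis
    unfolding h_f root_coordinates[of i x]
    by (rule poly2_eqI) (simp add: poly_act_simps poly_act_minus poly_act_diff ev2_shift2_idx
      scale2_def algebra_simps)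
qed (auto intro!: poly2_eqI simp: poly_act_simps root_add root_scale scale2_def algebra_simps)

definition annihilator :: "(nat \<Rightarrow> poly2) \<Rightarrow> (nat \<Rightarrow> poly2) \<Rightarrow> ('h, 2) km_gen free_lie set" where
  "annihilator E F = {x. \<forall>g. poly_act E F x g = 0}"

lemma poly_act_0: "poly_act E F x 0 = 0"
proof -
  have "Vector_Spaces.linear scale2 scale2 (poly_act E F x)"
    by (rule linear_free_act[OF vector_space_scale2 linear_poly_op])
  then show ?thesis
    unfolding linear_scale2_iff by (metis add_cancel_right_right)
qed

lemma fideal_annihilator: "fideal (annihilator E F)"
  by (simp add: fideal_def annihilator_def poly_act_simps scale2_def poly_act_0)

lemma K_subset_annihilator: "weyl_rels r s 0 0 E F \<Longrightarrow> K \<subseteq> annihilator E F"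
  by (rule rel_ideal_least[OF fideal_annihilator])
    (auto simp: annihilator_def poly_act_diff dest: poly_act_rels)

lemma serre_annihilator:
  assumes "serre_rels c i j E (-1)" "serre_rels c i j F 1"
  shows "fbr (ee i) (fbr (ee i) (ee j)) \<in> annihilator E F"
    "fbr (ee j) (fbr (ee j) (fbr (ee j) (ee i))) \<in> annihilator E F"
    "c = 1 \<Longrightarrow> fbr (ee j) (fbr (ee j) (ee i)) \<in> annihilator E F"
    "fbr (ff i) (fbr (ff i) (ff j)) \<in> annihilator E F"
    "fbr (ff j) (fbr (ff j) (fbr (ff j) (ff i))) \<in> annihilator E F"
    "c = 1 \<Longrightarrow> fbr (ff j) (fbr (ff j) (ff i)) \<in> annihilator E F"
proof -
  let ?T = "poly_act E F"
  have e: "weighted_shift (?T (ee k)) (ev2 (E (idx k))) (-1 * shx k) (-1 * shy k)" for k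
    by (simp add: weighted_shift_def poly_act_simps ev2_shift2_idx)
  have f: "weighted_shift (?T (ff k)) (ev2 (F (idx k))) (1 * shx k) (1 * shy k)" for k
    by (simp add: weighted_shift_def poly_act_simps ev2_shift2_idx)
  have br: "weighted_shift (?T (fbr u v)) (shift_bracket p a b q c d) (a + c) (b + d)"
    if "weighted_shift (?T u) p a b" "weighted_shift (?T v) q c d" for u v p a b q c d
    by (rule weighted_shift_commutator[OF that]) (simp add: poly_act_simps)
  have null: "u \<in> annihilator E F" if "weighted_shift (?T u) p a b" "\<forall>x y. p x y = 0" for u p a b
    using that by (auto simp: annihilator_def weighted_shift_def intro: poly2_eqI)
  show "fbr (ee i) (fbr (ee i) (ee j)) \<in> annihilator E F"
    by (rule null[OF br[OF e br[OF e e]]]) (use assms(1) in \<open>simp add: serre_rels_def serre2_def\<close>)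
  show "fbr (ee j) (fbr (ee j) (fbr (ee j) (ee i))) \<in> annihilator E F"
    by (rule null[OF br[OF e br[OF e br[OF e e]]]]) (use assms(1) in \<open>simp add: serre_rels_def
      serre3_def\<close>)
  show "fbr (ff i) (fbr (ff i) (ff j)) \<in> annihilator E F"
    by (rule null[OF br[OF f br[OF f f]]]) (use assms(2) in \<open>simp add: serre_rels_def serre2_def\<close>)
  show "fbr (ff j) (fbr (ff j) (fbr (ff j) (ff i))) \<in> annihilator E F"
    by (rule null[OF br[OF f br[OF f br[OF f f]]]]) (use assms(2) in \<open>simp add: serre_rels_def
      serre3_def\<close>)
  assume c: "c = 1"
  show "fbr (ee j) (fbr (ee j) (ee i)) \<in> annihilator E F"
    by (rule null[OF br[OF e br[OF e e]]]) (use assms(1) c in \<open>simp add: serre_rels_def serre2_def\<close>)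
  show "fbr (ff j) (fbr (ff j) (ff i)) \<in> annihilator E F"
    by (rule null[OF br[OF f br[OF f f]]]) (use assms(2) c in \<open>simp add: serre_rels_def serre2_def\<close>)
qed

lemma env_act_poly: "env_act scale2 (\<lambda>x g. cartan_poly (\<lambda>_. 0) x * g) u g =
  env_ev (cartan_poly (\<lambda>_. 0)) u * g"
  by (induction u arbitrary: g) (simp_all add: scale2_def algebra_simps)

lemma cartan_poly_linear:
  assumes "\<And>x y. \<nu> (x + y) = \<nu> x + \<nu> y" "\<And>c x. \<nu> (sh c x) = c * \<nu> x"
  shows "cartan_poly \<nu> (x + y) = cartan_poly \<nu> x + cartan_poly \<nu> y"
    "cartan_poly \<nu> (sh c x) = const2 c * cartan_poly \<nu> x"
  by (rule poly2_eqI; simp add: assms root_add root_scale algebra_simps)+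

end

subsection \<open>The polynomials of a module\<close>

text \<open>The automorphism h -> h - a(h) of the enveloping algebra, on terms.\<close>

primrec env_shift :: "('x \<Rightarrow> complex) \<Rightarrow> 'x env_term \<Rightarrow> 'x env_term" where
  "env_shift a (UGen x) = UAdd (UGen x) (UScale (- a x) UOne)"
| "env_shift a UZero = UZero"
| "env_shift a UOne = UOne"
| "env_shift a (UAdd s t) = UAdd (env_shift a s) (env_shift a t)"
| "env_shift a (UScale c t) = UScale c (env_shift a t)"
| "env_shift a (UMult s t) = UMult (env_shift a s) (env_shift a t)"

context km2
begin

lemma ev2_env_shift:
  "ev2 (env_ev (cartan_poly \<nu>) (env_shift (\<lambda>h. c * \<alpha> i h) u)) x y
   = ev2 (env_ev (cartan_poly \<nu>) u) (x - c * shx i) (y - c * shy i)"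
  by (induction u) (simp_all add: root_coordinates[of i] algebra_simps)

context
  fixes sm :: "complex \<Rightarrow> 'm::ab_group_add \<Rightarrow> 'm" and \<rho>
  assumes in_H: "in_H sh \<alpha> \<alpha>v sm \<rho>"
begin

abbreviation "\<tau> x \<equiv> \<rho> (kcls x)"
abbreviation "hact \<equiv> env_act sm (\<lambda>x. \<tau> (hh x))"

lemma rep_props: "is_rep sm (\<lambda>x. \<tau> x)" and free: "free_rank_one sh (\<lambda>_ _. 0) sm (\<lambda>x. \<tau> (hh x))"
  using in_H by (simp_all add: in_H_def lie_module_kac_moody_iff km_elem_eq)

interpretation vector_space sm
  using rep_props by (simp add: is_rep_def)

lemma rep_simps:
  "\<tau> x (m + m') = \<tau> x m + \<tau> x m'" "\<tau> x (sm c m) = sm c (\<tau> x m)"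
  "\<tau> (x + y) m = \<tau> x m + \<tau> y m" "\<tau> (fscale c x) m = sm c (\<tau> x m)"
  "\<tau> (fbr x y) m = \<tau> x (\<tau> y m) - \<tau> y (\<tau> x m)"
  using rep_props by (simp_all add: is_rep_def Vector_Spaces.linear_iff)

lemma rep_zero: "\<tau> x 0 = 0" "\<tau> 0 m = 0"
  using rep_simps(1)[of x 0 0] rep_simps(3)[of 0 0 m] by simp_all

lemma rep_cong: "x - y \<in> K \<Longrightarrow> \<tau> x = \<tau> y"
  using K_subset_Rad by (metis kcls_eq_iff subsetD)

lemma hact_simps: "hact u (m + m') = hact u m + hact u m'" "hact u (sm c m) = sm c (hact u m)"
  by (induction u arbitrary: m m' c) (simp_all add: rep_simps scale_right_distrib mult.commute
    algebra_simps)

lemma hact_cong: "env_eq sh (\<lambda>_ _. 0) u u' \<Longrightarrow> hact u m = hact u' m"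
proof (induction arbitrary: m rule: env_eq.induct)
  case (gen_add x y)
  then show ?case
    using rep_cong[OF hh_add] by (simp add: rep_simps)
next
  case (gen_scale c x)
  then show ?case
    using rep_cong[OF hh_scale] by (simp add: rep_simps)
next
  case (gen_br x y)
  have "\<tau> (hh 0) m = 0" "\<tau> (fbr (hh x) (hh y)) m = 0"
    using rep_cong[of _ 0] hh_0 br_hh by (simp_all add: rep_zero)
  then show ?case
    by (simp add: rep_simps)
qed (simp_all add: hact_simps scale_right_distrib scale_left_distrib algebra_simps)

text \<open>On the module [h, z] = a(h) z reads z h = (h - a(h)) z, which extends multiplicatively
  to all \<open>u\<close>.\<close>

lemma root_vector_hact:
  assumes "\<And>x. fbr (hh x) z - fscale (a x) z \<in> K"
  shows "\<tau> z (hact u m) = hact (env_shift a u) (\<tau> z m)"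
proof (induction u arbitrary: m)
  case (UGen x)
  have "\<tau> (fbr (hh x) z) m = sm (a x) (\<tau> z m)"
    using rep_cong[OF assms] by (simp add: rep_simps)
  then show ?case
    by (simp add: rep_simps algebra_simps)
qed (simp_all add: rep_simps rep_zero)

text \<open>Each e_i and f_i sends the free generator v to a multiple of v by an element of the
  enveloping algebra. Freeness turns the relation [e_i, f_j] on v into an identity in that algebra,
  and only this identity is mapped to polynomials; so \<nu> is arbitrary and the dimension of the
  Cartan subalgebra does not matter.\<close>

lemma module_polys:
  assumes \<nu>: "\<And>x y. \<nu> (x + y) = \<nu> x + \<nu> y" "\<And>c x. \<nu> (sh c x) = c * \<nu> x"
  obtains v uE uF where
    "\<And>m. \<exists>u. hact u v = m" "\<And>u. hact u v = 0 \<Longrightarrow> env_eq sh (\<lambda>_ _. 0) u UZero"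
    "\<And>i. \<tau> (ee i) v = hact (uE i) v" "\<And>i. \<tau> (ff i) v = hact (uF i) v"
    "weyl_rels r s (\<nu> (\<alpha>v 1)) (\<nu> (\<alpha>v 2)) (\<lambda>n. env_ev (cartan_poly \<nu>) (uE (if n = 1 then 1 else 2)))
      (\<lambda>n. env_ev (cartan_poly \<nu>) (uF (if n = 1 then 1 else 2)))"
proof -
  obtain v where v: "\<And>m. \<exists>u. hact u v = m" "\<And>u. hact u v = 0 \<Longrightarrow> env_eq sh (\<lambda>_ _. 0) u UZero"
    using free unfolding free_rank_one_def by blast
  have "\<forall>i. \<exists>u. \<tau> (ee i) v = hact u v" "\<forall>i. \<exists>u. \<tau> (ff i) v = hact u v"
    using v(1) by metis+
  then obtain uE uF where uE: "\<And>i. \<tau> (ee i) v = hact (uE i) v" and uF: "\<And>i. \<tau> (ff i) v =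
    hact (uF i) v"
    by metis
  let ?ev = "env_ev (cartan_poly \<nu>)"
  have rel: "?ev (env_shift (\<lambda>h. 1 * \<alpha> i h) (uF j)) * ?ev (uE i) - ?ev (env_shift (\<lambda>h. -1 * \<alpha> j h)
    (uE i)) * ?ev (uF j)
      = (if i = j then cartan_poly \<nu> (\<alpha>v i) else 0)" for i j
  proof -
    define T where "T = (if i = j then UGen (\<alpha>v i) else UZero)"
    let ?u = "UAdd (UMult (env_shift (\<lambda>h. 1 * \<alpha> i h) (uF j)) (uE i))
      (UScale (-1) (UAdd (UMult (env_shift (\<lambda>h. -1 * \<alpha> j h) (uE i)) (uF j)) T))"
    have e: "\<tau> (ee i) (\<tau> (ff j) v) = hact (env_shift (\<lambda>h. 1 * \<alpha> i h) (uF j)) (hact (uE i) v)"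
      unfolding uF uE[symmetric] by (rule root_vector_hact) (simp add: br_h_e)
    have f: "\<tau> (ff j) (\<tau> (ee i) v) = hact (env_shift (\<lambda>h. -1 * \<alpha> j h) (uE i)) (hact (uF j) v)"
      unfolding uE uF[symmetric] by (rule root_vector_hact) (use br_h_f in simp)
    have "\<tau> (fbr (ee i) (ff j)) v = hact T v"
      using rep_cong[OF br_e_f[of i j]] by (simp add: T_def rep_zero)
    then have "hact ?u v = 0"
      using e f by (simp add: rep_simps algebra_simps)
    then have "env_eq sh (\<lambda>_ _. 0) ?u UZero"
      by (rule v(2))
    then have "?ev ?u = ?ev UZero"
      by (rule env_ev_sound[OF cartan_poly_linear[OF \<nu>]])
    then show ?thesis
      by (simp add: const2_simps T_def algebra_simps split: if_splits)
  qed
  have rel': "ev2 (?ev (uF j)) (x - shx i) (y - shy i) * ev2 (?ev (uE i)) x y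
      - ev2 (?ev (uE i)) (x + shx j) (y + shy j) * ev2 (?ev (uF j)) x y
      = (if i = j then \<alpha> 1 (\<alpha>v i) * x + \<alpha> 2 (\<alpha>v i) * y + \<nu> (\<alpha>v i) else 0)" for i j x y
    using arg_cong[OF rel[of i j], of "\<lambda>p. ev2 p x y"] by (simp only: ev2_simps ev2_env_shift) simp
  show thesis
  proof (rule that[OF v uE uF])
    show "weyl_rels r s (\<nu> (\<alpha>v 1)) (\<nu> (\<alpha>v 2)) (\<lambda>n. ?ev (uE (if n = 1 then 1 else 2)))
      (\<lambda>n. ?ev (uF (if n = 1 then 1 else 2)))"
      unfolding weyl_rels_def
      using rel'[of 1 _ 1] rel'[of 2 _ 2] rel'[of 2 _ 1] rel'[of 1 _ 2]
      by (simp add: shx_def shy_def cartan algebra_simps)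
  qed
qed

end

end

context km2_dual
begin

lemma cartan_poly_0: "cartan_poly (\<lambda>_. 0) x = const2 (\<alpha> 1 x) * Hvar 1 + const2 (\<alpha> 2 x) * Hvar 2"
  by (simp add: cartan_poly_def const2_simps)

lemma env_ev_eq_0': "env_ev (cartan_poly (\<lambda>_. 0)) u = 0 \<Longrightarrow> env_eq sh (\<lambda>_ _. 0) u UZero"
  by (rule env_ev_eq_0[OF span cartan_poly_0])

lemma env_ev_surj': "\<exists>u. env_ev (cartan_poly (\<lambda>_. 0)) u = p"
  by (rule env_ev_surj[of _ H1 H2]) (simp_all add: cartan_poly_0 dual const2_simps)

text \<open>The action of the free Lie algebra descends once \<open>Rad\<close> acts by zero. The
  annihilator meets the Cartan subalgebra trivially because h acts on 1 by a linear form that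
  determines h. With i and j free, the case r = 2, s = 1 is included by exchanging the
  indices.\<close>

lemma module_exists:
  assumes rels: "weyl_rels r s 0 0 E F"
    and ij: "i \<noteq> j" "\<alpha> j (\<alpha>v i) = -1" "\<alpha> i (\<alpha>v j) = - c" "c = 1 \<or> c = 2"
    and serre: "serre_rels c i j E (-1)" "serre_rels c i j F 1"
  obtains \<rho> where "in_H sh \<alpha> \<alpha>v scale2 \<rho>" "\<And>z g. \<rho> (kcls (fgen z)) g = poly_op E F z g"
proof -
  let ?J = "annihilator E F"
  have K_J: "K \<subseteq> ?J"
    by (rule K_subset_annihilator[OF rels])
  have faithful: "x = 0" if "hh x \<in> ?J" for x
  proof -
    have "cartan_poly (\<lambda>_. 0) x * 1 = 0"
      using that unfolding annihilator_def mem_Collect_eq poly_act_simps poly_op.simps by blast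
    then have "ev2 (cartan_poly (\<lambda>_. 0) x) a b = 0" for a b
      by simp
    from this[of 1 0] this[of 0 1] have "\<alpha> 1 x = 0" "\<alpha> 2 x = 0"
      by simp_all
    then show "x = 0"
      using span[of x] module.scale_zero_left[OF vs_h[folded module_iff_vector_space]] by simp
  qed
  have "(UNIV :: 2 set) = {i, j}" "\<alpha> i (\<alpha>v i) = 2" "\<alpha> j (\<alpha>v j) = 2"
    using ij(1) UNIV_2' cartan by (auto, (metis UNIV_2')+)
  then have Rad_J: "Rad \<subseteq> ?J"
    using Rad_subset_finite_type[OF fideal_annihilator K_J faithful ij(1) _ ij(4) _ _ ij(2,3)]
      serre_annihilator[OF serre] by blast
  define \<rho> where "\<rho> X = poly_act E F (SOME x. kcls x = X)" for X
  have \<rho>: "\<rho> (kcls x) = poly_act E F x" for x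
  proof -
    have "kcls (SOME y. kcls y = kcls x) = kcls x"
      by (rule someI_ex) blast
    then have "(SOME y. kcls y = kcls x) - x \<in> ?J"
      using Rad_J by (auto simp: kcls_eq_iff)
    then show ?thesis
      unfolding \<rho>_def by (auto simp: annihilator_def poly_act_diff)
  qed
  have gen: "\<rho> (kcls (fgen z)) g = poly_op E F z g" for z g
    by (simp add: \<rho> poly_act_simps)
  have "lie_module (kac_moody sh \<alpha> \<alpha>v) scale2 \<rho>"
    using is_rep_free_act[OF vector_space_scale2 linear_poly_op]
    by (simp add: lie_module_kac_moody_iff \<rho>)
  moreover have "free_rank_one sh (\<lambda>_ _. 0) scale2 (\<lambda>x. \<rho> (km_elem sh \<alpha> \<alpha>v (KH x)))"
    unfolding free_rank_one_def
  proof (intro exI[of _ 1] conjI allI impI)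
    have act: "(\<lambda>x. \<rho> (km_elem sh \<alpha> \<alpha>v (KH x))) = (\<lambda>x g. cartan_poly (\<lambda>_. 0) x * g)"
      by (simp add: km_elem_eq gen fun_eq_iff)
    show "\<exists>u. env_act scale2 (\<lambda>x. \<rho> (km_elem sh \<alpha> \<alpha>v (KH x))) u 1 = m" for m
      using env_ev_surj'[of m] by (simp add: act env_act_poly)
    show "env_eq sh (\<lambda>_ _. 0) u UZero" if "env_act scale2 (\<lambda>x. \<rho> (km_elem sh \<alpha> \<alpha>v (KH x))) u 1 =
      0" for u
      using that env_ev_eq_0' by (simp add: act env_act_poly)
  qed
  ultimately show thesis
    using that[of \<rho>] gen by (simp add: in_H_def)
qed

lemma module_classify:
  fixes \<rho> :: "_ \<Rightarrow> 'm::ab_group_add \<Rightarrow> 'm"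
  assumes in_H: "in_H sh \<alpha> \<alpha>v sm \<rho>"
  obtains E F \<phi> where "weyl_rels r s 0 0 E F" "Vector_Spaces.linear sm scale2 \<phi>" "bij \<phi>"
    "\<And>z m. \<phi> (\<rho> (kcls (fgen z)) m) = poly_op E F z (\<phi> m)"
proof -
  let ?L = "cartan_poly (\<lambda>_. 0)" and ?act = "env_act sm (\<lambda>x. \<rho> (kcls (hh x)))"
  obtain v uE uF where v: "\<And>m. \<exists>u. ?act u v = m" "\<And>u. ?act u v = 0 \<Longrightarrow> env_eq sh (\<lambda>_ _. 0) u UZero"
    and uE: "\<And>i. \<rho> (kcls (ee i)) v = ?act (uE i) v" and uF: "\<And>i. \<rho> (kcls (ff i)) v = ?act (uF i) v"
    and rels: "weyl_rels r s 0 0 (\<lambda>n. env_ev ?L (uE (if n =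
      1 then 1 else 2))) (\<lambda>n. env_ev ?L (uF (if n = 1 then 1 else 2)))"
    by (rule module_polys[OF in_H, of "\<lambda>_. 0"]) auto
  interpret vector_space sm
    using rep_props[OF in_H] by (simp add: is_rep_def)
  have sound: "env_ev ?L u = env_ev ?L u'" if "env_eq sh (\<lambda>_ _. 0) u u'" for u u'
    by (rule env_ev_sound[OF cartan_poly_linear that]) simp_all
  \<comment> \<open>Freeness of v and the injectivity of \<open>env_ev\<close> together make
    \<open>\<phi>\<close> below well defined and injective.\<close>
  have eq_iff: "?act u v = ?act u' v \<longleftrightarrow> env_ev ?L u = env_ev ?L u'" for u u'
  proof -
    let ?d = "UAdd u (UScale (-1) u')"
    have "?act u v = ?act u' v \<longleftrightarrow> ?act ?d v = 0"
      by simp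
    also have "\<dots> \<longleftrightarrow> env_eq sh (\<lambda>_ _. 0) ?d UZero"
      using v(2) hact_cong[OF in_H, of ?d UZero v] by auto
    also have "\<dots> \<longleftrightarrow> env_ev ?L ?d = 0"
      using env_ev_eq_0'[of ?d] sound[of ?d UZero] by auto
    also have "\<dots> \<longleftrightarrow> env_ev ?L u = env_ev ?L u'"
      by (simp add: const2_simps)
    finally show ?thesis .
  qed
  define \<phi> where "\<phi> m = env_ev ?L (SOME u. ?act u v = m)" for m
  have \<phi>: "\<phi> (?act u v) = env_ev ?L u" for u
  proof -
    have "?act (SOME u'. ?act u' v = ?act u v) v = ?act u v"
      by (rule someI_ex) blast
    then show ?thesis
      by (simp add: \<phi>_def eq_iff)
  qed
  have add: "\<phi> (m + m') = \<phi> m + \<phi> m'" for m m'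
  proof -
    obtain u u' where "?act u v = m" "?act u' v = m'"
      using v(1) by blast
    then show ?thesis
      using \<phi>[of u] \<phi>[of u'] \<phi>[of "UAdd u u'"] by simp
  qed
  have scale: "\<phi> (sm c m) = scale2 c (\<phi> m)" for c m
  proof -
    obtain u where "?act u v = m"
      using v(1) by blast
    then show ?thesis
      using \<phi>[of u] \<phi>[of "UScale c u"] by (simp add: scale2_def)
  qed
  have "Vector_Spaces.linear sm scale2 \<phi>"
    using add scale vector_space_axioms vector_space_scale2 by (simp add: Vector_Spaces.linear_iff)
  moreover have "bij \<phi>"
  proof (rule bijI)
    show "inj \<phi>"
    proof (rule injI)
      fix m m' assume "\<phi> m = \<phi> m'"
      moreover obtain u u' where "?act u v = m" "?act u' v = m'"
        using v(1) by blast
      ultimately show "m = m'"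
        using \<phi>[of u] \<phi>[of u'] eq_iff by metis
    qed
    show "surj \<phi>"
      unfolding surj_def
    proof
      fix p
      obtain u where "env_ev ?L u = p"
        using env_ev_surj' by blast
      then show "\<exists>m. p = \<phi> m"
        using \<phi>[of u] by (intro exI[of _ "?act u v"]) simp
    qed
  qed
  moreover have "\<phi> (\<rho> (kcls (fgen z)) m) = poly_op (\<lambda>n. env_ev ?L (uE (if n = 1 then 1 else 2)))
      (\<lambda>n. env_ev ?L (uF (if n = 1 then 1 else 2))) z (\<phi> m)" for z m
  proof -
    obtain u where u: "?act u v = m"
      using v(1) by blast
    have idx: "(if idx i = 1 then 1 else 2) = i" for i
      using UNIV_2'[of i] by (auto simp: idx_def)
    show ?thesis
    proof (cases z)
      case (KH x)
      then show ?thesis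
        using \<phi>[of u] \<phi>[of "UMult (UGen x) u"] u by simp
    next
      case (KE i)
      have "\<rho> (kcls (ee i)) (?act u v) = ?act (env_shift (\<lambda>h. 1 * \<alpha> i h) u) (?act (uE i) v)"
        unfolding uE[symmetric] by (rule root_vector_hact[OF in_H]) (simp add: br_h_e)
      then have "\<phi> (\<rho> (kcls (ee i)) m) = env_ev ?L (UMult (env_shift (\<lambda>h. 1 * \<alpha> i h) u) (uE i))"
        using \<phi>[of "UMult (env_shift (\<lambda>h. 1 * \<alpha> i h) u) (uE i)"] u by simp
      also have "\<dots> = env_ev ?L (uE i) * shift2 (idx i) (-1) (\<phi> m)"
        using \<phi>[of u] u by (intro poly2_eqI) (simp only: env_ev.simps ev2_simps ev2_env_shift
          ev2_shift2_idx, simp)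
      finally show ?thesis
        using KE by (simp only: poly_op.simps idx)
    next
      case (KF i)
      have "\<rho> (kcls (ff i)) (?act u v) = ?act (env_shift (\<lambda>h. -1 * \<alpha> i h) u) (?act (uF i) v)"
        unfolding uF[symmetric] by (rule root_vector_hact[OF in_H]) (use br_h_f in simp)
      then have "\<phi> (\<rho> (kcls (ff i)) m) = env_ev ?L (UMult (env_shift (\<lambda>h. -1 * \<alpha> i h) u) (uF i))"
        using \<phi>[of "UMult (env_shift (\<lambda>h. -1 * \<alpha> i h) u) (uF i)"] u by simp
      also have "\<dots> = env_ev ?L (uF i) * shift2 (idx i) 1 (\<phi> m)"
        using \<phi>[of u] u by (intro poly2_eqI) (simp only: env_ev.simps ev2_simps ev2_env_shift
          ev2_shift2_idx, simp)
      finally show ?thesis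
        using KF by (simp only: poly_op.simps idx)
    qed
  qed
  ultimately show thesis
    using that rels by blast
qed

end

section \<open>The listed modules\<close>

lemma of_nat_2 [simp]: "(of_nat (Suc (Suc 0)) :: 2) = 2" "(of_nat 2 :: 2) = 2"
  by simp_all

lemma weyl_rels_A2_list:
  assumes "a $ 1 \<noteq> 0" "a $ 2 \<noteq> 0"
  shows "weyl_rels 1 1 0 0 (E_A2 a b S) (F_A2 a b S)"
  unfolding weyl_rels_def
  by (cases "Suc 0 \<in> S"; cases "2 \<in> S"; cases "3 \<in> S")
    (use assms in \<open>simp_all add: E_A2_def F_A2_def field_simps numeral_2_eq_2[symmetric]
      numeral_3_eq_3[symmetric]\<close>)

lemma weyl_rels_B2_list:
  assumes "a $ 1 \<noteq> 0" "a $ 2 \<noteq> 0"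
  shows "weyl_rels 1 2 0 0 (E_B2 a S) (F_B2 a S)"
  unfolding weyl_rels_def
  by (cases "Suc 0 \<in> S"; cases "2 \<in> S")
    (use assms in \<open>simp_all add: E_B2_def F_B2_def field_simps\<close>)

lemma serre_rels_A2_list: "serre_rels 1 1 2 (E_A2 a b S) (-1)" "serre_rels 1 1 2 (F_A2 a b S) 1"
proof -
  show "serre_rels 1 1 2 (E_A2 a b S) (-1)"
    unfolding serre_rels_def serre2_def serre3_def shift_bracket_def
    by (cases "Suc 0 \<in> S"; cases "2 \<in> S"; cases "3 \<in> S"; intro conjI allI impI;
        simp add: E_A2_def idx_def shx_def shy_def numeral_2_eq_2[symmetric]
          numeral_3_eq_3[symmetric]; algebra)
  show "serre_rels 1 1 2 (F_A2 a b S) 1"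
    unfolding serre_rels_def serre2_def serre3_def shift_bracket_def
    by (cases "Suc 0 \<in> S"; cases "2 \<in> S"; cases "3 \<in> S"; intro conjI allI impI;
        simp add: F_A2_def idx_def shx_def shy_def numeral_2_eq_2[symmetric]
          numeral_3_eq_3[symmetric]; algebra)
qed

lemma serre_rels_B2_list: "serre_rels 2 1 2 (E_B2 a S) (-1)" "serre_rels 2 1 2 (F_B2 a S) 1"
proof -
  show "serre_rels 2 1 2 (E_B2 a S) (-1)"
    unfolding serre_rels_def serre2_def serre3_def shift_bracket_def
    by (cases "Suc 0 \<in> S"; cases "2 \<in> S"; intro conjI allI impI;
        simp add: E_B2_def idx_def shx_def shy_def; algebra)
  show "serre_rels 2 1 2 (F_B2 a S) 1"
    unfolding serre_rels_def serre2_def serre3_def shift_bracket_def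
    by (cases "Suc 0 \<in> S"; cases "2 \<in> S"; intro conjI allI impI;
        simp add: F_B2_def idx_def shx_def shy_def; algebra)
qed

text \<open>The module \<open>M(a, {1, 2})\<close> of case (2) with the two indices exchanged and \<open>a\<close> chosen to clear
  denominators.\<close>

definition E_C2 :: "complex \<Rightarrow> complex \<Rightarrow> nat \<Rightarrow> poly2" where
  "E_C2 p q n = (if n = 1 then const2 p * (2 * Hvar 1 - 4 * Hvar 2 - 1) else const2 q)"

definition F_C2 :: "nat \<Rightarrow> poly2" where
  "F_C2 n = (if n = 1 then - (2 * Hvar 1 + 1) else - ((4 * Hvar 2 - 2 * Hvar 1 + 3) * (4 * Hvar 2
    - 2 * Hvar 1 + 1)))"

lemma weyl_rels_C2: "weyl_rels 2 1 0 0 (E_C2 (1/4) (1/16)) F_C2"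
  unfolding weyl_rels_def by (simp add: E_C2_def F_C2_def field_simps)

lemma serre_rels_C2: "serre_rels 2 2 1 (E_C2 p q) (-1)" "serre_rels 2 2 1 F_C2 1"
proof -
  show "serre_rels 2 2 1 (E_C2 p q) (-1)"
    unfolding serre_rels_def serre2_def serre3_def shift_bracket_def
    by (intro conjI allI impI; simp add: E_C2_def idx_def shx_def shy_def; algebra)
  show "serre_rels 2 2 1 F_C2 1"
    unfolding serre_rels_def serre2_def serre3_def shift_bracket_def
    by (intro conjI allI impI; simp add: F_C2_def idx_def shx_def shy_def; algebra)
qed

section \<open>Realizations of rank two Cartan matrices\<close>

lemma cartan2_nth [simp]:
  "cartan2 r s $ 1 $ 1 = 2" "cartan2 r s $ 1 $ 2 = - int r" "cartan2 r s $ 2 $ 1 =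
    - int s" "cartan2 r s $ 2 $ 2 = 2"
  by (simp_all add: cartan2_def)

text \<open>The determinant is 4 - r s.\<close>

lemma invertible_cartan2: "r * s \<noteq> 4 \<Longrightarrow> invertible (complex_mat (cartan2 r s))"
  unfolding invertible_det_nz det_2
  by (simp add: complex_mat_def) (metis (no_types, opaque_lifting) of_nat_eq_iff of_nat_mult
    of_nat_numeral)

lemma rank_invertible:
  fixes A :: "'a::field^'n^'n"
  assumes "invertible A" shows "rank A = CARD('n)"
proof -
  have "vec.span (rows A) = UNIV"
    using assms matrix_left_invertible_span_rows_gen[of A] unfolding invertible_def by blast
  then have "vec.dim (rows A) = vec.dim (UNIV :: ('a^'n) set)"
    by (metis vec.dim_span)
  then show ?thesis
    by (simp add: row_rank_def_gen card_cart_basis)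
qed

lemma realization_km2:
  assumes "realization (cartan2 r s) sh \<alpha> \<alpha>v" shows "km2 sh \<alpha> \<alpha>v r s"
proof -
  have vs: "vector_space sh" and lin: "\<And>i. Vector_Spaces.linear sh (*) (\<alpha> i)"
    and indep: "\<And>c. (\<And>x. (\<Sum>i\<in>UNIV. c i * \<alpha> i x) = 0) \<Longrightarrow> (\<forall>i. c i = 0)"
    and cartan: "\<And>i j. \<alpha> j (\<alpha>v i) = of_int (cartan2 r s $ i $ j)"
    using assms unfolding realization_def by blast+
  have add: "\<alpha> i (x + y) = \<alpha> i x + \<alpha> i y" and scale: "\<alpha> i (sh c x) = c * \<alpha> i x" for i c x y
    using lin[of i] by (simp_all add: Vector_Spaces.linear_iff)
  have indep2: "p = 0 \<and> q = 0" if "\<And>x. p * \<alpha> 1 x + q * \<alpha> 2 x = 0" for p q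
    using indep[of "\<lambda>i. if i = 1 then p else q"] that by (auto simp: UNIV_2) (metis zero_neq_one)+
  obtain x where x: "1 * \<alpha> 1 x + 0 * \<alpha> 2 x \<noteq> 0"
    using indep2[of 1 0] one_neq_zero by blast
  define x0 where "x0 = sh (inverse (\<alpha> 1 x)) x"
  have x0: "\<alpha> 1 x0 = 1"
    using x by (simp add: x0_def scale)
  \<comment> \<open>By independence \<alpha> 2 minus the multiple \<open>\<alpha> 2 x0\<close> of
    \<alpha> 1 is nonzero at some y; \<open>z\<close> is the projection of y to the kernel of
    \<alpha> 1 along x0.\<close>
  obtain y where y: "- \<alpha> 2 x0 * \<alpha> 1 y + 1 * \<alpha> 2 y \<noteq> 0"
    using indep2[of "- \<alpha> 2 x0" 1] one_neq_zero by blast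
  define z where "z = y + sh (- \<alpha> 1 y) x0"
  have z: "\<alpha> 1 z = 0" "\<alpha> 2 z \<noteq> 0"
    using x0 y by (simp_all add: z_def add scale mult.commute)
  have vals: "\<exists>x. \<forall>i. \<alpha> i x = c i" for c :: "2 \<Rightarrow> complex"
  proof -
    let ?x = "sh (c 1) x0 + sh ((c 2 - c 1 * \<alpha> 2 x0) / \<alpha> 2 z) z"
    have "\<alpha> 1 ?x = c 1" "\<alpha> 2 ?x = c 2"
      using z x0 by (simp_all add: add scale)
    then show ?thesis
      by (intro exI[of _ ?x]) (metis exhaust_2)
  qed
  show ?thesis
    by (intro km2.intro km_algebra.intro km2_axioms.intro vs lin vals) (simp_all add: cartan)
qed

lemma (in vector_space) independent_2_span:
  assumes dim: "dim UNIV = 2" and indep: "\<And>p q. scale p a + scale q b = 0 \<Longrightarrow> p = 0 \<and> q = 0"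
  shows "\<exists>p q. x = scale p a + scale q b"
proof -
  obtain B where B: "independent B" "UNIV \<subseteq> span B" "card B = 2"
    using basis_exists[of UNIV] dim by metis
  interpret finite_dimensional_vector_space scale B
    by unfold_locales (use B in \<open>auto simp: card_ge_0_finite\<close>)
  have ab: "a \<noteq> b"
    using indep[of 1 "-1"] by auto
  have "independent {a, b}"
  proof (rule independent_if_scalars_zero)
    fix f x assume sum: "(\<Sum>y\<in>{a, b}. scale (f y) y) = 0" "x \<in> {a, b}"
    then have "scale (f a) a + scale (f b) b = 0"
      using ab by simp
    then show "f x = 0"
      using indep[of "f a" "f b"] sum(2) by auto
  qed simp
  then have "UNIV \<subseteq> span {a, b}"
    by (intro card_ge_dim_independent) (use dim ab in auto)
  then have "x \<in> span {a, b}"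
    by blast
  then obtain k where "x - scale k a \<in> span {b}"
    by (auto simp: span_breakdown_eq)
  then obtain l where "x - scale k a - scale l b \<in> span {}"
    by (auto simp: span_breakdown_eq)
  then have "x = scale k a + scale l b"
    by (simp add: algebra_simps)
  then show ?thesis
    by blast
qed

text \<open>Applying \<alpha> j to \<open>dual_coroot\<close> i gives an entry of the product of the
  inverse matrix with the matrix. The two vectors are therefore independent, and they span because
  the prescribed dimension is 4 - 2.\<close>

lemma realization_km2_dual:
  assumes R: "realization (cartan2 r s) sh \<alpha> \<alpha>v" and rs: "r * s \<noteq> 4"
  shows "km2_dual sh \<alpha> \<alpha>v r s (dual_coroot (cartan2 r s) sh \<alpha>v 1) (dual_coroot (cartan2 r s) sh \<alpha>v
    2)"
proof -
  interpret km2 sh \<alpha> \<alpha>v r s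
    by (rule realization_km2[OF R])
  interpret vector_space sh
    by (rule vs_h)
  let ?A = "complex_mat (cartan2 r s)"
  let ?H = "dual_coroot (cartan2 r s) sh \<alpha>v"
  have inv: "invertible ?A"
    by (rule invertible_cartan2[OF rs])
  have "matrix_inv ?A ** ?A = mat 1"
    using inv unfolding invertible_def matrix_inv_def by (rule someI2_ex) simp
  then have mat: "(matrix_inv ?A ** ?A) $ i $ j = (if i = j then 1 else 0)" for i j
    by (simp add: mat_def)
  have A: "\<alpha> j (\<alpha>v i) = ?A $ i $ j" for i j
    using R by (simp add: realization_def complex_mat_def)
  have dual: "\<alpha> j (?H i) = (if i = j then 1 else 0)" for i j
    using mat[of i j] by (simp add: dual_coroot_def UNIV_2 sum_2 root_add root_scale A
      matrix_matrix_mult_def)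
  have "dim (UNIV :: 'a set) = 2"
    using R rank_invertible[OF inv] by (simp add: realization_def)
  have span: "x = sh (\<alpha> 1 x) (?H 1) + sh (\<alpha> 2 x) (?H 2)" for x
  proof -
    have "\<exists>p q. x = sh p (?H 1) + sh q (?H 2)"
    proof (rule independent_2_span)
      fix p q assume "sh p (?H 1) + sh q (?H 2) = 0"
      then have "\<alpha> i (sh p (?H 1) + sh q (?H 2)) = 0" for i
        using root_scale[of i 0 0] by simp
      from this[of 1] this[of 2] show "p = 0 \<and> q = 0"
        by (simp add: root_add root_scale dual)
    qed fact
    then show ?thesis
      by (auto simp: root_add root_scale dual)
  qed
  show ?thesis
    by unfold_locales (simp_all add: dual span[symmetric])
qed

lemma ex_functional:
  assumes "vector_space sh" "w \<noteq> 0"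
  obtains \<nu> :: "'h::ab_group_add \<Rightarrow> complex" where "\<And>x y. \<nu> (x + y) = \<nu> x + \<nu> y"
    "\<And>c x. \<nu> (sh c x) = c * \<nu> x" "\<nu> w \<noteq> 0"
proof -
  interpret vs1: vector_space sh
    by (rule assms(1))
  have vs2: "vector_space ((*) :: complex \<Rightarrow> complex \<Rightarrow> complex)"
    by unfold_locales (simp_all add: algebra_simps)
  interpret vector_space_pair sh "(*) :: complex \<Rightarrow> complex \<Rightarrow> complex"
    by (intro vector_space_pair.intro assms(1) vs2)
  have "vs1.independent {w}"
    using assms(2) by (simp add: vs1.dependent_single)
  then obtain \<nu> where "Vector_Spaces.linear sh (*) \<nu>" "\<nu> w = (1::complex)"
    using linear_independent_extend[of "{w}" "\<lambda>_. 1"] by auto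
  then show thesis
    using that[of \<nu>] by (simp add: Vector_Spaces.linear_iff)
qed

section \<open>The main theorem\<close>

text \<open>One functional that is nonzero on the coroot sum suffices: \<nu>1 + \<nu>2 is its value
  there, and 0 is the only value that \<open>weyl_rels_cartan\<close> has to avoid.\<close>

lemma (in km2) in_H_cartan:
  assumes in_H: "in_H sh \<alpha> \<alpha>v sm (\<rho> :: _ \<Rightarrow> 'm::ab_group_add \<Rightarrow> 'm)"
    and rs: "r > 0" "s > 0" and coroots: "\<alpha>v 1 + \<alpha>v 2 \<noteq> 0"
  shows "r * s \<le> 2"
proof -
  obtain \<nu> :: "'h \<Rightarrow> complex" where \<nu>: "\<And>x y. \<nu> (x + y) = \<nu> x + \<nu> y" "\<And>c x. \<nu> (sh c x) = c * \<nu> x"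
    "\<nu> (\<alpha>v 1 + \<alpha>v 2) \<noteq> 0"
    by (rule ex_functional[OF vs_h coroots]) blast
  obtain E F where "weyl_rels r s (\<nu> (\<alpha>v 1)) (\<nu> (\<alpha>v 2)) E F"
    by (rule module_polys[OF in_H \<nu>(1,2)]) blast
  then show ?thesis
    by (rule weyl_rels_cartan[OF _ rs]) (use \<nu>(1,3) in simp)
qed

context km2_dual
begin

lemma poly_op_cong:
  assumes "\<And>i. i \<in> {1, 2} \<Longrightarrow> E i = E' i \<and> F i = F' i"
  shows "poly_op E F z = poly_op E' F' z"
  using assms by (cases z) (auto simp: idx_def fun_eq_iff)

lemma acts_byI:
  assumes "dual_coroot A sh \<alpha>v 1 = H1" "dual_coroot A sh \<alpha>v 2 = H2"
    and "\<And>z g. \<rho> (kcls (fgen z)) g = poly_op E F z g"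
  shows "acts_by A sh \<alpha> \<alpha>v E F \<rho>"
  unfolding acts_by_def
  by (auto simp: km_elem_eq assms cartan_poly_0 dual const2_simps idx_def)

text \<open>Compatibility with the generators passes to sums, multiples and brackets, hence to the
  image of the free Lie algebra, which is the whole Kac-Moody algebra.\<close>

lemma lie_module_isoI:
  fixes \<rho> :: "_ \<Rightarrow> 'm::ab_group_add \<Rightarrow> 'm"
  assumes in_H: "in_H sh \<alpha> \<alpha>v sm \<rho>" "in_H sh \<alpha> \<alpha>v scale2 \<rho>'"
    and \<phi>: "Vector_Spaces.linear sm scale2 \<phi>" "bij \<phi>"
    and gen: "\<And>z m. \<phi> (\<rho> (kcls (fgen z)) m) = \<rho>' (kcls (fgen z)) (\<phi> m)"
  shows "lie_module_iso (kac_moody sh \<alpha> \<alpha>v) sm \<rho> scale2 \<rho>'"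
proof -
  have add: "\<phi> (m + m') = \<phi> m + \<phi> m'" and scale: "\<phi> (sm c m) = scale2 c (\<phi> m)" for c m m'
    using \<phi>(1) by (simp_all add: Vector_Spaces.linear_iff)
  have diff: "\<phi> (m - m') = \<phi> m - \<phi> m'" for m m'
    using add[of "m - m'" m'] by simp
  have "\<phi> 0 = 0"
    using add[of 0 0] by simp
  then have "\<phi> (\<rho> (kcls x) m) = \<rho>' (kcls x) (\<phi> m)" for x m
    by (induction x arbitrary: m rule: free_lie_induct)
      (simp_all add: gen add scale diff rep_zero(2)[OF in_H(1)] rep_zero(2)[OF in_H(2)]
        rep_simps(3-5)[OF in_H(1)] rep_simps(3-5)[OF in_H(2)])
  then show ?thesis
    unfolding lie_module_iso_def using \<phi> by (auto simp: kac_moody_simps)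
qed

lemma in_H_iso_listed:
  fixes \<rho> :: "_ \<Rightarrow> 'm::ab_group_add \<Rightarrow> 'm"
  assumes in_H: "in_H sh \<alpha> \<alpha>v sm \<rho>" "in_H sh \<alpha> \<alpha>v scale2 \<rho>'"
    and \<phi>: "Vector_Spaces.linear sm scale2 \<phi>" "bij \<phi>"
    and gen: "\<And>z m. \<phi> (\<rho> (kcls (fgen z)) m) = poly_op E F z (\<phi> m)"
      "\<And>z g. \<rho>' (kcls (fgen z)) g = poly_op E' F' z g"
    and eq: "\<And>i. i \<in> {1, 2} \<Longrightarrow> E i = E' i \<and> F i = F' i"
  shows "lie_module_iso (kac_moody sh \<alpha> \<alpha>v) sm \<rho> scale2 \<rho>'"
  using poly_op_cong[OF eq] by (intro lie_module_isoI[OF in_H \<phi>]) (simp add: gen)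

end

lemma A2_listed:
  assumes R: "realization (cartan2 1 1) sh \<alpha> \<alpha>v" and a: "a $ 1 \<noteq> 0" "a $ 2 \<noteq> 0"
  obtains \<rho> where "is_M_A2 sh \<alpha> \<alpha>v a b S \<rho>" "in_H sh \<alpha> \<alpha>v scale2 \<rho>"
    "\<And>z g. \<rho> (km_algebra.kcls sh \<alpha> \<alpha>v (fgen z)) g = km2.poly_op \<alpha> (E_A2 a b S) (F_A2 a b S) z g"
proof -
  interpret km2_dual sh \<alpha> \<alpha>v 1 1 "dual_coroot (cartan2 1 1) sh \<alpha>v 1" "dual_coroot (cartan2 1 1) sh
    \<alpha>v 2"
    by (rule realization_km2_dual[OF R]) simp
  obtain \<rho> where \<rho>: "in_H sh \<alpha> \<alpha>v scale2 \<rho>"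
    "\<And>z g. \<rho> (kcls (fgen z)) g = poly_op (E_A2 a b S) (F_A2 a b S) z g"
    by (rule module_exists[OF weyl_rels_A2_list[OF a], of 1 2 1]) (use cartan serre_rels_A2_list
      in auto)
  then show thesis
    using that acts_byI[OF HOL.refl HOL.refl \<rho>(2)] by (simp add: is_M_A2_def)
qed

lemma B2_listed:
  assumes R: "realization (cartan2 1 2) sh \<alpha> \<alpha>v" and a: "a $ 1 \<noteq> 0" "a $ 2 \<noteq> 0"
  obtains \<rho> where "is_M_B2 sh \<alpha> \<alpha>v a S \<rho>" "in_H sh \<alpha> \<alpha>v scale2 \<rho>"
    "\<And>z g. \<rho> (km_algebra.kcls sh \<alpha> \<alpha>v (fgen z)) g = km2.poly_op \<alpha> (E_B2 a S) (F_B2 a S) z g"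
proof -
  interpret km2_dual sh \<alpha> \<alpha>v 1 2 "dual_coroot (cartan2 1 2) sh \<alpha>v 1" "dual_coroot (cartan2 1 2) sh
    \<alpha>v 2"
    by (rule realization_km2_dual[OF R]) simp
  obtain \<rho> where \<rho>: "in_H sh \<alpha> \<alpha>v scale2 \<rho>"
    "\<And>z g. \<rho> (kcls (fgen z)) g = poly_op (E_B2 a S) (F_B2 a S) z g"
    by (rule module_exists[OF weyl_rels_B2_list[OF a], of 1 2 2]) (use cartan serre_rels_B2_list
      in auto)
  then show thesis
    using that acts_byI[OF HOL.refl HOL.refl \<rho>(2)] by (simp add: is_M_B2_def)
qed

lemma C2_nonempty:
  assumes R: "realization (cartan2 2 1) sh \<alpha> \<alpha>v"
  shows "\<exists>\<rho>. in_H sh \<alpha> \<alpha>v scale2 \<rho>"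
proof -
  interpret km2_dual sh \<alpha> \<alpha>v 2 1 "dual_coroot (cartan2 2 1) sh \<alpha>v 1" "dual_coroot (cartan2 2 1) sh
    \<alpha>v 2"
    by (rule realization_km2_dual[OF R]) simp
  show ?thesis
    by (rule module_exists[OF weyl_rels_C2, of 2 1 2]) (use cartan serre_rels_C2 in auto)
qed

lemma A2_complete:
  fixes \<rho> :: "_ \<Rightarrow> 'm::ab_group_add \<Rightarrow> 'm"
  assumes R: "realization (cartan2 1 1) sh \<alpha> \<alpha>v" and in_H: "in_H sh \<alpha> \<alpha>v sm \<rho>"
  shows "\<exists>a b S \<rho>'. a $ 1 \<noteq> 0 \<and> a $ 2 \<noteq> 0 \<and> S \<subseteq> {1, 2, 3} \<and> is_M_A2 sh \<alpha> \<alpha>v a b S \<rho>' \<and>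
    in_H sh \<alpha> \<alpha>v scale2 \<rho>' \<and> lie_module_iso (kac_moody sh \<alpha> \<alpha>v) sm \<rho> scale2 \<rho>'"
proof -
  interpret km2_dual sh \<alpha> \<alpha>v 1 1 "dual_coroot (cartan2 1 1) sh \<alpha>v 1" "dual_coroot (cartan2 1 1) sh
    \<alpha>v 2"
    by (rule realization_km2_dual[OF R]) simp
  obtain E F \<phi> where rels: "weyl_rels 1 1 0 0 E F" and \<phi>: "Vector_Spaces.linear sm scale2 \<phi>" "bij \<phi>"
    and gen: "\<And>z m. \<phi> (\<rho> (kcls (fgen z)) m) = poly_op E F z (\<phi> m)"
    by (rule module_classify[OF in_H]) blast
  obtain a b S where a: "a $ 1 \<noteq> 0" "a $ 2 \<noteq> 0" and S: "S \<subseteq> {1, 2, 3}"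
    and eq: "\<And>i. i \<in> {1, 2} \<Longrightarrow> E i = E_A2 a b S i \<and> F i = F_A2 a b S i"
    by (rule weyl_rels_A2[OF rels]) blast
  obtain \<rho>' where \<rho>': "is_M_A2 sh \<alpha> \<alpha>v a b S \<rho>'" "in_H sh \<alpha> \<alpha>v scale2 \<rho>'"
    "\<And>z g. \<rho>' (kcls (fgen z)) g = poly_op (E_A2 a b S) (F_A2 a b S) z g"
    by (rule A2_listed[OF R a]) blast
  have "lie_module_iso (kac_moody sh \<alpha> \<alpha>v) sm \<rho> scale2 \<rho>'"
    by (rule in_H_iso_listed[OF in_H \<rho>'(2) \<phi> gen \<rho>'(3) eq])
  then show ?thesis
    using a S \<rho>' by blast
qed

lemma B2_complete:
  fixes \<rho> :: "_ \<Rightarrow> 'm::ab_group_add \<Rightarrow> 'm"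
  assumes R: "realization (cartan2 1 2) sh \<alpha> \<alpha>v" and in_H: "in_H sh \<alpha> \<alpha>v sm \<rho>"
  shows "\<exists>a S \<rho>'. a $ 1 \<noteq> 0 \<and> a $ 2 \<noteq> 0 \<and> S \<subseteq> {1, 2} \<and> is_M_B2 sh \<alpha> \<alpha>v a S \<rho>' \<and>
    in_H sh \<alpha> \<alpha>v scale2 \<rho>' \<and> lie_module_iso (kac_moody sh \<alpha> \<alpha>v) sm \<rho> scale2 \<rho>'"
proof -
  interpret km2_dual sh \<alpha> \<alpha>v 1 2 "dual_coroot (cartan2 1 2) sh \<alpha>v 1" "dual_coroot (cartan2 1 2) sh
    \<alpha>v 2"
    by (rule realization_km2_dual[OF R]) simp
  obtain E F \<phi> where rels: "weyl_rels 1 2 0 0 E F" and \<phi>: "Vector_Spaces.linear sm scale2 \<phi>" "bij \<phi>"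
    and gen: "\<And>z m. \<phi> (\<rho> (kcls (fgen z)) m) = poly_op E F z (\<phi> m)"
    by (rule module_classify[OF in_H]) blast
  obtain a S where a: "a $ 1 \<noteq> 0" "a $ 2 \<noteq> 0" and S: "S \<subseteq> {1, 2}"
    and eq: "\<And>i. i \<in> {1, 2} \<Longrightarrow> E i = E_B2 a S i \<and> F i = F_B2 a S i"
    by (rule weyl_rels_B2[OF rels]) blast
  obtain \<rho>' where \<rho>': "is_M_B2 sh \<alpha> \<alpha>v a S \<rho>'" "in_H sh \<alpha> \<alpha>v scale2 \<rho>'"
    "\<And>z g. \<rho>' (kcls (fgen z)) g = poly_op (E_B2 a S) (F_B2 a S) z g"
    by (rule B2_listed[OF R a]) blast
  have "lie_module_iso (kac_moody sh \<alpha> \<alpha>v) sm \<rho> scale2 \<rho>'"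
    by (rule in_H_iso_listed[OF in_H \<rho>'(2) \<phi> gen \<rho>'(3) eq])
  then show ?thesis
    using a S \<rho>' by blast
qed

lemma realization_coroots_sum:
  assumes "realization (cartan2 r s) sh \<alpha> \<alpha>v" shows "\<alpha>v 1 + \<alpha>v 2 \<noteq> 0"
proof
  assume "\<alpha>v 1 + \<alpha>v 2 = 0"
  moreover have "sh 1 x = x" for x
    using assms by (simp add: realization_def vector_space_def)
  ultimately have "(\<Sum>i\<in>UNIV. sh ((\<lambda>_. 1) i) (\<alpha>v i)) = 0"
    by (simp add: sum_2)
  moreover have "\<forall>c. (\<Sum>i\<in>UNIV. sh (c i) (\<alpha>v i)) = 0 \<longrightarrow> (\<forall>i. c i = 0)"
    using assms unfolding realization_def by (elim conjE)
  from this[rule_format, of "\<lambda>_. 1"] have "(\<Sum>i\<in>UNIV. sh 1 (\<alpha>v i)) \<noteq> 0"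
    by auto
  ultimately show False
    by simp
qed

lemma in_H_cartan:
  assumes "realization (cartan2 r s) sh \<alpha> \<alpha>v" "r > 0" "s > 0"
    and "in_H sh \<alpha> \<alpha>v sm (\<rho> :: _ \<Rightarrow> 'm::ab_group_add \<Rightarrow> 'm)"
  shows "r * s \<le> 2"
  by (rule km2.in_H_cartan[OF realization_km2[OF assms(1)] assms(4,2,3) realization_coroots_sum[OF
    assms(1)]])

text \<open>The pairs are (1, 1), (1, 2) and (2, 1); the last one is outside both lists and has its
  own module.\<close>

lemma nonempty:
  assumes R: "realization (cartan2 r s) sh \<alpha> \<alpha>v" and rs: "r > 0" "s > 0" "r * s \<le> 2"
  shows "\<exists>\<rho>. in_H sh \<alpha> \<alpha>v scale2 \<rho>"
proof -
  have "r \<le> r * s" "s \<le> r * s"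
    using rs by simp_all
  then have "r = 1 \<or> r = 2" "s = 1 \<or> s = 2"
    using rs by linarith+
  then consider "r = 1" "s = 1" | "r = 1" "s = 2" | "r = 2" "s = 1"
    using rs(3) by fastforce
  then show ?thesis
  proof cases
    case 1
    show ?thesis
      by (rule A2_listed[OF R[unfolded 1], of "\<chi> i. 1" 0 "{}"]) auto
  next
    case 2
    show ?thesis
      by (rule B2_listed[OF R[unfolded 2], of "\<chi> i. 1" "{}"]) auto
  next
    case 3
    show ?thesis
      by (rule C2_nonempty[OF R[unfolded 3]])
  qed
qed

text \<open>The carrier type of a module is fixed within the statement. Nonemptiness is therefore
  expressed on \<open>poly2\<close>, where the listed modules live, while the bound on r s is
  repeated, and the completeness of the lists is stated, for an arbitrary carrier type
  \<open>'m\<close>.\<close>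

theorem theorem11:
  fixes r s :: nat
    and sh :: "complex \<Rightarrow> 'h::ab_group_add \<Rightarrow> 'h"
    and \<alpha> :: "2 \<Rightarrow> 'h \<Rightarrow> complex"
    and \<alpha>v :: "2 \<Rightarrow> 'h"
  assumes "r > 0" and "s > 0"
    and "realization (cartan2 r s) sh \<alpha> \<alpha>v"
  shows
    "((\<exists>sm (\<rho> :: ('h, 2) km_gen lie_term set set \<Rightarrow> poly2 \<Rightarrow> poly2). in_H sh \<alpha> \<alpha>v sm \<rho>)
        \<longleftrightarrow> r * s \<le> 2) \<and>
     (\<forall>sm (\<rho> :: ('h, 2) km_gen lie_term set set \<Rightarrow> 'm \<Rightarrow> 'm::ab_group_add).
        in_H sh \<alpha> \<alpha>v sm \<rho> \<longrightarrow> r * s \<le> 2) \<and>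
     (r = 1 \<and> s = 1 \<longrightarrow>
        (\<forall>a b S. a $ 1 \<noteq> 0 \<and> a $ 2 \<noteq> 0 \<and> S \<subseteq> {1, 2, 3} \<longrightarrow>
           (\<exists>\<rho>. is_M_A2 sh \<alpha> \<alpha>v a b S \<rho> \<and> in_H sh \<alpha> \<alpha>v scale2 \<rho>)) \<and>
        (\<forall>sm (\<rho> :: ('h, 2) km_gen lie_term set set \<Rightarrow> 'm \<Rightarrow> 'm).
           in_H sh \<alpha> \<alpha>v sm \<rho> \<longrightarrow>
           (\<exists>a b S \<rho>'. a $ 1 \<noteq> 0 \<and> a $ 2 \<noteq> 0 \<and> S \<subseteq> {1, 2, 3} \<and>
              is_M_A2 sh \<alpha> \<alpha>v a b S \<rho>' \<and> in_H sh \<alpha> \<alpha>v scale2 \<rho>' \<and>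
              lie_module_iso (kac_moody sh \<alpha> \<alpha>v) sm \<rho> scale2 \<rho>'))) \<and>
     (r = 1 \<and> s = 2 \<longrightarrow>
        (\<forall>a S. a $ 1 \<noteq> 0 \<and> a $ 2 \<noteq> 0 \<and> S \<subseteq> {1, 2} \<longrightarrow>
           (\<exists>\<rho>. is_M_B2 sh \<alpha> \<alpha>v a S \<rho> \<and> in_H sh \<alpha> \<alpha>v scale2 \<rho>)) \<and>
        (\<forall>sm (\<rho> :: ('h, 2) km_gen lie_term set set \<Rightarrow> 'm \<Rightarrow> 'm).
           in_H sh \<alpha> \<alpha>v sm \<rho> \<longrightarrow>
           (\<exists>a S \<rho>'. a $ 1 \<noteq> 0 \<and> a $ 2 \<noteq> 0 \<and> S \<subseteq> {1, 2} \<and>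
              is_M_B2 sh \<alpha> \<alpha>v a S \<rho>' \<and> in_H sh \<alpha> \<alpha>v scale2 \<rho>' \<and>
              lie_module_iso (kac_moody sh \<alpha> \<alpha>v) sm \<rho> scale2 \<rho>')))"
proof (intro conjI impI allI)
  note R = assms(3) and rs = assms(1,2)
  show "(\<exists>sm (\<rho> :: ('h, 2) km_gen lie_term set set \<Rightarrow> poly2 \<Rightarrow> poly2). in_H sh \<alpha> \<alpha>v sm \<rho>) \<longleftrightarrow> r * s \<le> 2"
    using in_H_cartan[OF R rs] nonempty[OF R rs] by blast
  show "r * s \<le> 2" if "in_H sh \<alpha> \<alpha>v sm \<rho>"
    for sm and \<rho> :: "('h, 2) km_gen lie_term set set \<Rightarrow> 'm \<Rightarrow> 'm"
    by (rule in_H_cartan[OF R rs that])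
  show "\<exists>\<rho>. is_M_A2 sh \<alpha> \<alpha>v a b S \<rho> \<and> in_H sh \<alpha> \<alpha>v scale2 \<rho>"
    if "r = 1 \<and> s = 1" "a $ 1 \<noteq> 0 \<and> a $ 2 \<noteq> 0 \<and> S \<subseteq> {1, 2, 3}" for a b S
    by (rule A2_listed[of sh \<alpha> \<alpha>v a b S]) (use R that in auto)
  show "\<exists>a b S \<rho>'. a $ 1 \<noteq> 0 \<and> a $ 2 \<noteq> 0 \<and> S \<subseteq> {1, 2, 3} \<and> is_M_A2 sh \<alpha> \<alpha>v a b S \<rho>' \<and>
      in_H sh \<alpha> \<alpha>v scale2 \<rho>' \<and> lie_module_iso (kac_moody sh \<alpha> \<alpha>v) sm \<rho> scale2 \<rho>'"
    if "r = 1 \<and> s = 1" "in_H sh \<alpha> \<alpha>v sm \<rho>"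
    for sm and \<rho> :: "('h, 2) km_gen lie_term set set \<Rightarrow> 'm \<Rightarrow> 'm"
    using A2_complete[OF _ that(2)] R that(1) by simp
  show "\<exists>\<rho>. is_M_B2 sh \<alpha> \<alpha>v a S \<rho> \<and> in_H sh \<alpha> \<alpha>v scale2 \<rho>"
    if "r = 1 \<and> s = 2" "a $ 1 \<noteq> 0 \<and> a $ 2 \<noteq> 0 \<and> S \<subseteq> {1, 2}" for a S
    by (rule B2_listed[of sh \<alpha> \<alpha>v a S]) (use R that in auto)
  show "\<exists>a S \<rho>'. a $ 1 \<noteq> 0 \<and> a $ 2 \<noteq> 0 \<and> S \<subseteq> {1, 2} \<and> is_M_B2 sh \<alpha> \<alpha>v a S \<rho>' \<and>
      in_H sh \<alpha> \<alpha>v scale2 \<rho>' \<and> lie_module_iso (kac_moody sh \<alpha> \<alpha>v) sm \<rho> scale2 \<rho>'"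
    if "r = 1 \<and> s = 2" "in_H sh \<alpha> \<alpha>v sm \<rho>"
    for sm and \<rho> :: "('h, 2) km_gen lie_term set set \<Rightarrow> 'm \<Rightarrow> 'm"
    using B2_complete[OF _ that(2)] R that(1) by simp
qed

end
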